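(* Let $1<p\le N$. Assume there are constants $\rho_0>0$ and $\gamma>p-1$ such that $\rho(x)\ge \rho_0(1+x_N)^\gamma$ for a.e. $x\in\mathbb{R}^N_+$. Then the problem $$-\mathrm{div}(\rho(x)|\nabla u|^{p-2}\nabla u)=a(x)|u|^{q-2}u-b(x)|u|^{s-2}u \ \text{ in } \mathbb{R}^N_+,\qquad |\nabla u|^{p-2}\nabla u\cdot\nu=0\ \text{ on } \mathbb{R}^{N-1},$$ has a nontrivial and nonnegative weak solution $u\in E$ when one of the following conditions occurs: (i) $1<q<s<p$ and $a,b\in L^1(\mathbb{R}^N_+)\cap\mathcal{K}_b$; (ii) $1<q<p<s<p^*$, $a\in L^1(\mathbb{R}^N_+)\cap\mathcal{K}_b$ and $b\in\mathcal{K}_0$.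
   Context: $p^*=Np/(N-p)$ if $p<N$ and $p^*=\infty$ if $p=N$. $\mathbb{R}^N_+=\{(x',x_N): x'\in\mathbb{R}^{N-1},\ x_N>0\}$, with boundary identified with $\mathbb{R}^{N-1}$ and unit outer normal $\nu$. The functions $\rho,a,b$ are positive and integrable on every bounded subset of $\mathbb{R}^N_+$. $C_\delta^\infty(\mathbb{R}^N_+)$ is the set of restrictions to $\mathbb{R}^N_+$ of functions in $C_0^\infty(\mathbb{R}^N)$ (smooth, compactly supported). $E$ is the completion (closure) of $C_\delta^\infty(\mathbb{R}^N_+)$ with respect to $\|u\|=\left(\int_{\mathbb{R}^N_+}\rho|\nabla u|^p\,dx\right)^{1/p}$; under the lower bound on $\rho$ it is identified with a space of weakly differentiable functions in $L^p(\mathbb{R}^N_+,(1+x_N)^{\gamma-p}dx)$. $\mathcal{K}_b=\{k\in C(\overline{\mathbb{R}^N_+},(0,\infty)): k(x)(1+x_N)^{p-\gamma}\in L^\infty(\mathbb{R}^N_+)\}$ and $\mathcal{K}_0=\{k\in C(\overline{\mathbb{R}^N_+},(0,\infty)): \lim_{|x|\to\infty}k(x)(1+x_N)^{p-\gamma}=0\}$. A weak solution of the problem is a function $u\in E$ such that $$\int_{\mathbb{R}^N_+}\rho|\nabla u|^{p-2}\nabla u\cdot\nabla\varphi\,dx=\int_{\mathbb{R}^N_+}\left(a|u|^{q-2}u-b|u|^{s-2}u\right)\varphi\,dx\quad\text{for every }\varphi\in C_\delta^\infty(\mathbb{R}^N_+).$$ *)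

theory Defs
  imports "HOL-Analysis.Analysis"
begin

text \<open>Points of \<open>\<real>\<^sup>N\<close> are pairs \<open>(x', x\<^sub>N)\<close> in \<open>\<real>\<^sup>N\<^sup>-\<^sup>1 \<times> \<real>\<close>, so that \<open>N = CARD('n) + 1 \<ge> 2\<close>. The product type
  carries the Euclidean norm and inner product. Nothing is lost by \<open>N \<ge> 2\<close>, since
  \<open>1 < p \<le> N\<close> is assumed throughout. All integrals are with respect to Lebesgue measure.\<close>

type_synonym 'n space = "(real ^ 'n) \<times> real"

definition half_space :: "('n::finite) space set" where
  "half_space = {x. 0 < snd x}"

definition critical_exponent :: "nat \<Rightarrow> real \<Rightarrow> ereal" where
  "critical_exponent N p = (if p < real N then ereal (real N * p / (real N - p)) else \<infinity>)"

definition integrable_on_bounded_subsets :: "('n::finite space \<Rightarrow> real) \<Rightarrow> bool" where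
  "integrable_on_bounded_subsets f \<longleftrightarrow>
     (\<forall>S. S \<in> sets lebesgue \<and> bounded S \<and> S \<subseteq> half_space \<longrightarrow> set_integrable lebesgue S f)"


fun C_times :: "nat \<Rightarrow> ('a::euclidean_space \<Rightarrow> real) \<Rightarrow> bool" where
  "C_times 0 f \<longleftrightarrow> continuous_on UNIV f"
| "C_times (Suc k) f \<longleftrightarrow> (\<forall>x. f differentiable (at x)) \<and>
     (\<forall>v. C_times k (\<lambda>x. frechet_derivative f (at x) v))"

definition smooth :: "('a::euclidean_space \<Rightarrow> real) \<Rightarrow> bool" where
  "smooth f \<longleftrightarrow> (\<forall>k. C_times k f)"

definition Cc_infinity :: "('a::euclidean_space) set \<Rightarrow> ('a \<Rightarrow> real) set" where
  "Cc_infinity \<Omega> = {\<phi>. smooth \<phi> \<and> compact (closure {x. \<phi> x \<noteq> 0}) \<and> closure {x. \<phi> x \<noteq> 0} \<subseteq> \<Omega>}"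

text \<open>An element of \<open>C\<^sub>\<delta>\<^sup>\<infinity>(\<real>\<^sup>N\<^sub>+)\<close> is represented by any of its extensions in \<open>C\<^sub>0\<^sup>\<infinity>(\<real>\<^sup>N)\<close>. Below, only
  its values and derivatives in the open half-space are used, and these do not depend on the
  extension. It need not vanish on the boundary.\<close>

definition C_delta_infinity :: "('n::finite space \<Rightarrow> real) set" where
  "C_delta_infinity = Cc_infinity UNIV"

definition grad :: "('a::euclidean_space \<Rightarrow> real) \<Rightarrow> 'a \<Rightarrow> 'a" where
  "grad \<phi> x = (\<Sum>i\<in>Basis. frechet_derivative \<phi> (at x) i *\<^sub>R i)"

definition locally_integrable :: "'a::euclidean_space set \<Rightarrow> ('a \<Rightarrow> 'b::euclidean_space) \<Rightarrow> bool" where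
  "locally_integrable \<Omega> f \<longleftrightarrow> (\<forall>K. compact K \<and> K \<subseteq> \<Omega> \<longrightarrow> set_integrable lebesgue K f)"

definition has_weak_gradient ::
  "'a::euclidean_space set \<Rightarrow> ('a \<Rightarrow> real) \<Rightarrow> ('a \<Rightarrow> 'a) \<Rightarrow> bool" where
  "has_weak_gradient \<Omega> u g \<longleftrightarrow> locally_integrable \<Omega> u \<and> locally_integrable \<Omega> g \<and>
     (\<forall>\<phi>\<in>Cc_infinity \<Omega>.
        (LINT x:\<Omega>|lebesgue. u x *\<^sub>R grad \<phi> x) = - (LINT x:\<Omega>|lebesgue. \<phi> x *\<^sub>R g x))"

definition weighted_Lp :: "real \<Rightarrow> real \<Rightarrow> ('n::finite space \<Rightarrow> real) set" where
  "weighted_Lp p \<gamma> = {u. u \<in> borel_measurable (lebesgue_on half_space) \<and>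
     set_integrable lebesgue half_space (\<lambda>x. \<bar>u x\<bar> powr p * (1 + snd x) powr (\<gamma> - p))}"

text \<open>The space \<open>E\<close>: the closure of \<open>C\<^sub>\<delta>\<^sup>\<infinity>\<close> for \<open>\<parallel>u\<parallel> = (\<integral> \<rho> |\<nabla>u|\<^sup>p)\<^sup>1\<^sup>/\<^sup>p\<close> inside the weakly differentiable functions
  of the weighted \<open>L\<^sup>p\<close> space; the last inequality says \<open>\<parallel>\<phi> - u\<parallel> < \<epsilon>\<close>. Under \<open>\<rho> \<ge> \<rho>\<^sub>0 (1 + x\<^sub>N)\<^sup>\<gamma>\<close> with
  \<open>\<gamma> > p - 1\<close>, Hardy's inequality makes every Cauchy sequence in \<open>C\<^sub>\<delta>\<^sup>\<infinity>\<close> converge in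
  the weighted \<open>L\<^sup>p\<close> space, and the norm determines the limit because the weighted \<open>L\<^sup>p\<close> space
  contains no nonzero constant. So this is the concrete form of the completion.\<close>

definition energy_space :: "('n::finite space \<Rightarrow> real) \<Rightarrow> real \<Rightarrow> real \<Rightarrow> ('n space \<Rightarrow> real) set" where
  "energy_space \<rho> p \<gamma> = {u \<in> weighted_Lp p \<gamma>. \<exists>g. has_weak_gradient half_space u g \<and>
     (\<forall>\<epsilon>>0. \<exists>\<phi>\<in>C_delta_infinity.
        (\<integral>\<^sup>+x\<in>half_space. ennreal (\<rho> x * norm (grad \<phi> x - g x) powr p) \<partial>lebesgue) < ennreal (\<epsilon> powr p))}"

definition K_b :: "real \<Rightarrow> real \<Rightarrow> ('n::finite space \<Rightarrow> real) set" where
  "K_b p \<gamma> = {k. continuous_on (closure half_space) k \<and> (\<forall>x\<in>closure half_space. 0 < k x) \<and>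
     (\<exists>C. AE x in lebesgue_on half_space. \<bar>k x * (1 + snd x) powr (p - \<gamma>)\<bar> \<le> C)}"

definition K_0 :: "real \<Rightarrow> real \<Rightarrow> ('n::finite space \<Rightarrow> real) set" where
  "K_0 p \<gamma> = {k. continuous_on (closure half_space) k \<and> (\<forall>x\<in>closure half_space. 0 < k x) \<and>
     ((\<lambda>x. k x * (1 + snd x) powr (p - \<gamma>)) \<longlongrightarrow> 0)
       (inf at_infinity (principal (closure half_space)))}"

text \<open>Since a nonintegrable function has Bochner integral \<open>0\<close>, the existence of both integrals is
  required explicitly. The convention \<open>0 powr r = 0\<close> gives \<open>|\<nabla>u|\<^sup>p\<^sup>-\<^sup>2 \<nabla>u = 0\<close> where \<open>\<nabla>u = 0\<close> and
  \<open>|u|\<^sup>q\<^sup>-\<^sup>2 u = 0\<close> where \<open>u = 0\<close>, also for exponents below \<open>2\<close>.\<close>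

definition weak_solution ::
  "('n::finite space \<Rightarrow> real) \<Rightarrow> ('n space \<Rightarrow> real) \<Rightarrow> ('n space \<Rightarrow> real) \<Rightarrow>
   real \<Rightarrow> real \<Rightarrow> real \<Rightarrow> real \<Rightarrow> ('n space \<Rightarrow> real) \<Rightarrow> bool" where
  "weak_solution \<rho> a b p \<gamma> q s u \<longleftrightarrow> u \<in> energy_space \<rho> p \<gamma> \<and>
     (\<exists>g. has_weak_gradient half_space u g \<and>
       (\<forall>\<phi>\<in>C_delta_infinity.
          set_integrable lebesgue half_space
            (\<lambda>x. \<rho> x * norm (g x) powr (p - 2) * (g x \<bullet> grad \<phi> x)) \<and>
          set_integrable lebesgue half_space
            (\<lambda>x. (a x * \<bar>u x\<bar> powr (q - 2) * u x - b x * \<bar>u x\<bar> powr (s - 2) * u x) * \<phi> x) \<and>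
          (LINT x:half_space|lebesgue. \<rho> x * norm (g x) powr (p - 2) * (g x \<bullet> grad \<phi> x)) =
          (LINT x:half_space|lebesgue.
             (a x * \<bar>u x\<bar> powr (q - 2) * u x - b x * \<bar>u x\<bar> powr (s - 2) * u x) * \<phi> x)))"

end

theory Submission
  imports Defs
begin

text \<open>The solution minimizes
  \<open>\<Phi> f = 1/p \<integral> \<rho> |\<nabla>f|^p - 1/q \<integral> a |f|^q + 1/s \<integral> b |f|^s\<close> over \<open>C\<^sub>\<delta>\<^sup>\<infinity>\<close>. Since \<open>q < p\<close> and \<open>a\<close> is integrable and bounded by a multiple of
  the Hardy weight, \<open>\<Phi>\<close> is coercive; it is negative at small multiples of a bump function. No compactness is needed:
  as a function of \<open>v = |f|^q\<close> the first term is convex (because \<open>q \<le> p\<close>), the second is linear and the third is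
  uniformly convex (because \<open>q < s\<close>), so the powers \<open>f\<^sub>n^q\<close> of a nonnegative minimizing sequence form a Cauchy sequence in
  \<open>L^(s/q)(b)\<close>, and a subsequence of \<open>f\<^sub>n\<close> converges almost everywhere. Vitali's theorem gives convergence in \<open>L^q(a)\<close>,
  and then ordinary midpoint convexity makes \<open>\<nabla>f\<^sub>n\<close> a Cauchy sequence in \<open>L^p(\<rho>)\<close>. The limit minimizes \<open>\<Phi>\<close> in all directions
  from \<open>C\<^sub>\<delta>\<^sup>\<infinity>\<close>, which is the weak equation. Both cases of the hypothesis give
  \<open>1 < q < min p s\<close>, so they need not be distinguished.\<close>

text \<open>The \<open>a\<close>-term enters with a minus sign, so the energy is not convex in
  \<open>f\<close>, and two almost minimizing functions cannot be compared directly through their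
  arithmetic mean. Along the mean of order \<open>q\<close> this term is exactly averaged and drops
  out; the gradient term does not increase, by Hoelder's inequality applied to the chain rule, and
  the midpoint defect of the \<open>b\<close>-term remains. This controls only the functions. The
  gradients need a second comparison, along arithmetic means, which is available once the
  \<open>a\<close>-term is known to converge. The mean of order \<open>q\<close> need not be smooth
  at zeros of the functions, so it is regularized with a parameter \<open>d\<close> that tends to 0.

  All comparisons are made between smooth functions with compact support. The minimizer appears only
  as a pair of limits, \<open>u\<close> for the functions and \<open>g\<close> for the gradients, so
  no calculus in the completion is required. Strong convergence of the gradients serves three times:
  in identifying \<open>g\<close> as the weak gradient of \<open>u\<close>, in placing
  \<open>u\<close> in the closure, and in the limit of the energies.\<close>

subsection \<open>Inequalities for powers of norms\<close>

text \<open>Convexity on the open half-line is extended to the endpoint 0, where the claim reduces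
  to \<open>t powr r \<le> t\<close> on the unit interval.\<close>

lemma powr_convex_combination:
  fixes x y t r :: real
  assumes "1 \<le> r" "0 \<le> x" "0 \<le> y" "0 \<le> t" "t \<le> 1"
  shows "((1 - t) * x + t * y) powr r \<le> (1 - t) * x powr r + t * y powr r"
proof -
  have le: "c powr r \<le> c" if "0 \<le> c" "c \<le> 1" for c :: real
    using powr_mono'[of 1 r c] that assms by (cases "c = 0") auto
  consider "x = 0" | "y = 0" | "0 < x" "0 < y" using assms by linarith
  then show ?thesis
  proof cases
    case 1
    have "t powr r * y powr r \<le> t * y powr r" using le[of t] assms by (intro mult_right_mono) auto
    then show ?thesis using 1 assms by (simp add: powr_mult)
  next
    case 2
    have "(1 - t) powr r * x powr r \<le> (1 - t) * x powr r" using le[of "1 - t"] assms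
      by (intro mult_right_mono) auto
    then show ?thesis using 2 assms by (simp add: powr_mult)
  next
    case 3
    then show ?thesis using convex_onD[OF powr_convex[OF assms(1)], of t x y] assms by simp
  qed
qed

lemma norm_powr_convex_combination:
  fixes x y :: "'v::real_normed_vector" and t r :: real
  assumes "1 \<le> r" "0 \<le> t" "t \<le> 1"
  shows "norm ((1 - t) *\<^sub>R x + t *\<^sub>R y) powr r \<le> (1 - t) * norm x powr r + t * norm y powr r"
proof -
  have "norm ((1 - t) *\<^sub>R x + t *\<^sub>R y) \<le> (1 - t) * norm x + t * norm y"
    using norm_triangle_ineq[of "(1 - t) *\<^sub>R x" "t *\<^sub>R y"] assms by simp
  then have "norm ((1 - t) *\<^sub>R x + t *\<^sub>R y) powr r \<le> ((1 - t) * norm x + t * norm y) powr r"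
    using assms by (intro powr_mono2) auto
  also have "\<dots> \<le> (1 - t) * norm x powr r + t * norm y powr r"
    using assms by (intro powr_convex_combination) auto
  finally show ?thesis .
qed

lemma norm_powr_midpoint_le:
  fixes x y :: "'v::real_normed_vector" and r :: real
  assumes "1 \<le> r"
  shows "norm ((1/2) *\<^sub>R (x + y)) powr r \<le> (norm x powr r + norm y powr r) / 2"
  using norm_powr_convex_combination[of r "1/2" x y] assms by (simp add: scaleR_add_right)

text \<open>The mean value theorem on the two halves of the interval compares the increments, and
  the derivative is strictly increasing since \<open>r - 1\<close> is positive. The left endpoint 0
  is settled by \<open>(1/2) powr r < 1/2\<close>.\<close>

lemma powr_strict_midpoint:
  fixes x y r :: real
  assumes r: "1 < r" and xy: "0 \<le> x" "x < y"
  shows "((x + y) / 2) powr r < (x powr r + y powr r) / 2"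
proof (cases "x = 0")
  case True
  have "(1/2::real) powr r < (1/2) powr 1" using r by (intro powr_less_mono') auto
  then have "(1/2) powr r * y powr r < (1/2) * y powr r" using xy True by (intro mult_strict_right_mono) auto
  then have "((1/2) * y) powr r < (1/2) * y powr r" using xy True by (subst powr_mult) auto
  then show ?thesis using True r by simp
next
  case False
  define m where "m = (x + y) / 2"
  have m: "x < m" "m < y" "0 < x" using False xy by (auto simp: m_def field_simps)
  have der: "DERIV (\<lambda>z. z powr r) z :> r * z powr (r - 1)" if "x \<le> z" for z
    using that m by (intro has_real_derivative_powr) auto
  obtain c1 where c1: "x < c1" "c1 < m" "m powr r - x powr r = (m - x) * (r * c1 powr (r - 1))"
    using MVT2[OF m(1), of "\<lambda>z. z powr r" "\<lambda>z. r * z powr (r - 1)"] der by auto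
  obtain c2 where c2: "m < c2" "c2 < y" "y powr r - m powr r = (y - m) * (r * c2 powr (r - 1))"
    using MVT2[OF m(2), of "\<lambda>z. z powr r" "\<lambda>z. r * z powr (r - 1)"] der m by auto
  have e: "y - m = m - x" by (simp add: m_def field_simps)
  have "c1 powr (r - 1) < c2 powr (r - 1)" using c1 c2 m r by (intro powr_less_mono2) auto
  then have "(m - x) * (r * c1 powr (r - 1)) < (m - x) * (r * c2 powr (r - 1))"
    using m r by (intro mult_strict_left_mono) auto
  then have "m powr r - x powr r < y powr r - m powr r" using c1 c2 e by simp
  then show ?thesis unfolding m_def[symmetric] by (simp add: field_simps)
qed

text \<open>Strict convexity of the scalar power forces equal norms. The triangle inequality is then
  an equality, which in an inner product space means that the vectors point in the same
  direction.\<close>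

lemma norm_powr_midpoint_eq:
  fixes x y :: "'v::real_inner" and r :: real
  assumes r: "1 < r" and eq: "norm ((1/2) *\<^sub>R (x + y)) powr r \<ge> (norm x powr r + norm y powr r) / 2"
  shows "x = y"
proof -
  have le: "norm ((1/2) *\<^sub>R (x + y)) \<le> (norm x + norm y) / 2" 
    using norm_triangle_ineq[of x y] by simp
  then have le': "norm ((1/2) *\<^sub>R (x + y)) powr r \<le> ((norm x + norm y) / 2) powr r"
    using r by (intro powr_mono2) auto
  have n: "norm x = norm y"
  proof (rule ccontr)
    assume "norm x \<noteq> norm y"
    then have "norm x < norm y \<or> norm y < norm x" by auto
    then have "((norm x + norm y) / 2) powr r < (norm x powr r + norm y powr r) / 2"
      using powr_strict_midpoint[OF r, of "norm x" "norm y"] powr_strict_midpoint[OF r, of "norm y" "norm x"]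
      by (auto simp: add.commute)
    then show False using le' eq by simp
  qed
  then have "norm x powr r \<le> norm ((1/2) *\<^sub>R (x + y)) powr r" using eq by simp
  then have "norm x \<le> norm ((1/2) *\<^sub>R (x + y))" using r
    by (metis le_less_linear norm_ge_zero not_less powr_less_mono2 less_trans zero_less_one)
  then have "norm (x + y) = norm x + norm y" using le n by auto
  then have "norm x *\<^sub>R y = norm y *\<^sub>R x" by (simp add: norm_triangle_eq)
  then show ?thesis using n by (cases "norm x = 0") auto
qed

lemma continuous_on_norm_powr:
  fixes h :: "'a::topological_space \<Rightarrow> 'v::real_normed_vector" and r :: real
  assumes "0 < r" "continuous_on A h"
  shows "continuous_on A (\<lambda>z. norm (h z) powr r)"
  using assms by (intro continuous_on_powr' continuous_on_norm continuous_on_const) auto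

text \<open>Uniform convexity in a form linear in the powers, so that it can be integrated against a
  weight; it treats all exponents \<open>r > 1\<close> alike, in contrast to Clarkson's
  inequalities. All terms are homogeneous of degree \<open>r\<close>, and in finite dimension the
  midpoint defect \<open>d\<close> has a positive minimum on the compact set \<open>S\<close> of
  normalized pairs whose difference is not small.\<close>

lemma powr_uniform_convexity:
  fixes r \<eta> :: real
  assumes r: "1 < r" and \<eta>: "0 < \<eta>"
  obtains K where "0 < K" "\<And>x y :: 'v::euclidean_space. norm (x - y) powr r \<le> \<eta> * (norm x powr r + norm y powr r)
      + K * ((norm x powr r + norm y powr r) / 2 - norm ((1/2) *\<^sub>R (x + y)) powr r)"
proof -
  define n where "n = (\<lambda>z::'v\<times>'v. norm (fst z) powr r + norm (snd z) powr r)"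
  define d where "d = (\<lambda>z::'v\<times>'v. n z / 2 - norm ((1/2) *\<^sub>R (fst z + snd z)) powr r)"
  define S where "S = {z::'v\<times>'v. n z = 1 \<and> \<eta> \<le> norm (fst z - snd z) powr r}"
  have le1: "c \<le> 1" if "c powr r + e powr r = 1" "0 \<le> c" for c e :: real
  proof (rule ccontr)
    assume "\<not> c \<le> 1"
    then have "1 powr r < c powr r" using r by (intro powr_less_mono2) auto
    moreover have "0 \<le> e powr r" by simp
    ultimately show False using that by simp
  qed
  have cn: "continuous_on UNIV n" unfolding n_def using r by (intro continuous_on_add continuous_on_norm_powr continuous_intros) auto
  have cd: "continuous_on UNIV d" unfolding d_def using r cn by (intro continuous_on_diff continuous_on_norm_powr continuous_intros) auto
  have cm: "continuous_on UNIV (\<lambda>z::'v\<times>'v. norm (fst z - snd z) powr r)" using r by (intro continuous_on_norm_powr continuous_intros) auto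
  have "closed S" unfolding S_def
    using continuous_closed_preimage[OF cn closed_UNIV, of "{1}"] continuous_closed_preimage[OF cm closed_UNIV, of "{\<eta>..}"]
    by (auto simp: vimage_def Collect_conj_eq intro!: closed_Int)
  moreover have "bounded S"
  proof -
    have "norm z \<le> 2" if "z \<in> S" for z
    proof -
      have "norm (fst z) \<le> 1" "norm (snd z) \<le> 1"
        using le1[of "norm (fst z)" "norm (snd z)"] le1[of "norm (snd z)" "norm (fst z)"] that
        by (auto simp: S_def n_def add.commute)
      then show ?thesis using norm_Pair_le[of "fst z" "snd z"] by simp
    qed
    then show ?thesis unfolding bounded_iff by blast
  qed
  ultimately have S: "compact S" by (simp add: compact_eq_bounded_closed)
  have dpos: "0 < d z" if "z \<in> S" for z
  proof (rule ccontr)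
    assume "\<not> 0 < d z"
    then have "fst z = snd z" unfolding d_def n_def by (intro norm_powr_midpoint_eq[OF r]) auto
    then show False using that \<eta> by (auto simp: S_def)
  qed
  obtain m where m: "0 < m" "\<And>z. z \<in> S \<Longrightarrow> m \<le> d z"
  proof (cases "S = {}")
    case True then show ?thesis using that[of 1] by auto
  next
    case False
    then obtain z0 where "z0 \<in> S" "\<And>z. z \<in> S \<Longrightarrow> d z0 \<le> d z"
      using continuous_attains_inf[OF S False continuous_on_subset[OF cd subset_UNIV]] by auto
    then show ?thesis using that[of "d z0"] dpos by auto
  qed
  have d0: "0 \<le> d z" for z using norm_powr_midpoint_le[of r "fst z" "snd z"] r by (auto simp: d_def n_def)
  \<comment> \<open>Either the difference is already below \<open>\<eta>\<close>, or
    \<open>z\<close> lies in \<open>S\<close>. Then \<open>d z\<close> is at least \<open>m\<close>,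
    and the second term alone reaches \<open>2 powr r\<close>, the largest value possible on the
    left.\<close>
  have unit: "norm (fst z - snd z) powr r \<le> \<eta> * n z + 2 powr r / m * d z" if "n z = 1" for z
  proof (cases "\<eta> \<le> norm (fst z - snd z) powr r")
    case True
    have "norm (fst z) \<le> 1" "norm (snd z) \<le> 1"
      using le1[of "norm (fst z)" "norm (snd z)"] le1[of "norm (snd z)" "norm (fst z)"] that
      by (auto simp: n_def add.commute)
    then have "norm (fst z - snd z) \<le> 2" using norm_triangle_ineq4[of "fst z" "snd z"] by simp
    then have "norm (fst z - snd z) powr r \<le> 2 powr r" using r by (intro powr_mono2) auto
    also have "\<dots> = 2 powr r / m * m" using m by simp
    also have "\<dots> \<le> 2 powr r / m * d z" using m(2)[of z] m(1) True that by (intro mult_left_mono) (auto simp: S_def)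
    finally show ?thesis using \<eta> that by simp
  next
    case False
    then show ?thesis using that d0[of z] m by (simp add: add_increasing2)
  qed
  show thesis
  proof (rule that[of "2 powr r / m"])
    show "0 < 2 powr r / m" using m by simp
    fix x y :: 'v
    define t where "t = n (x, y)"
    show "norm (x - y) powr r \<le> \<eta> * (norm x powr r + norm y powr r)
      + 2 powr r / m * ((norm x powr r + norm y powr r) / 2 - norm ((1/2) *\<^sub>R (x + y)) powr r)"
    proof (cases "t = 0")
      case True
      then have "x = 0" "y = 0" by (auto simp: t_def n_def add_nonneg_eq_0_iff)
      then show ?thesis by simp
    next
      case False
      then have t: "0 < t" unfolding t_def n_def by (simp add: less_le)
      \<comment> \<open>The factor that scales the pair to \<open>n = 1\<close>; by homogeneity it
        cancels at the end.\<close>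
      define c where "c = t powr (- 1 / r)"
      have c: "0 < c" "c powr r * t = 1"
      proof -
        have "c powr r = t powr (- 1)" unfolding c_def powr_powr using r by simp
        then show "c powr r * t = 1" using t by (simp add: powr_minus_divide)
      qed (use t in \<open>simp add: c_def\<close>)
      have sc: "norm (c *\<^sub>R v) powr r = c powr r * norm v powr r" for v :: 'v using c by (simp add: powr_mult)
      have e1: "n (c *\<^sub>R x, c *\<^sub>R y) = c powr r * n (x, y)" by (simp add: n_def sc distrib_left del: norm_scaleR)
      have e2: "norm (c *\<^sub>R x - c *\<^sub>R y) powr r = c powr r * norm (x - y) powr r"
        using sc[of "x - y"] by (simp add: scaleR_diff_right del: norm_scaleR)
      have e3: "norm ((1/2) *\<^sub>R (c *\<^sub>R x + c *\<^sub>R y)) powr r = c powr r * norm ((1/2) *\<^sub>R (x + y)) powr r"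
        using sc[of "(1/2) *\<^sub>R (x + y)"] by (simp add: scaleR_add_right scaleR_left_commute mult.commute del: norm_scaleR)
      have "norm (c *\<^sub>R x - c *\<^sub>R y) powr r \<le> \<eta> * n (c *\<^sub>R x, c *\<^sub>R y) + 2 powr r / m * d (c *\<^sub>R x, c *\<^sub>R y)"
        using unit[of "(c *\<^sub>R x, c *\<^sub>R y)"] c e1 by (simp add: t_def)
      then have "c powr r * norm (x - y) powr r \<le> c powr r * (\<eta> * n (x, y) + 2 powr r / m * d (x, y))"
        using c unfolding d_def fst_conv snd_conv e1 e2 e3 by (simp add: algebra_simps)
      then have "norm (x - y) powr r \<le> \<eta> * n (x, y) + 2 powr r / m * d (x, y)"
        using c by simp
      then show ?thesis by (simp add: d_def n_def)
    qed
  qed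
qed

text \<open>A substitute for the reverse triangle inequality at the level of \<open>r\<close>-th
  powers. If \<open>x\<close> is close to \<open>y\<close> relative to \<open>norm y\<close>, the
  ratio of the norms is near 1 and continuity of the power at 1 applies; otherwise both norms are
  bounded by a multiple of \<open>norm (x - y)\<close>.\<close>

lemma norm_powr_near:
  fixes r \<eta> :: real
  assumes r: "0 < r" and \<eta>: "0 < \<eta>"
  obtains K where "0 < K" "\<And>x y :: 'v::real_normed_vector.
    \<bar>norm x powr r - norm y powr r\<bar> \<le> \<eta> * norm y powr r + K * norm (x - y) powr r"
proof -
  have "isCont (\<lambda>t::real. t powr r) 1" using r by (intro continuous_intros) auto
  then obtain \<delta> where \<delta>: "0 < \<delta>" "\<And>t. \<bar>t - 1\<bar> < \<delta> \<Longrightarrow> \<bar>t powr r - 1\<bar> < \<eta>"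
    unfolding continuous_at_eps_delta using \<eta> by (auto simp: dist_real_def)
  show thesis
  proof (rule that[of "(1 + 1 / \<delta>) powr r"])
    have "0 < 1 + 1 / \<delta>" using \<delta> by (simp add: add_pos_pos)
    then show "0 < (1 + 1 / \<delta>) powr r" by simp
    fix x y :: 'v
    show "\<bar>norm x powr r - norm y powr r\<bar> \<le> \<eta> * norm y powr r + (1 + 1 / \<delta>) powr r * norm (x - y) powr r"
    proof (cases "norm (x - y) < \<delta> * norm y")
      case True
      then have y: "0 < norm y" using \<delta> by (metis norm_ge_zero mult_zero_right not_less less_le)
      define t where "t = norm x / norm y"
      have "\<bar>norm x - norm y\<bar> < \<delta> * norm y" using norm_triangle_ineq3[of x y] True by simp
      then have "\<bar>t - 1\<bar> * norm y < \<delta> * norm y" using y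
        by (simp add: t_def abs_mult[symmetric] left_diff_distrib abs_if split: if_splits)
          (auto simp: field_simps)
      then have "\<bar>t powr r - 1\<bar> < \<eta>" using \<delta>(2)[of t] y by (simp add: mult_less_cancel_right)
      moreover have "norm x powr r = t powr r * norm y powr r"
        using y by (subst powr_mult[symmetric]) (auto simp: t_def)
      then have "\<bar>norm x powr r - norm y powr r\<bar> = \<bar>t powr r - 1\<bar> * norm y powr r"
        by (metis abs_mult abs_of_nonneg left_diff_distrib mult_1 powr_ge_zero)
      ultimately have "\<bar>norm x powr r - norm y powr r\<bar> \<le> \<eta> * norm y powr r"
        by (simp add: mult_right_mono)
      then show ?thesis by (simp add: add_increasing2)
    next
      case False
      then have ny: "norm y \<le> norm (x - y) / \<delta>" using \<delta> by (simp add: field_simps)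
      then have "norm y \<le> (1 + 1 / \<delta>) * norm (x - y)" by (simp add: distrib_right add_increasing)
      moreover have "norm x \<le> norm (x - y) + norm y" using norm_triangle_sub[of x y] by (simp add: norm_minus_commute)
      with ny have "norm x \<le> (1 + 1 / \<delta>) * norm (x - y)" by (simp add: distrib_right)
      ultimately have "norm y powr r \<le> ((1 + 1 / \<delta>) * norm (x - y)) powr r" 
        "norm x powr r \<le> ((1 + 1 / \<delta>) * norm (x - y)) powr r" using r
        by (simp_all add: powr_mono2)
      moreover have "((1 + 1 / \<delta>) * norm (x - y)) powr r = (1 + 1 / \<delta>) powr r * norm (x - y) powr r"
        by (rule powr_mult)
      moreover have "0 \<le> norm x powr r" "0 \<le> norm y powr r" "0 \<le> \<eta> * norm y powr r" using \<eta> by auto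
      ultimately show ?thesis by linarith
    qed
  qed
qed

lemma norm_add_powr_le:
  fixes x y :: "'v::real_normed_vector" and r :: real
  assumes r: "0 < r"
  shows "norm (x + y) powr r \<le> 2 powr r * (norm x powr r + norm y powr r)"
proof -
  have "norm (x + y) \<le> 2 * max (norm x) (norm y)" using norm_triangle_ineq[of x y] by linarith
  then have "norm (x + y) powr r \<le> (2 * max (norm x) (norm y)) powr r" using r by (intro powr_mono2) auto
  also have "\<dots> = 2 powr r * max (norm x) (norm y) powr r" by (simp add: powr_mult)
  also have "\<dots> \<le> 2 powr r * (norm x powr r + norm y powr r)"
    by (intro mult_left_mono) (auto simp: max_def)
  finally show ?thesis .
qed

text \<open>For \<open>y \<le> x\<close> split \<open>x powr r\<close> as
  \<open>(x - y) * x powr (r - 1) + y * x powr (r - 1)\<close> and lower the second factors to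
  powers of \<open>x - y\<close> and \<open>y\<close>. This transfers convergence of
  \<open>q\<close>-th powers to the functions themselves.\<close>

lemma powr_diff_le:
  fixes x y r :: real
  assumes r: "1 \<le> r" and "0 \<le> x" "0 \<le> y"
  shows "\<bar>x - y\<bar> powr r \<le> \<bar>x powr r - y powr r\<bar>"
proof -
  have split: "t powr r = t * t powr (r - 1)" if "0 \<le> t" for t :: real
    using that by (cases "t = 0") (auto simp: powr_diff)
  have *: "(x - y) powr r \<le> x powr r - y powr r" if "0 \<le> y" "y \<le> x" for x y :: real
  proof -
    have "(x - y) * (x - y) powr (r - 1) \<le> (x - y) * x powr (r - 1)"
      using that r by (intro mult_left_mono powr_mono2) auto
    moreover have "y * y powr (r - 1) \<le> y * x powr (r - 1)"
      using that r by (intro mult_left_mono powr_mono2) auto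
    ultimately show ?thesis using split[of "x - y"] split[of x] split[of y] that by (simp add: algebra_simps)
  qed
  show ?thesis using *[of y x] *[of x y] assms by (cases "y \<le> x") (auto simp: abs_if)
qed

text \<open>The function \<open>\<tau> \<mapsto> norm (h + \<tau> *\<^sub>R k) powr r\<close> is
  convex, so its quotients for \<open>0 < t \<le> 1\<close> lie between the slopes towards -1 and 1.
  The bound does not depend on \<open>t\<close> and is the dominating function for differentiating
  under the integral.\<close>

lemma norm_powr_quotient_bound:
  fixes h k :: "'v::real_normed_vector" and r t :: real
  assumes r: "1 \<le> r" and t: "0 < t" "t \<le> 1"
  shows "\<bar>(norm (h + t *\<^sub>R k) powr r - norm h powr r) / t\<bar> \<le> norm (h + k) powr r + norm (h - k) powr r"
proof -
  define f where "f = (\<lambda>\<tau>. norm (h + \<tau> *\<^sub>R k) powr r)"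
  have pos: "0 \<le> f \<tau>" for \<tau> by (simp add: f_def)
  have "f t \<le> (1 - t) * f 0 + t * f 1"
    using norm_powr_convex_combination[OF r, of t "h" "h + k"] t by (simp add: f_def algebra_simps)
  then have "f t - f 0 \<le> t * f 1 - t * f 0" by (simp add: algebra_simps)
  also have "\<dots> \<le> t * f 1" using pos[of 0] t by simp
  finally have up: "f t - f 0 \<le> t * f 1" .
  \<comment> \<open>The weight for which \<open>h\<close> is the convex combination of
    \<open>h + t *\<^sub>R k\<close> and \<open>h - k\<close>.\<close>
  define \<theta> where "\<theta> = t / (1 + t)"
  have \<theta>: "0 \<le> \<theta>" "\<theta> \<le> 1" "1 - \<theta> = 1 / (1 + t)" using t by (auto simp: \<theta>_def field_simps)
  have h: "(1 - \<theta>) *\<^sub>R (h + t *\<^sub>R k) + \<theta> *\<^sub>R (h - k) = h"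
  proof -
    have "(1 - \<theta>) *\<^sub>R (h + t *\<^sub>R k) + \<theta> *\<^sub>R (h - k) = h + ((1 - \<theta>) * t - \<theta>) *\<^sub>R k"
      by (simp add: algebra_simps)
    also have "(1 - \<theta>) * t - \<theta> = 0" unfolding \<theta>(3) by (simp add: \<theta>_def)
    finally show ?thesis by simp
  qed
  have "f 0 \<le> (1 - \<theta>) * f t + \<theta> * f (-1)"
    using norm_powr_convex_combination[OF r \<theta>(1,2), of "h + t *\<^sub>R k" "h - k"] h by (simp add: f_def)
  then have "(1 + t) * f 0 \<le> (1 + t) * ((1 - \<theta>) * f t + \<theta> * f (-1))" using t by (intro mult_left_mono) auto
  also have "\<dots> = ((1 + t) * (1 - \<theta>)) * f t + ((1 + t) * \<theta>) * f (-1)" by (simp add: distrib_left mult.assoc)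
  also have "(1 + t) * (1 - \<theta>) = 1" using t by (simp add: \<theta>(3))
  also have "(1 + t) * \<theta> = t" using t by (simp add: \<theta>_def)
  also have "1 * f t + t * f (-1) = f t + t * f (-1)" by simp
  finally have "f 0 - f t \<le> t * f (-1) - t * f 0" by (simp add: algebra_simps)
  also have "\<dots> \<le> t * f (-1)" using pos[of 0] t by simp
  finally have low: "f 0 - f t \<le> t * f (-1)" .
  have "\<bar>f t - f 0\<bar> \<le> t * (f 1 + f (-1))" using up low pos[of 1] pos[of "-1"] t
    by (simp add: abs_le_iff distrib_left) (smt (verit) mult_nonneg_nonneg)
  then have "\<bar>(f t - f 0) / t\<bar> \<le> f 1 + f (-1)" using t by (simp add: field_simps)
  then show ?thesis by (simp add: f_def)
qed

text \<open>At \<open>h = 0\<close> the quotient is \<open>t powr (r - 1) * norm k powr r\<close>,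
  which tends to 0 because \<open>r > 1\<close>; this agrees with the formula on the right.
  Elsewhere the norm is differentiable.\<close>

lemma norm_powr_quotient_tendsto:
  fixes h k :: "'v::real_inner" and r :: real
  assumes r: "1 < r"
  shows "(\<lambda>n. (norm (h + (1 / real (Suc n)) *\<^sub>R k) powr r - norm h powr r) / (1 / real (Suc n)))
    \<longlonglongrightarrow> r * norm h powr (r - 2) * (h \<bullet> k)"
proof (cases "h = 0")
  case True
  have "(\<lambda>n. (1 / real (Suc n)) powr (r - 1) * norm k powr r) \<longlonglongrightarrow> 0 powr (r - 1) * norm k powr r"
    using r LIMSEQ_Suc[OF lim_1_over_n[where 'a=real]] by (intro tendsto_mult tendsto_const tendsto_powr') auto
  moreover have "(norm ((1 / real (Suc n)) *\<^sub>R k) powr r) / (1 / real (Suc n)) = (1 / real (Suc n)) powr (r - 1) * norm k powr r" for n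
    by (simp add: powr_mult powr_diff powr_divide)
  ultimately show ?thesis using True r by simp
next
  case False
  have d: "((\<lambda>t. norm (h + t *\<^sub>R k)) has_real_derivative (h \<bullet> k) / norm h) (at 0)"
  proof -
    have 1: "(norm has_derivative (\<lambda>y. y \<bullet> sgn h)) (at (h + 0 *\<^sub>R k))"
      using has_derivative_norm[OF False] by simp
    have 2: "((\<lambda>t. h + t *\<^sub>R k) has_derivative (\<lambda>t. t *\<^sub>R k)) (at 0)"
      by (auto intro!: derivative_eq_intros)
    have "((\<lambda>t. norm (h + t *\<^sub>R k)) has_derivative (\<lambda>t. (t *\<^sub>R k) \<bullet> sgn h)) (at 0)"
      by (rule has_derivative_compose[OF 2 1])
    then show ?thesis unfolding has_field_derivative_def
      by (rule has_derivative_eq_rhs) (auto simp: sgn_div_norm inner_commute divide_inverse fun_eq_iff)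
  qed
  have "((\<lambda>t. norm (h + t *\<^sub>R k) powr r) has_real_derivative r * norm h powr (r - 1) * ((h \<bullet> k) / norm h)) (at 0)"
    using DERIV_fun_powr[OF d, of r] False by simp
  moreover have "r * norm h powr (r - 1) * ((h \<bullet> k) / norm h) = r * norm h powr (r - 2) * (h \<bullet> k)"
    using False by (simp add: powr_diff power2_eq_square)
  ultimately have "((\<lambda>t. norm (h + t *\<^sub>R k) powr r) has_real_derivative r * norm h powr (r - 2) * (h \<bullet> k)) (at 0)"
    by simp
  then have "((\<lambda>t. (norm (h + t *\<^sub>R k) powr r - norm h powr r) / t) \<longlongrightarrow> r * norm h powr (r - 2) * (h \<bullet> k)) (at 0)"
    by (simp add: DERIV_def)
  moreover have "filterlim (\<lambda>n. 1 / real (Suc n)) (at 0) sequentially"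
    using LIMSEQ_Suc[OF lim_1_over_n[where 'a=real]] by (auto simp: filterlim_at)
  ultimately show ?thesis by (rule filterlim_compose)
qed

lemma weighted_mean_le_power_mean:
  fixes A1 A2 B1 B2 p q M :: real
  assumes q: "1 < q" "q \<le> p" and nn: "0 \<le> A1" "0 \<le> A2" "0 \<le> B1" "0 \<le> B2"
    and A: "(A1 powr q + A2 powr q) / 2 = 1"
  shows "((A1 powr (q - 1) * B1 + A2 powr (q - 1) * B2) / 2) powr p \<le> (B1 powr p + B2 powr p) / 2"
proof -
  \<comment> \<open>Hoelder's inequality with exponent \<open>q\<close>, then the power mean inequality, both in the normalization \<open>Q = c powr p\<close>.\<close>
  define Q where "Q = (B1 powr p + B2 powr p) / 2"
  define c where "c = Q powr (1 / p)"
  show ?thesis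
  proof (cases "Q = 0")
    case True
    then have "B1 = 0" "B2 = 0" by (auto simp: Q_def add_nonneg_eq_0_iff)
    then show ?thesis by simp
  next
    case False
    then have Q: "0 < Q" by (simp add: Q_def less_le)
    have c: "0 < c" "c powr p = Q" using Q q by (auto simp: c_def powr_powr)
    \<comment> \<open>Young's inequality twice: with exponents \<open>q / (q - 1)\<close> and
      \<open>q\<close> for the product, then with \<open>p / q\<close> to raise
      \<open>B powr q\<close> to \<open>B powr p\<close>. Equality holds at
      \<open>A = B = 1\<close>, so under the normalization the two copies add up to exactly
      2.\<close>
    have young: "A powr (q - 1) * B \<le> (q - 1) / q * A powr q + (B powr p / p + (1 / q - 1 / p))"
      if "0 \<le> A" "0 \<le> B" for A B :: real
    proof -
      have "A powr (q - 1) * B \<le> (A powr (q - 1)) powr (q / (q - 1)) / (q / (q - 1)) + B powr q / q"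
        using that q by (intro Youngs_inequality) (auto simp: field_simps)
      also have "\<dots> = (q - 1) / q * A powr q + B powr q / q" using q by (simp add: powr_powr)
      finally have y: "A powr (q - 1) * B \<le> (q - 1) / q * A powr q + B powr q / q" .
      have "B powr q \<le> q / p * B powr p + (1 - q / p)"
      proof (cases "q = p")
        case False
        have "B powr q * 1 \<le> (B powr q) powr (p / q) / (p / q) + 1 powr (p / (p - q)) / (p / (p - q))"
          using that q False by (intro Youngs_inequality) (auto simp: field_simps)
        then have "B powr q \<le> B powr p / (p / q) + 1 / (p / (p - q))" using q False that by (simp add: powr_powr)
        also have "\<dots> = q / p * B powr p + (1 - q / p)" using q by (simp add: diff_divide_distrib)
        finally show ?thesis .
      qed (use q in auto)
      then have "B powr q / q \<le> (q / p * B powr p + (1 - q / p)) / q" using q by (intro divide_right_mono) auto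
      also have "\<dots> = B powr p / p + (1 / q - 1 / p)" using q by (simp add: field_simps)
      finally have "B powr q / q \<le> B powr p / p + (1 / q - 1 / p)" .
      with y show ?thesis by simp
    qed
    have e: "(B1 / c) powr p + (B2 / c) powr p = 2"
      using nn c Q by (simp add: powr_divide Q_def field_simps)
    have "A1 powr (q - 1) * (B1 / c) + A2 powr (q - 1) * (B2 / c)
       \<le> (q - 1) / q * (A1 powr q + A2 powr q) + ((B1 / c) powr p + (B2 / c) powr p) / p + 2 * (1 / q - 1 / p)"
      using young[of A1 "B1 / c"] young[of A2 "B2 / c"] nn c by (simp add: algebra_simps add_divide_distrib)
    also have "\<dots> = 2" using A q unfolding e by (simp add: field_simps)
    finally have "(A1 powr (q - 1) * B1 + A2 powr (q - 1) * B2) / 2 \<le> c"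
      using c by (simp add: field_simps)
    then have "((A1 powr (q - 1) * B1 + A2 powr (q - 1) * B2) / 2) powr p \<le> c powr p"
      using q nn by (intro powr_mono2) auto
    then show ?thesis using c by (simp add: Q_def)
  qed
qed

subsection \<open>Weighted Lebesgue spaces\<close>

text \<open>Above the level \<open>m\<close> the negative exponent \<open>q - p\<close> gives
  \<open>t powr (q - p) \<le> m powr (q - p)\<close>. The truncated part suits finite measures, and
  the tail is paid for by the \<open>p\<close>-th power; coercivity, Vitali's theorem and the local
  bounds all rest on this splitting.\<close>

lemma powr_le_min_plus:
  fixes p q m t :: real
  assumes q: "q < p" and "0 < m" "0 \<le> t"
  shows "t powr q \<le> min t m powr q + m powr (q - p) * t powr p"
proof (cases "t \<le> m")
  case False
  then have "t powr q = t powr (q - p) * t powr p" using assms by (simp flip: powr_add)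
  also have "\<dots> \<le> m powr (q - p) * t powr p" using assms False q
    by (intro mult_right_mono) (auto intro!: powr_mono2')
  finally show ?thesis by (simp add: add_increasing)
qed (use assms in \<open>auto simp: min_def\<close>)

text \<open>The weight is kept as a positive function and not absorbed into the measure, so that
  \<open>\<rho>\<close>, \<open>a\<close> and \<open>b\<close> share the null sets of
  \<open>M\<close> and one almost everywhere limit serves all three.\<close>

locale weighted_measure =
  fixes M :: "'a measure" and w :: "'a \<Rightarrow> real"
  assumes w_measurable [measurable]: "w \<in> borel_measurable M"
    and w_pos: "x \<in> space M \<Longrightarrow> 0 < w x"
begin

definition Lp :: "real \<Rightarrow> ('a \<Rightarrow> 'v::euclidean_space) set" where
  "Lp r = {h \<in> borel_measurable M. integrable M (\<lambda>x. w x * norm (h x) powr r)}"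

text \<open>The \<open>r\<close>-th power of the weighted norm, without the root: the energy is a
  linear combination of such integrals. The factor \<open>2 powr r\<close> in \<open>Lp_add\<close>
  takes the place of Minkowski's inequality.\<close>

definition Np :: "real \<Rightarrow> ('a \<Rightarrow> 'v::euclidean_space) \<Rightarrow> real" where
  "Np r h = (\<integral>x. w x * norm (h x) powr r \<partial>M)"

lemma LpD:
  assumes "h \<in> Lp r"
  shows "h \<in> borel_measurable M" "integrable M (\<lambda>x. w x * norm (h x) powr r)"
  using assms by (auto simp: Lp_def)

lemma Lp_bound:
  assumes "h \<in> borel_measurable M" "integrable M f"
    and "\<And>x. x \<in> space M \<Longrightarrow> w x * norm (h x) powr r \<le> f x"
  shows "h \<in> Lp r"
proof -
  note [measurable] = assms(1)
  have "integrable M (\<lambda>x. w x * norm (h x) powr r)"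
  proof (rule Bochner_Integration.integrable_bound[OF assms(2)])
    show "AE x in M. norm (w x * norm (h x) powr r) \<le> norm (f x)"
    proof (rule AE_I2)
      fix x assume x: "x \<in> space M"
      have "0 \<le> w x * norm (h x) powr r" using w_pos[OF x] by simp
      then show "norm (w x * norm (h x) powr r) \<le> norm (f x)" using assms(3)[OF x] by simp
    qed
  qed simp
  then show ?thesis using assms(1) by (simp add: Lp_def)
qed

lemma Np_nonneg: "0 \<le> Np r h"
  unfolding Np_def using w_pos by (intro integral_nonneg_AE AE_I2) (simp add: less_imp_le)

lemma Lp_add:
  assumes r: "0 < r" and h: "h \<in> Lp r" and k: "k \<in> Lp r"
  shows "(\<lambda>x. h x + k x) \<in> Lp r" "Np r (\<lambda>x. h x + k x) \<le> 2 powr r * (Np r h + Np r k)"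
proof -
  define S where "S x = 2 powr r * (w x * norm (h x) powr r + w x * norm (k x) powr r)" for x
  have S: "integrable M S" unfolding S_def using LpD[OF h] LpD[OF k] by simp
  have le: "w x * norm (h x + k x) powr r \<le> S x" if "x \<in> space M" for x
    using mult_left_mono[OF norm_add_powr_le[OF r, of "h x" "k x"], of "w x"] w_pos[OF that]
    by (simp add: S_def algebra_simps)
  show sum: "(\<lambda>x. h x + k x) \<in> Lp r"
    by (rule Lp_bound[OF _ S le]) (use LpD[OF h] LpD[OF k] in measurable)
  have "Np r (\<lambda>x. h x + k x) \<le> (\<integral>x. S x \<partial>M)"
    unfolding Np_def using LpD(2)[OF sum] S le by (intro integral_mono) auto
  also have "\<dots> = 2 powr r * (Np r h + Np r k)" unfolding S_def using LpD[OF h] LpD[OF k] by (simp add: Np_def)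
  finally show "Np r (\<lambda>x. h x + k x) \<le> 2 powr r * (Np r h + Np r k)" .
qed

lemma Lp_scaleR:
  assumes h: "h \<in> Lp r"
  shows "(\<lambda>x. c *\<^sub>R h x) \<in> Lp r"
proof (rule Lp_bound)
  show "integrable M (\<lambda>x. \<bar>c\<bar> powr r * (w x * norm (h x) powr r))"
    using LpD[OF h] by simp
  show "w x * norm (c *\<^sub>R h x) powr r \<le> \<bar>c\<bar> powr r * (w x * norm (h x) powr r)" for x
    by (simp add: powr_mult)
qed (use LpD[OF h] in measurable)

lemma Np_scaleR: "Np r (\<lambda>x. c *\<^sub>R h x) = \<bar>c\<bar> powr r * Np r h"
proof -
  have "(\<lambda>x. w x * norm (c *\<^sub>R h x) powr r) = (\<lambda>x. \<bar>c\<bar> powr r * (w x * norm (h x) powr r))"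
    by (simp add: powr_mult fun_eq_iff)
  then show ?thesis unfolding Np_def by simp
qed

lemma Lp_diff:
  assumes "0 < r" "h \<in> Lp r" "k \<in> Lp r"
  shows "(\<lambda>x. h x - k x) \<in> Lp r"
  using Lp_add(1)[OF assms(1,2) Lp_scaleR[OF assms(3), of "-1"]] by simp

lemma Np_mono:
  assumes "h \<in> borel_measurable M" "k \<in> Lp r"
    and "\<And>x. x \<in> space M \<Longrightarrow> norm (h x) powr r \<le> norm (k x) powr r"
  shows "h \<in> Lp r" "Np r h \<le> Np r k"
proof -
  have le: "w x * norm (h x) powr r \<le> w x * norm (k x) powr r" if "x \<in> space M" for x
    using assms(3)[OF that] w_pos[OF that] by simp
  show "h \<in> Lp r" using LpD[OF assms(2)] le by (intro Lp_bound[OF assms(1)]) auto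
  from LpD(2)[OF this] show "Np r h \<le> Np r k" unfolding Np_def using LpD(2)[OF assms(2)] le
    by (intro integral_mono) auto
qed

text \<open>Integrates \<open>norm_powr_near\<close>: \<open>\<eta>\<close> is chosen against the
  fixed value \<open>Np r k\<close>, and only then \<open>\<delta>\<close> against the constant
  \<open>K\<close> that belongs to \<open>\<eta>\<close>.\<close>

lemma Np_continuous:
  fixes k :: "'a \<Rightarrow> 'v::euclidean_space"
  assumes r: "0 < r" and k: "k \<in> Lp r" and e: "0 < e"
  obtains \<delta> where "0 < \<delta>" "\<And>h. h \<in> Lp r \<Longrightarrow> Np r (\<lambda>x. h x - k x) < \<delta> \<Longrightarrow> \<bar>Np r h - Np r k\<bar> < e"
proof -
  define \<eta> where "\<eta> = e / (2 * (Np r k + 1))"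
  have \<eta>: "0 < \<eta>" using e Np_nonneg[of r k] by (simp add: \<eta>_def)
  obtain K where K: "0 < K" "\<And>x y :: 'v. \<bar>norm x powr r - norm y powr r\<bar> \<le> \<eta> * norm y powr r + K * norm (x - y) powr r"
    using norm_powr_near[OF r \<eta>] by blast
  show thesis
  proof (rule that[of "e / (2 * K)"])
    show "0 < e / (2 * K)" using e K by simp
    fix h :: "'a \<Rightarrow> 'v"
    assume h: "h \<in> Lp r" and close: "Np r (\<lambda>x. h x - k x) < e / (2 * K)"
    note i = LpD(2)[OF h] LpD(2)[OF k] LpD(2)[OF Lp_diff[OF r h k]]
    have "\<bar>Np r (h) - Np r k\<bar> = \<bar>\<integral>x. w x * norm (h x) powr r - w x * norm (k x) powr r \<partial>M\<bar>"
      unfolding Np_def using i by simp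
    also have "\<dots> \<le> (\<integral>x. \<bar>w x * norm (h x) powr r - w x * norm (k x) powr r\<bar> \<partial>M)"
      by (rule integral_abs_bound)
    also have "\<dots> \<le> (\<integral>x. \<eta> * (w x * norm (k x) powr r) + K * (w x * norm (h x - k x) powr r) \<partial>M)"
    proof (rule integral_mono)
      fix x assume x: "x \<in> space M"
      have "\<bar>w x * norm (h x) powr r - w x * norm (k x) powr r\<bar> = w x * \<bar>norm (h x) powr r - norm (k x) powr r\<bar>"
        using w_pos[OF x] by (simp add: abs_mult flip: right_diff_distrib)
      also have "\<dots> \<le> w x * (\<eta> * norm (k x) powr r + K * norm (h x - k x) powr r)"
        using K(2) w_pos[OF x] by (intro mult_left_mono) auto
      finally show "\<bar>w x * norm (h x) powr r - w x * norm (k x) powr r\<bar>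
        \<le> \<eta> * (w x * norm (k x) powr r) + K * (w x * norm (h x - k x) powr r)" by (simp add: algebra_simps)
    qed (use i in auto)
    also have "\<dots> = \<eta> * Np r k + K * Np r (\<lambda>x. h x - k x)" unfolding Np_def using i by simp
    finally have "\<bar>Np r h - Np r k\<bar> \<le> \<eta> * Np r k + K * Np r (\<lambda>x. h x - k x)" .
    moreover have "\<eta> * Np r k < e / 2" "K * Np r (\<lambda>x. h x - k x) < e / 2"
      using Np_nonneg[of r k] e close K by (auto simp: \<eta>_def field_simps)
    ultimately show "\<bar>Np r h - Np r k\<bar> < e" by linarith
  qed
qed

lemma Np_tendsto:
  assumes r: "0 < r" and hn: "\<And>n. h n \<in> Lp r" and k: "k \<in> Lp r"
    and lim: "(\<lambda>n. Np r (\<lambda>x. h n x - k x)) \<longlonglongrightarrow> 0"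
  shows "(\<lambda>n. Np r (h n)) \<longlonglongrightarrow> Np r k"
proof (rule LIMSEQ_I)
  fix e :: real assume "0 < e"
  then obtain \<delta> where \<delta>: "0 < \<delta>" "\<And>h. h \<in> Lp r \<Longrightarrow> Np r (\<lambda>x. h x - k x) < \<delta> \<Longrightarrow> \<bar>Np r h - Np r k\<bar> < e"
    using Np_continuous[OF r k] by blast
  obtain n0 where "\<And>n. n0 \<le> n \<Longrightarrow> Np r (\<lambda>x. h n x - k x) < \<delta>"
    using LIMSEQ_D[OF lim \<delta>(1)] by (auto simp: abs_of_nonneg[OF Np_nonneg])
  then show "\<exists>no. \<forall>n\<ge>no. norm (Np r (h n) - Np r k) < e" using \<delta>(2)[OF hn] by auto
qed

lemma Np_dominated_convergence:
  assumes r: "0 < r" and hn: "\<And>n. h n \<in> borel_measurable M" and H: "H \<in> Lp r"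
    and le: "\<And>n x. x \<in> space M \<Longrightarrow> norm (h n x) \<le> norm (H x)"
    and lim: "\<And>x. x \<in> space M \<Longrightarrow> (\<lambda>n. h n x) \<longlonglongrightarrow> k x"
  shows "(\<lambda>n. Np r (h n)) \<longlonglongrightarrow> Np r k"
proof -
  note [measurable] = hn
  have [measurable]: "k \<in> borel_measurable M" by (rule borel_measurable_LIMSEQ_metric[OF hn lim])
  show ?thesis unfolding Np_def
  proof (rule integral_dominated_convergence[where w = "\<lambda>x. w x * norm (H x) powr r"])
    show "AE x in M. (\<lambda>n. w x * norm (h n x) powr r) \<longlonglongrightarrow> w x * norm (k x) powr r"
      using r lim by (intro AE_I2 tendsto_mult tendsto_const tendsto_powr' tendsto_norm) auto
    show "AE x in M. norm (w x * norm (h n x) powr r) \<le> w x * norm (H x) powr r" for n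
    proof (rule AE_I2)
      fix x assume x: "x \<in> space M"
      then show "norm (w x * norm (h n x) powr r) \<le> w x * norm (H x) powr r"
        using le[OF x, of n] w_pos[OF x] r by (auto simp: abs_mult intro!: mult_left_mono powr_mono2)
    qed
  qed (use LpD(2)[OF H] in auto)
qed

lemma Np_nn_integral:
  assumes "h \<in> Lp r"
  shows "(\<integral>\<^sup>+x. ennreal (w x * norm (h x) powr r) \<partial>M) = ennreal (Np r h)"
  unfolding Np_def using LpD[OF assms] w_pos by (intro nn_integral_eq_integral AE_I2) (auto simp: less_imp_le)

lemma Lp_Fatou:
  assumes r: "0 < r" and hn: "\<And>n. h n \<in> Lp r" and k: "k \<in> borel_measurable M"
    and bd: "\<forall>\<^sub>F n in sequentially. Np r (h n) \<le> C" and lim: "AE x in M. (\<lambda>n. h n x) \<longlonglongrightarrow> k x"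
  shows "k \<in> Lp r" "Np r k \<le> C"
proof -
  note [measurable] = LpD(1)[OF hn] k
  have "(\<integral>\<^sup>+x. ennreal (w x * norm (k x) powr r) \<partial>M) \<le> (\<integral>\<^sup>+x. liminf (\<lambda>n. ennreal (w x * norm (h n x) powr r)) \<partial>M)"
  proof (rule nn_integral_mono_AE)
    show "AE x in M. ennreal (w x * norm (k x) powr r) \<le> liminf (\<lambda>n. ennreal (w x * norm (h n x) powr r))"
      using lim
    proof eventually_elim
      case (elim x)
      have "(\<lambda>n. ennreal (w x * norm (h n x) powr r)) \<longlonglongrightarrow> ennreal (w x * norm (k x) powr r)"
        using r elim by (intro tendsto_ennrealI tendsto_mult tendsto_const tendsto_powr' tendsto_norm) auto
      then show ?case by (simp add: lim_imp_Liminf)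
    qed
  qed
  also have "\<dots> \<le> liminf (\<lambda>n. \<integral>\<^sup>+x. ennreal (w x * norm (h n x) powr r) \<partial>M)"
    by (rule nn_integral_liminf) measurable
  also have "\<dots> \<le> limsup (\<lambda>n. \<integral>\<^sup>+x. ennreal (w x * norm (h n x) powr r) \<partial>M)" by (simp add: Liminf_le_Limsup)
  also have "\<dots> \<le> ennreal C"
    by (rule Limsup_bounded) (use bd in eventually_elim, simp add: Np_nn_integral[OF hn] ennreal_leI)
  finally have le: "(\<integral>\<^sup>+x. ennreal (w x * norm (k x) powr r) \<partial>M) \<le> ennreal C" .
  obtain n where "Np r (h n) \<le> C" using eventually_happens'[OF _ bd] by auto
  then have C: "0 \<le> C" using Np_nonneg[of r "h n"] by linarith
  have "integrable M (\<lambda>x. w x * norm (k x) powr r)"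
    using le w_pos by (intro integrableI_bounded) (auto simp: less_imp_le abs_mult le_less_trans cong: nn_integral_cong_simp)
  then show kL: "k \<in> Lp r" using k by (simp add: Lp_def)
  show "Np r k \<le> C" using le C unfolding Np_nn_integral[OF kL] by simp
qed

section \<open>Completeness, uniform convexity and Vitali's theorem in the weighted spaces\<close>

lemma Lp_complete:
  fixes h :: "nat \<Rightarrow> 'a \<Rightarrow> 'v::euclidean_space"
  assumes r: "0 < r" and hn: "\<And>n. h n \<in> Lp r"
    and cauchy: "\<And>e. 0 < e \<Longrightarrow> \<exists>n0. \<forall>m\<ge>n0. \<forall>n\<ge>n0. Np r (\<lambda>x. h m x - h n x) < e"
  obtains k \<sigma> where "k \<in> Lp r" "strict_mono (\<sigma> :: nat \<Rightarrow> nat)" "AE x in M. (\<lambda>n. h (\<sigma> n) x) \<longlonglongrightarrow> k x"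
    "(\<lambda>n. Np r (\<lambda>x. h n x - k x)) \<longlonglongrightarrow> 0"
proof -
  \<comment> \<open>Increments of this size remain summable after multiplication by
    \<open>2 powr (r * real n)\<close>. Finiteness of the weighted sum at almost every point then
    yields the pointwise bound \<open>norm (d n x) \<le> const * (1/2) ^ n\<close>, without
    Minkowski's inequality for series.\<close>
  define \<epsilon> where "\<epsilon> n = (1/2) ^ n * 2 powr (- r * real n)" for n :: nat
  have \<epsilon>: "0 < \<epsilon> n" for n by (simp add: \<epsilon>_def)
  have "\<forall>n. \<exists>n0. \<forall>m\<ge>n0. \<forall>n'\<ge>n0. Np r (\<lambda>x. h m x - h n' x) < \<epsilon> n" using cauchy \<epsilon> by blast
  then obtain \<tau> where \<tau>: "\<And>n m n'. \<tau> n \<le> m \<Longrightarrow> \<tau> n \<le> n' \<Longrightarrow> Np r (\<lambda>x. h m x - h n' x) < \<epsilon> n" by metis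
  \<comment> \<open>Summing makes \<open>\<sigma> n\<close> dominate \<open>\<tau> n\<close>, and
    the \<open>Suc\<close> makes the sequence strictly increasing.\<close>
  define \<sigma> where "\<sigma> n = (\<Sum>i\<le>n. Suc (\<tau> i))" for n
  have \<sigma>: "strict_mono \<sigma>" by (intro strict_monoI_Suc) (simp add: \<sigma>_def)
  have \<sigma>\<tau>: "\<tau> n \<le> \<sigma> n" for n unfolding \<sigma>_def
    using member_le_sum[of n "{..n}" "\<lambda>i. Suc (\<tau> i)"] by auto
  define d where "d n x = h (\<sigma> (Suc n)) x - h (\<sigma> n) x" for n x
  have dL: "d n \<in> Lp r" for n unfolding d_def by (intro Lp_diff r hn)
  have Nd: "Np r (d n) \<le> \<epsilon> n" for n unfolding d_def
    using \<tau>[of n "\<sigma> (Suc n)" "\<sigma> n"] \<sigma>\<tau>[of n] strict_monoD[OF \<sigma>, of n "Suc n"] by simp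
  note [measurable] = LpD(1)[OF hn] LpD(1)[OF dL]
  have "(\<integral>\<^sup>+x. (\<Sum>n. ennreal (2 powr (r * real n)) * ennreal (w x * norm (d n x) powr r)) \<partial>M)
      = (\<Sum>n. (\<integral>\<^sup>+x. ennreal (2 powr (r * real n)) * ennreal (w x * norm (d n x) powr r) \<partial>M))"
    by (rule nn_integral_suminf) measurable
  also have "\<dots> = (\<Sum>n. ennreal (2 powr (r * real n)) * ennreal (Np r (d n)))"
    by (subst nn_integral_cmult) (auto simp: Np_nn_integral[OF dL])
  also have "\<dots> \<le> (\<Sum>n. ennreal ((1/2) ^ n))"
  proof (rule suminf_le)
    fix n
    have "2 powr (r * real n) * Np r (d n) \<le> 2 powr (r * real n) * \<epsilon> n" by (intro mult_left_mono Nd) auto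
    also have "\<dots> = (1/2) ^ n" by (simp add: \<epsilon>_def powr_minus)
    finally show "ennreal (2 powr (r * real n)) * ennreal (Np r (d n)) \<le> ennreal ((1/2) ^ n)"
      using Np_nonneg[of r "d n"] by (simp add: ennreal_mult[symmetric] ennreal_leI)
  qed auto
  also have "\<dots> = ennreal 2" using sums_unique[of "\<lambda>n. (1/2::real) ^ n" 2] geometric_sums[of "1/2::real"]
    by (subst suminf_ennreal2) auto
  finally have "(\<integral>\<^sup>+x. (\<Sum>n. ennreal (2 powr (r * real n)) * ennreal (w x * norm (d n x) powr r)) \<partial>M) \<noteq> \<infinity>"
    by (auto simp: top_unique)
  then have "AE x in M. (\<Sum>n. ennreal (2 powr (r * real n)) * ennreal (w x * norm (d n x) powr r)) \<noteq> \<infinity>"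
    by (intro nn_integral_PInf_AE) measurable
  moreover have "AE x in M. x \<in> space M" by (rule AE_space)
  ultimately have conv: "AE x in M. convergent (\<lambda>n. h (\<sigma> n) x)"
  proof eventually_elim
    case (elim x)
    define S where "S = enn2real (\<Sum>n. ennreal (2 powr (r * real n)) * ennreal (w x * norm (d n x) powr r))"
    have w: "0 < w x" using w_pos elim by auto
    have bd: "norm (d n x) \<le> (S / w x) powr (1 / r) * (1/2) ^ n" for n
    proof -
      have "ennreal (2 powr (r * real n)) * ennreal (w x * norm (d n x) powr r) \<le> ennreal S"
        using sum_le_suminf[of "\<lambda>n. ennreal (2 powr (r * real n)) * ennreal (w x * norm (d n x) powr r)" "{n}"] elim
        by (simp add: S_def less_top[symmetric])
      then have "2 powr (r * real n) * (w x * norm (d n x) powr r) \<le> S"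
        using w by (simp add: ennreal_mult[symmetric] S_def)
      then have "norm (d n x) powr r \<le> S / w x * 2 powr (- (r * real n))"
        using w by (simp add: powr_minus field_simps)
      then have "(norm (d n x) powr r) powr (1 / r) \<le> (S / w x * 2 powr (- (r * real n))) powr (1 / r)"
        using r by (intro powr_mono2) auto
      also have "\<dots> = (S / w x) powr (1 / r) * 2 powr (- real n)"
        unfolding powr_mult powr_powr using r by simp
      also have "2 powr (- real n) = (1/2::real) ^ n" by (simp add: powr_minus powr_realpow power_one_over inverse_eq_divide)
      finally show ?thesis using r by (simp add: powr_powr)
    qed
    have "summable (\<lambda>n. d n x)"
    proof (rule summable_comparison_test')
      show "summable (\<lambda>n. (S / w x) powr (1 / r) * (1/2) ^ n)"
        by (intro summable_mult summable_geometric) simp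
    qed (use bd in auto)
    then have "(\<lambda>n. \<Sum>i<n. d i x) \<longlonglongrightarrow> suminf (\<lambda>n. d n x)" by (rule summable_LIMSEQ)
    moreover have "(\<Sum>i<n. d i x) = h (\<sigma> n) x - h (\<sigma> 0) x" for n by (induction n) (auto simp: d_def)
    ultimately have "(\<lambda>n. h (\<sigma> n) x - h (\<sigma> 0) x + h (\<sigma> 0) x) \<longlonglongrightarrow> suminf (\<lambda>n. d n x) + h (\<sigma> 0) x"
      by (intro tendsto_add tendsto_const) simp
    then show ?case by (auto simp: convergent_def)
  qed
  define k where "k x = lim (\<lambda>n. h (\<sigma> n) x)" for x
  have k: "k \<in> borel_measurable M" unfolding k_def by measurable
  have lim: "AE x in M. (\<lambda>n. h (\<sigma> n) x) \<longlonglongrightarrow> k x" using conv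
    by eventually_elim (simp add: k_def convergent_LIMSEQ_iff)
  \<comment> \<open>Fatou's lemma along the subsequence, with \<open>n\<close> fixed, carries the
    Cauchy estimate for the full sequence over to the limit.\<close>
  have fat: "(\<lambda>x. h n x - k x) \<in> Lp r \<and> Np r (\<lambda>x. h n x - k x) \<le> e"
    if n0: "\<And>m. m \<ge> n0 \<Longrightarrow> Np r (\<lambda>x. h n x - h m x) < e" for n n0 e
  proof -
    have ev: "\<forall>\<^sub>F j in sequentially. Np r (\<lambda>x. h n x - h (\<sigma> j) x) \<le> e"
      using n0 seq_suble[OF \<sigma>] by (intro eventually_sequentiallyI[of n0] less_imp_le) (meson order_trans)
    have "AE x in M. (\<lambda>j. h n x - h (\<sigma> j) x) \<longlonglongrightarrow> h n x - k x"
      using lim by eventually_elim (intro tendsto_diff tendsto_const)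
    then show ?thesis using k
      by (intro conjI Lp_Fatou[OF r Lp_diff[OF r hn hn] _ ev]) auto
  qed
  have lim0: "(\<lambda>n. Np r (\<lambda>x. h n x - k x)) \<longlonglongrightarrow> 0"
  proof (rule LIMSEQ_I)
    fix e :: real assume e: "0 < e"
    obtain n0 where n0: "\<And>m n. m \<ge> n0 \<Longrightarrow> n \<ge> n0 \<Longrightarrow> Np r (\<lambda>x. h m x - h n x) < e / 2"
      using cauchy[of "e / 2"] e by auto
    have "Np r (\<lambda>x. h n x - k x) < e" if "n0 \<le> n" for n
      using fat[of n0 n "e / 2"] n0[OF that] e by auto
    then show "\<exists>no. \<forall>n\<ge>no. norm (Np r (\<lambda>x. h n x - k x) - 0) < e" by (auto simp: abs_of_nonneg[OF Np_nonneg])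
  qed
  obtain n0 where n0: "\<And>m n. m \<ge> n0 \<Longrightarrow> n \<ge> n0 \<Longrightarrow> Np r (\<lambda>x. h m x - h n x) < 1"
    using cauchy[of 1] by auto
  have "(\<lambda>x. h n0 x - k x) \<in> Lp r" using fat[of n0 n0 1] n0[of n0] by auto
  from Lp_diff[OF r hn[of n0] this] have "k \<in> Lp r" by simp
  then show thesis using that \<sigma> lim lim0 by blast
qed

text \<open>The integrated form of \<open>powr_uniform_convexity\<close>: the bound \<open>C\<close>
  makes the \<open>\<eta>\<close>-term smaller than \<open>e / 2\<close>, and the small midpoint
  defect controls the \<open>K\<close>-term.\<close>

lemma Lp_Cauchy_of_midpoint_defect:
  fixes h :: "nat \<Rightarrow> 'a \<Rightarrow> 'v::euclidean_space"
  assumes r: "1 < r" and hn: "\<And>n. h n \<in> Lp r" and bd: "\<And>n. Np r (h n) \<le> C"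
    and defect: "\<And>e. 0 < e \<Longrightarrow> \<exists>n0. \<forall>m\<ge>n0. \<forall>n\<ge>n0.
      (Np r (h m) + Np r (h n)) / 2 - Np r (\<lambda>x. (1/2) *\<^sub>R (h m x + h n x)) < e"
    and e: "0 < e"
  shows "\<exists>n0. \<forall>m\<ge>n0. \<forall>n\<ge>n0. Np r (\<lambda>x. h m x - h n x) < e"
proof -
  have C: "0 \<le> C" using bd[of 0] Np_nonneg[of r "h 0"] by simp
  define \<eta> where "\<eta> = e / (4 * (C + 1))"
  have \<eta>: "0 < \<eta>" using e C by (simp add: \<eta>_def)
  obtain K where K: "0 < K" "\<And>x y :: 'v. norm (x - y) powr r \<le> \<eta> * (norm x powr r + norm y powr r)
      + K * ((norm x powr r + norm y powr r) / 2 - norm ((1/2) *\<^sub>R (x + y)) powr r)"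
    using powr_uniform_convexity[OF r \<eta>] by blast
  obtain n0 where n0: "\<And>m n. m \<ge> n0 \<Longrightarrow> n \<ge> n0 \<Longrightarrow>
      (Np r (h m) + Np r (h n)) / 2 - Np r (\<lambda>x. (1/2) *\<^sub>R (h m x + h n x)) < e / (2 * K)"
    using defect[of "e / (2 * K)"] e K(1) by (meson divide_pos_pos mult_pos_pos zero_less_numeral)
  have "Np r (\<lambda>x. h m x - h n x) < e" if mn: "m \<ge> n0" "n \<ge> n0" for m n
  proof -
    have r0: "0 < r" using r by simp
    note i = LpD(2)[OF hn[of n]] LpD(2)[OF hn[of m]] LpD(2)[OF Lp_diff[OF r0 hn[of m] hn[of n]]]
      LpD(2)[OF Lp_scaleR[OF Lp_add(1)[OF r0 hn[of m] hn[of n]], of "1/2"]]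
    have "Np r (\<lambda>x. h m x - h n x) \<le> (\<integral>x. \<eta> * (w x * norm (h m x) powr r + w x * norm (h n x) powr r)
      + K * ((w x * norm (h m x) powr r + w x * norm (h n x) powr r) / 2 - w x * norm ((1/2) *\<^sub>R (h m x + h n x)) powr r) \<partial>M)"
      unfolding Np_def
    proof (rule integral_mono)
      show "integrable M (\<lambda>x. \<eta> * (w x * norm (h m x) powr r + w x * norm (h n x) powr r)
        + K * ((w x * norm (h m x) powr r + w x * norm (h n x) powr r) / 2 - w x * norm ((1/2) *\<^sub>R (h m x + h n x)) powr r))"
        by (intro Bochner_Integration.integrable_add integrable_mult_right Bochner_Integration.integrable_diff
            integrable_divide i)
      fix x assume x: "x \<in> space M"
      show "w x * norm (h m x - h n x) powr r \<le> \<eta> * (w x * norm (h m x) powr r + w x * norm (h n x) powr r)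
        + K * ((w x * norm (h m x) powr r + w x * norm (h n x) powr r) / 2 - w x * norm ((1/2) *\<^sub>R (h m x + h n x)) powr r)"
        using mult_left_mono[OF K(2)[of "h m x" "h n x"], of "w x"] w_pos[OF x]
        by (simp add: algebra_simps add_divide_distrib del: norm_scaleR)
    qed (use i in auto)
    also have "\<dots> = \<eta> * (Np r (h m) + Np r (h n)) + K * ((Np r (h m) + Np r (h n)) / 2 - Np r (\<lambda>x. (1/2) *\<^sub>R (h m x + h n x)))"
    proof -
      have "(\<integral>x. \<eta> * (f x + g x) + K * ((f x + g x) / 2 - c x) \<partial>M)
        = \<eta> * (integral\<^sup>L M f + integral\<^sup>L M g) + K * ((integral\<^sup>L M f + integral\<^sup>L M g) / 2 - integral\<^sup>L M c)"
        if "integrable M f" "integrable M g" "integrable M c" for f g c :: "'a \<Rightarrow> real" using that by simp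
      from this[OF i(2,1,4)] show ?thesis unfolding Np_def .
    qed
    also have "\<dots> \<le> \<eta> * (2 * C) + K * ((Np r (h m) + Np r (h n)) / 2 - Np r (\<lambda>x. (1/2) *\<^sub>R (h m x + h n x)))"
      using bd[of m] bd[of n] \<eta> by simp
    also have "\<eta> * (2 * C) < e / 2" using e C by (simp add: \<eta>_def field_simps)
    also have "K * ((Np r (h m) + Np r (h n)) / 2 - Np r (\<lambda>x. (1/2) *\<^sub>R (h m x + h n x))) < K * (e / (2 * K))"
      using n0[OF mn] K by (intro mult_strict_left_mono) auto
    finally show ?thesis using K by simp
  qed
  then show ?thesis by blast
qed

text \<open>With weight \<open>w\<close> the total mass is finite, so boundedness in the higher
  exponent \<open>p\<close> makes the \<open>q\<close>-th powers uniformly integrable: the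
  differences cut off at a level \<open>m\<close> are treated by dominated convergence, and the part
  above \<open>m\<close> is at most \<open>m powr (q - p)\<close> times a fixed bound.\<close>

lemma Lp_Vitali:
  fixes h :: "nat \<Rightarrow> 'a \<Rightarrow> 'v::euclidean_space"
  assumes q: "0 < q" "q < p" and w: "integrable M w" and hn: "\<And>n. h n \<in> Lp p" and bd: "\<And>n. Np p (h n) \<le> C"
    and k: "k \<in> borel_measurable M" and lim: "AE x in M. (\<lambda>n. h n x) \<longlonglongrightarrow> k x"
  shows "h n \<in> Lp q" "k \<in> Lp q" "(\<lambda>n. Np q (\<lambda>x. h n x - k x)) \<longlonglongrightarrow> 0"
proof -
  note cut = powr_le_min_plus[OF q(2)]
  have sub: "f \<in> Lp q" if f: "f \<in> Lp p" for f :: "'a \<Rightarrow> 'v"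
  proof (rule Lp_bound)
    show "integrable M (\<lambda>x. w x + w x * norm (f x) powr p)" using w LpD[OF f] by simp
    fix x assume x: "x \<in> space M"
    have "min (norm (f x)) 1 powr q \<le> 1 powr q" using q by (intro powr_mono2) auto
    then have "norm (f x) powr q \<le> 1 + norm (f x) powr p" using cut[of 1 "norm (f x)"] by simp
    then show "w x * norm (f x) powr q \<le> w x + w x * norm (f x) powr p"
      using w_pos[OF x] mult_left_mono[of "norm (f x) powr q" "1 + norm (f x) powr p" "w x"] by (simp add: algebra_simps)
  qed (use LpD[OF f] in simp)
  have kp: "k \<in> Lp p" using Lp_Fatou(1)[OF _ hn k _ lim, of C] q bd by auto
  have dL: "(\<lambda>x. h n x - k x) \<in> Lp p" for n using q by (intro Lp_diff hn kp) auto
  show "h n \<in> Lp q" "k \<in> Lp q" using sub hn kp by auto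
  note [measurable] = LpD(1)[OF hn] k
  define D where "D = 2 powr p * (C + Np p k)"
  have D: "Np p (\<lambda>x. h n x - k x) \<le> D" for n
  proof -
    have "Np p (\<lambda>x. h n x + (-1) *\<^sub>R k x) \<le> 2 powr p * (Np p (h n) + Np p (\<lambda>x. (-1) *\<^sub>R k x))"
      using q by (intro Lp_add(2) hn Lp_scaleR kp) auto
    also have "\<dots> \<le> D" using bd[of n] by (simp add: D_def Np_def)
    finally show ?thesis by simp
  qed
  have D0: "0 \<le> D" using D[of 0] Np_nonneg[of p "\<lambda>x. h 0 x - k x"] by simp
  show "(\<lambda>n. Np q (\<lambda>x. h n x - k x)) \<longlonglongrightarrow> 0"
  proof (rule LIMSEQ_I)
    fix e :: real assume e: "0 < e"
    \<comment> \<open>The level at which the tail contributes at most \<open>e / 2\<close>; it is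
      large for small \<open>e\<close>, as the exponent is negative.\<close>
    define m where "m = (e / (2 * (D + 1))) powr (1 / (q - p))"
    have m: "0 < m" "m powr (q - p) = e / (2 * (D + 1))" using e D0 q by (auto simp: m_def powr_powr)
    have mbd: "AE x in M. norm (w x * min (norm (h n x - k x)) m powr q) \<le> w x * m powr q" for n
    proof (rule AE_I2)
      fix x assume x: "x \<in> space M"
      have "min (norm (h n x - k x)) m powr q \<le> m powr q" using q m by (intro powr_mono2) auto
      then show "norm (w x * min (norm (h n x - k x)) m powr q) \<le> w x * m powr q"
        using w_pos[OF x] by (simp add: abs_mult)
    qed
    have "(\<lambda>n. \<integral>x. w x * min (norm (h n x - k x)) m powr q \<partial>M) \<longlonglongrightarrow> (\<integral>x. 0 \<partial>M)"
    proof (rule integral_dominated_convergence[where w = "\<lambda>x. w x * m powr q"])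
      show "AE x in M. (\<lambda>n. w x * min (norm (h n x - k x)) m powr q) \<longlonglongrightarrow> 0"
        using lim
      proof eventually_elim
        case (elim x)
        have "(\<lambda>n. min (norm (h n x - k x)) m) \<longlonglongrightarrow> min (norm (k x - k x)) m"
          using elim by (intro tendsto_min tendsto_norm tendsto_diff tendsto_const)
        then have "(\<lambda>n. w x * min (norm (h n x - k x)) m powr q) \<longlonglongrightarrow> w x * 0 powr q"
          using q m by (intro tendsto_mult tendsto_const tendsto_powr') auto
        then show ?case by simp
      qed
    qed (use w mbd in auto)
    from LIMSEQ_D[OF this, of "e / 2"] e
    obtain n0 where n0: "\<And>n. n0 \<le> n \<Longrightarrow> \<bar>\<integral>x. w x * min (norm (h n x - k x)) m powr q \<partial>M\<bar> < e / 2"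
      by auto
    have "Np q (\<lambda>x. h n x - k x) < e" if n: "n0 \<le> n" for n
    proof -
      have im: "integrable M (\<lambda>x. w x * min (norm (h n x - k x)) m powr q)"
        by (rule Bochner_Integration.integrable_bound[of _ "\<lambda>x. w x * m powr q"])
          (use w mbd[of n] w_pos in \<open>auto elim!: eventually_mono intro: order_trans[OF _ abs_ge_self]\<close>)
      have "Np q (\<lambda>x. h n x - k x) \<le> (\<integral>x. w x * min (norm (h n x - k x)) m powr q
          + m powr (q - p) * (w x * norm (h n x - k x) powr p) \<partial>M)" unfolding Np_def
      proof (rule integral_mono)
        fix x assume x: "x \<in> space M"
        show "w x * norm (h n x - k x) powr q \<le> w x * min (norm (h n x - k x)) m powr q
          + m powr (q - p) * (w x * norm (h n x - k x) powr p)"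
          using mult_left_mono[OF cut[OF m(1), of "norm (h n x - k x)"], of "w x"] w_pos[OF x]
          by (simp add: algebra_simps)
      qed (use LpD[OF dL[of n]] LpD[OF sub[OF dL[of n]]] im in auto)
      also have "\<dots> = (\<integral>x. w x * min (norm (h n x - k x)) m powr q \<partial>M) + m powr (q - p) * Np p (\<lambda>x. h n x - k x)"
        unfolding Np_def using LpD[OF dL[of n]] im by simp
      also have "m powr (q - p) * Np p (\<lambda>x. h n x - k x) \<le> m powr (q - p) * D" by (intro mult_left_mono D) auto
      also have "m powr (q - p) * D \<le> e / 2" unfolding m(2) using e D0 by (simp add: field_simps)
      finally show ?thesis using n0[OF n] by (simp add: abs_less_iff)
    qed
    then show "\<exists>no. \<forall>n\<ge>no. norm (Np q (\<lambda>x. h n x - k x) - 0) < e" by (auto simp: abs_of_nonneg[OF Np_nonneg])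
  qed
qed

text \<open>Dominated convergence with the bound from \<open>norm_powr_quotient_bound\<close> at
  \<open>t = 1\<close>. A one-sided derivative along the steps \<open>1 / (n + 1)\<close> suffices,
  because minimality is tested with both signs of the direction.\<close>

lemma Np_directional_derivative:
  fixes h k :: "'a \<Rightarrow> 'v::euclidean_space"
  assumes r: "1 < r" and h: "h \<in> Lp r" and k: "k \<in> Lp r"
  shows "integrable M (\<lambda>x. w x * norm (h x) powr (r - 2) * (h x \<bullet> k x))"
    and "(\<lambda>n. (Np r (\<lambda>x. h x + (1 / real (Suc n)) *\<^sub>R k x) - Np r h) / (1 / real (Suc n)))
      \<longlonglongrightarrow> r * (\<integral>x. w x * norm (h x) powr (r - 2) * (h x \<bullet> k x) \<partial>M)"
proof -
  have r0: "0 < r" using r by simp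
  note [measurable] = LpD(1)[OF h] LpD(1)[OF k]
  define t where "t n = 1 / real (Suc n)" for n
  have t: "0 < t n" "t n \<le> 1" for n by (auto simp: t_def)
  define W where "W x = w x * norm (h x + k x) powr r + w x * norm (h x - k x) powr r" for x
  define Q where "Q n x = w x * ((norm (h x + t n *\<^sub>R k x) powr r - norm (h x) powr r) / t n)" for n x
  define D where "D x = w x * (r * norm (h x) powr (r - 2) * (h x \<bullet> k x))" for x
  have W: "integrable M W" unfolding W_def
    using LpD(2)[OF Lp_add(1)[OF r0 h k]] LpD(2)[OF Lp_diff[OF r0 h k]] by simp
  have [measurable]: "Q n \<in> borel_measurable M" "D \<in> borel_measurable M" for n unfolding Q_def D_def by measurable
  have lim: "AE x in M. (\<lambda>n. Q n x) \<longlonglongrightarrow> D x" unfolding Q_def D_def t_def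
    by (intro AE_I2 tendsto_mult tendsto_const norm_powr_quotient_tendsto r)
  have bd: "AE x in M. norm (Q n x) \<le> W x" for n
  proof (rule AE_I2)
    fix x assume x: "x \<in> space M"
    have "norm (Q n x) = w x * \<bar>(norm (h x + t n *\<^sub>R k x) powr r - norm (h x) powr r) / t n\<bar>"
      using w_pos[OF x] by (simp add: Q_def abs_mult)
    also have "\<dots> \<le> w x * (norm (h x + k x) powr r + norm (h x - k x) powr r)"
      using w_pos[OF x] r by (intro mult_left_mono norm_powr_quotient_bound t) auto
    finally show "norm (Q n x) \<le> W x" by (simp add: W_def algebra_simps)
  qed
  have D: "integrable M D" "(\<lambda>n. \<integral>x. Q n x \<partial>M) \<longlonglongrightarrow> (\<integral>x. D x \<partial>M)"
    by (rule integrable_dominated_convergence[OF _ _ W lim bd] integral_dominated_convergence[OF _ _ W lim bd]; measurable)+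
  have De: "D = (\<lambda>x. r * (w x * norm (h x) powr (r - 2) * (h x \<bullet> k x)))" by (simp add: D_def fun_eq_iff)
  show "integrable M (\<lambda>x. w x * norm (h x) powr (r - 2) * (h x \<bullet> k x))"
    using D(1) r unfolding De by (simp add: integrable_mult_right_iff)
  have "(\<integral>x. Q n x \<partial>M) = (Np r (\<lambda>x. h x + t n *\<^sub>R k x) - Np r h) / t n" for n
  proof -
    have "Q n = (\<lambda>x. (w x * norm (h x + t n *\<^sub>R k x) powr r - w x * norm (h x) powr r) / t n)"
      by (simp add: Q_def fun_eq_iff algebra_simps)
    then show ?thesis unfolding Np_def
      using LpD(2)[OF h] LpD(2)[OF Lp_add(1)[OF r0 h Lp_scaleR[OF k, of "t n"]]] by simp
  qed
  then show "(\<lambda>n. (Np r (\<lambda>x. h x + (1 / real (Suc n)) *\<^sub>R k x) - Np r h) / (1 / real (Suc n)))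
      \<longlonglongrightarrow> r * (\<integral>x. w x * norm (h x) powr (r - 2) * (h x \<bullet> k x) \<partial>M)"
    using D(2) unfolding t_def De by simp
qed

end

subsection \<open>Calculus of smooth functions\<close>

lemma frechet_derivative_eq:
  assumes "(f has_derivative f') (at x)"
  shows "frechet_derivative f (at x) = f'"
  using frechet_derivative_at[OF assms] by simp

lemma C_times_Suc_imp:
  "C_times (Suc k) f \<Longrightarrow> C_times k f"
proof (induction k arbitrary: f)
  case 0
  then show ?case by (auto intro!: continuous_at_imp_continuous_on differentiable_imp_continuous_within)
next
  case (Suc k)
  then show ?case by (metis C_times.simps(2))
qed

lemma C_times_const [simp]: "C_times k (\<lambda>x. c)"
  by (induction k arbitrary: c) (auto simp: frechet_derivative_const)

lemma C_times_linear:
  assumes "bounded_linear f"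
  shows "C_times k f"
proof (cases k)
  case 0
  then show ?thesis using linear_continuous_on[OF assms] by simp
next
  case (Suc j)
  have "frechet_derivative f (at x) = f" for x
    by (rule frechet_derivative_eq) (rule bounded_linear_imp_has_derivative[OF assms])
  then show ?thesis using Suc bounded_linear_imp_differentiable[OF assms] by simp
qed

lemma C_times_add:
  "C_times k f \<Longrightarrow> C_times k g \<Longrightarrow> C_times k (\<lambda>x. f x + g x)"
proof (induction k arbitrary: f g)
  case 0
  then show ?case by (auto intro: continuous_on_add)
next
  case (Suc k)
  then have d: "f differentiable (at x)" "g differentiable (at x)" for x by auto
  have "frechet_derivative (\<lambda>x. f x + g x) (at x) = (\<lambda>v. frechet_derivative f (at x) v + frechet_derivative g (at x) v)" for x
    by (rule frechet_derivative_eq) (intro has_derivative_add d[THEN frechet_derivative_works[THEN iffD1]])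
  then show ?case using Suc d by auto
qed

lemma C_times_mult:
  "C_times k f \<Longrightarrow> C_times k g \<Longrightarrow> C_times k (\<lambda>x. f x * g x)"
proof (induction k arbitrary: f g)
  case 0
  then show ?case by (auto intro: continuous_on_mult)
next
  case (Suc k)
  then have d: "f differentiable (at x)" "g differentiable (at x)" for x by auto
  have "frechet_derivative (\<lambda>x. f x * g x) (at x)
      = (\<lambda>v. f x * frechet_derivative g (at x) v + frechet_derivative f (at x) v * g x)" for x
    by (rule frechet_derivative_eq) (intro has_derivative_mult d[THEN frechet_derivative_works[THEN iffD1]])
  moreover have "C_times k f" "C_times k g" using Suc.prems C_times_Suc_imp by auto
  ultimately show ?case using Suc d by (auto intro!: C_times_add)
qed

lemma C_times_sum:
  "(\<And>i. i \<in> I \<Longrightarrow> C_times k (f i)) \<Longrightarrow> C_times k (\<lambda>x. \<Sum>i\<in>I. f i x)"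
  by (induction I rule: infinite_finite_induct) (auto intro: C_times_add)

text \<open>The families in question, \<open>y powr r\<close> indexed by \<open>r\<close> and \<open>exp (- 1/t) * (1/t)^m\<close> indexed by \<open>m\<close>, are
  closed under differentiation up to linear combinations, which lets the induction on \<open>k\<close> go through.\<close>

lemma C_times_compose_family:
  fixes F :: "'i \<Rightarrow> real \<Rightarrow> real" and S :: "real set"
  assumes der: "\<And>i y. y \<in> S \<Longrightarrow> (F i has_real_derivative (c1 i * F (j1 i) y + c2 i * F (j2 i) y)) (at y)"
    and f: "C_times k f" and S: "\<And>x. f x \<in> S"
  shows "C_times k (\<lambda>x. F i (f x))"
  using f
proof (induction k arbitrary: i)
  case 0
  have "isCont (F i) y" if "y \<in> S" for y using DERIV_isCont[OF der[OF that]] .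
  then have "continuous_on (range f) (F i)" using S by (intro continuous_at_imp_continuous_on) auto
  then show ?case using 0 continuous_on_compose[of UNIV f "F i"] by (simp add: o_def)
next
  case (Suc k)
  then have d: "f differentiable (at x)" for x by auto
  have D: "((\<lambda>x. F i (f x)) has_derivative
      (\<lambda>v. (c1 i * F (j1 i) (f x) + c2 i * F (j2 i) (f x)) * frechet_derivative f (at x) v)) (at x)" for x
    using has_derivative_compose[OF d[THEN frechet_derivative_works[THEN iffD1]] der[OF S, unfolded has_field_derivative_def]]
    by simp
  have "C_times k f" using Suc.prems C_times_Suc_imp by blast
  then have "C_times k (\<lambda>x. F (j1 i) (f x))" "C_times k (\<lambda>x. F (j2 i) (f x))" using Suc.IH by auto
  then show ?case using Suc.prems D
    by (auto simp: frechet_derivative_eq[OF D] differentiable_def intro!: C_times_mult C_times_add)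
qed

lemma C_times_powr:
  assumes "C_times k f" "\<And>x. 0 < f x"
  shows "C_times k (\<lambda>x. f x powr r)"
proof (rule C_times_compose_family[where F = "\<lambda>r y. y powr r" and S = "{0<..}" and ?c1.0 = "\<lambda>r. r"
      and ?j1.0 = "\<lambda>r. r - 1" and ?c2.0 = "\<lambda>_. 0"])
  fix y r :: real
  assume "y \<in> {0<..}"
  then show "((\<lambda>y. y powr r) has_real_derivative r * y powr (r - 1) + 0 * y powr r) (at y)"
    by (auto intro!: has_real_derivative_powr)
qed (use assms in auto)

section \<open>Construction of bump functions\<close>

definition exp_inverse_power :: "nat \<Rightarrow> real \<Rightarrow> real" where
  "exp_inverse_power m t = (if 0 < t then exp (- (1 / t)) * (1 / t) ^ m else 0)"

lemma exp_inverse_power_tendsto: "(exp_inverse_power m \<longlongrightarrow> 0) (at 0)"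
proof -
  have "((\<lambda>z::real. z ^ m / exp z) \<longlongrightarrow> 0) at_top" by (rule tendsto_power_div_exp_0)
  then have "((\<lambda>t::real. inverse t ^ m / exp (inverse t)) \<longlongrightarrow> 0) (at_right 0)"
    by (rule filterlim_compose) (rule filterlim_inverse_at_top_right)
  moreover have "\<forall>\<^sub>F t in at_right 0. inverse t ^ m / exp (inverse t) = exp_inverse_power m t"
    by (auto simp: eventually_at_filter exp_inverse_power_def exp_minus field_simps)
  ultimately have "(exp_inverse_power m \<longlongrightarrow> 0) (at_right 0)" by (rule Lim_transform_eventually)
  moreover have "(exp_inverse_power m \<longlongrightarrow> 0) (at_left 0)"
    by (rule Lim_transform_eventually[of "\<lambda>_. 0"]) (auto simp: eventually_at_filter exp_inverse_power_def)
  ultimately show ?thesis by (simp add: filterlim_split_at)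
qed

lemma exp_inverse_power_derivative:
  "(exp_inverse_power m has_real_derivative 1 * exp_inverse_power (m + 2) t + (- real m) * exp_inverse_power (m + 1) t) (at t)"
proof -
  consider "0 < t" | "t < 0" | "t = 0" by linarith
  then show ?thesis
  proof cases
    case 1
    have inv: "((\<lambda>t. 1 / t) has_real_derivative - ((1 / t) ^ 2)) (at t)"
      using 1 by (auto intro!: derivative_eq_intros simp: power2_eq_square)
    have "((\<lambda>t. (1 / t) ^ m) has_real_derivative - real m * (1 / t) ^ (m + 1)) (at t)"
    proof (rule DERIV_cong[OF DERIV_power[OF inv]])
      have "real m * (- (u ^ 2) * u ^ (m - Suc 0)) = - real m * u ^ (m + 1)" for u :: real
        by (cases m; simp add: power2_eq_square algebra_simps)
      then show "real m * (- ((1 / t)\<^sup>2) * (1 / t) ^ (m - Suc 0)) = - real m * (1 / t) ^ (m + 1)" .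
    qed
    moreover have "((\<lambda>t. exp (- (1 / t))) has_real_derivative exp (- (1 / t)) * (1 / t) ^ 2) (at t)"
      using DERIV_fun_exp[OF DERIV_minus[OF inv]] by simp
    ultimately have "((\<lambda>t. exp (- (1 / t)) * (1 / t) ^ m) has_real_derivative
        exp (- (1 / t)) * (1 / t) ^ 2 * (1 / t) ^ m + - real m * (1 / t) ^ (m + 1) * exp (- (1 / t))) (at t)"
      by (intro DERIV_mult)
    moreover have "exp (- (1 / t)) * (1 / t) ^ 2 * (1 / t) ^ m + - real m * (1 / t) ^ (m + 1) * exp (- (1 / t))
        = exp_inverse_power (m + 2) t + (- real m) * exp_inverse_power (m + 1) t"
    proof -
      have "e * u ^ 2 * u ^ m + - real m * u ^ (m + 1) * e = e * u ^ (m + 2) + - real m * (e * u ^ (m + 1))"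
        for e u :: real by (simp add: power_add algebra_simps power2_eq_square)
      then show ?thesis using 1 unfolding exp_inverse_power_def by (simp only: if_True)
    qed
    ultimately have "((\<lambda>t. exp (- (1 / t)) * (1 / t) ^ m) has_real_derivative
        exp_inverse_power (m + 2) t + (- real m) * exp_inverse_power (m + 1) t) (at t)" by simp
    then show ?thesis using 1
      by (subst DERIV_cong_ev[OF refl _ refl, of _ "\<lambda>t. exp (- (1 / t)) * (1 / t) ^ m"])
        (auto simp: exp_inverse_power_def eventually_nhds intro!: exI[of _ "{0<..}"])
  next
    case 2
    then show ?thesis
      by (subst DERIV_cong_ev[OF refl _ refl, of _ "\<lambda>t. 0"])
        (auto simp: exp_inverse_power_def eventually_nhds intro!: exI[of _ "{..<0}"])
  next
    case 3
    \<comment> \<open>The difference quotient at 0 of the member with index \<open>m\<close> is the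
      member with index \<open>m + 1\<close>, which tends to 0.\<close>
    have "((\<lambda>h. (exp_inverse_power m (0 + h) - exp_inverse_power m 0) / h) \<longlongrightarrow> 0) (at 0)"
      using exp_inverse_power_tendsto[of "m + 1"]
      by (rule Lim_transform_eventually) (auto simp: eventually_at_filter exp_inverse_power_def)
    then show ?thesis using 3 by (simp add: DERIV_def exp_inverse_power_def)
  qed
qed

lemma C_times_bump:
  assumes "C_times k f"
  shows "C_times k (\<lambda>x. exp_inverse_power m (f x))"
  by (rule C_times_compose_family[where S = UNIV, OF exp_inverse_power_derivative assms]) auto

lemma smoothI: "(\<And>k. C_times k f) \<Longrightarrow> smooth f" and smoothD: "smooth f \<Longrightarrow> C_times k f"
  by (auto simp: smooth_def)

lemma smooth_add: "smooth f \<Longrightarrow> smooth g \<Longrightarrow> smooth (\<lambda>x. f x + g x)"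
  and smooth_mult: "smooth f \<Longrightarrow> smooth g \<Longrightarrow> smooth (\<lambda>x. f x * g x)"
  and smooth_const: "smooth (\<lambda>x. c)"
  by (auto simp: smooth_def intro: C_times_add C_times_mult)

lemma smooth_powr: "smooth f \<Longrightarrow> (\<And>x. 0 < f x) \<Longrightarrow> smooth (\<lambda>x. f x powr r)"
  by (auto simp: smooth_def intro: C_times_powr)

lemma smooth_has_derivative:
  assumes "smooth f"
  shows "(f has_derivative (\<lambda>v. grad f x \<bullet> v)) (at x)"
proof -
  have "f differentiable (at x)" using smoothD[OF assms, of "Suc 0"] by simp
  then have D: "(f has_derivative frechet_derivative f (at x)) (at x)" by (simp add: frechet_derivative_works)
  interpret linear "frechet_derivative f (at x)" using D by (rule has_derivative_linear)
  have "frechet_derivative f (at x) v = grad f x \<bullet> v" for v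
    by (subst euclidean_representation[of v, symmetric])
      (simp only: sum scale grad_def inner_sum_left inner_scaleR_left, simp add: inner_commute mult.commute)
  then have "frechet_derivative f (at x) = (\<lambda>v. grad f x \<bullet> v)" by (rule ext)
  then show ?thesis using D by simp
qed

lemma grad_eqI:
  assumes "(f has_derivative (\<lambda>v. g \<bullet> v)) (at x)"
  shows "grad f x = g"
  by (simp add: grad_def frechet_derivative_eq[OF assms] euclidean_representation)

lemma continuous_on_grad:
  assumes "smooth f"
  shows "continuous_on A (grad f)"
proof -
  have "continuous_on UNIV (\<lambda>x. frechet_derivative f (at x) v)" for v using smoothD[OF assms, of "Suc 0"] by simp
  then have "continuous_on UNIV (grad f)" unfolding grad_def
    by (intro continuous_on_sum continuous_on_scaleR continuous_on_const) auto
  then show ?thesis by (rule continuous_on_subset) auto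
qed

lemma continuous_on_smooth: "smooth f \<Longrightarrow> continuous_on A f"
  using smoothD[of f 0] continuous_on_subset by auto

lemma grad_add_scaled:
  assumes "smooth f" "smooth g"
  shows "grad (\<lambda>x. f x + c * g x) x = grad f x + c *\<^sub>R grad g x"
proof (rule grad_eqI)
  have "((\<lambda>x. f x + c * g x) has_derivative (\<lambda>v. grad f x \<bullet> v + c * (grad g x \<bullet> v))) (at x)"
    by (intro has_derivative_add has_derivative_mult_right smooth_has_derivative assms)
  then show "((\<lambda>x. f x + c * g x) has_derivative (\<lambda>v. (grad f x + c *\<^sub>R grad g x) \<bullet> v)) (at x)"
    by (simp add: inner_add_left)
qed

lemma grad_mult:
  assumes "smooth f" "smooth g"
  shows "grad (\<lambda>x. f x * g x) x = f x *\<^sub>R grad g x + g x *\<^sub>R grad f x"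
proof (rule grad_eqI)
  have "((\<lambda>x. f x * g x) has_derivative (\<lambda>v. f x * (grad g x \<bullet> v) + (grad f x \<bullet> v) * g x)) (at x)"
    by (intro has_derivative_mult smooth_has_derivative assms)
  then show "((\<lambda>x. f x * g x) has_derivative (\<lambda>v. (f x *\<^sub>R grad g x + g x *\<^sub>R grad f x) \<bullet> v)) (at x)"
    by (simp add: inner_add_left mult.commute)
qed

lemma grad_eq_0_outside_support:
  assumes "x \<notin> closure {x. f x \<noteq> 0}"
  shows "grad f x = 0"
proof (rule grad_eqI)
  have "((\<lambda>x. 0) has_derivative (\<lambda>v. 0 \<bullet> v)) (at x)" by simp
  then show "(f has_derivative (\<lambda>v. 0 \<bullet> v)) (at x)"
    by (rule has_derivative_transform_within_open[of _ _ _ UNIV "- closure {x. f x \<noteq> 0}"])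
      (use assms closure_subset[of "{x. f x \<noteq> 0}"] in auto)
qed

lemma Cc_infinityD:
  assumes "f \<in> Cc_infinity \<Omega>"
  shows "smooth f" "bounded {x. f x \<noteq> 0}"
  using assms by (auto simp: Cc_infinity_def)

lemma Cc_infinity_UNIV_I: "smooth f \<Longrightarrow> bounded {x. f x \<noteq> 0} \<Longrightarrow> f \<in> Cc_infinity UNIV"
  by (simp add: Cc_infinity_def compact_closure)

lemma Cc_infinity_UNIV: "f \<in> Cc_infinity \<Omega> \<Longrightarrow> f \<in> Cc_infinity UNIV"
  by (simp add: Cc_infinity_def)

lemma Cc_infinity_bounds:
  assumes "f \<in> Cc_infinity \<Omega>"
  obtains B R where "\<And>x. \<bar>f x\<bar> \<le> B" "\<And>x. norm (grad f x) \<le> B" 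
    "\<And>x. R < norm x \<Longrightarrow> f x = 0" "\<And>x. R < norm x \<Longrightarrow> grad f x = 0" "0 < B"
proof -
  have s: "smooth f" and K: "compact (closure {x. f x \<noteq> 0})" using assms by (auto simp: Cc_infinity_def)
  define K where "K = closure {x. f x \<noteq> 0}"
  have z: "f x = 0" "grad f x = 0" if "x \<notin> K" for x
    using that closure_subset[of "{x. f x \<noteq> 0}"] grad_eq_0_outside_support[of x f] by (auto simp: K_def)
  obtain R where R: "\<And>x. x \<in> K \<Longrightarrow> norm x \<le> R"
    using compact_imp_bounded[OF K] by (auto simp: bounded_iff K_def)
  obtain B1 where B1: "\<And>x. x \<in> K \<Longrightarrow> norm (f x) \<le> B1"
    using compact_imp_bounded[OF compact_continuous_image[OF continuous_on_smooth[OF s] K]] by (auto simp: bounded_iff K_def)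
  obtain B2 where B2: "\<And>x. x \<in> K \<Longrightarrow> norm (grad f x) \<le> B2"
    using compact_imp_bounded[OF compact_continuous_image[OF continuous_on_grad[OF s] K]] by (auto simp: bounded_iff K_def)
  show thesis
  proof (rule that[of "max 1 (max B1 B2)" R])
    fix x
    show "\<bar>f x\<bar> \<le> max 1 (max B1 B2)" using B1[of x] z[of x] by (cases "x \<in> K") auto
    show "norm (grad f x) \<le> max 1 (max B1 B2)" using B2[of x] z[of x] by (cases "x \<in> K") auto
    show "f x = 0" "grad f x = 0" if "R < norm x" using R[of x] z[of x] that by (cases "x \<in> K"; auto)+
  qed auto
qed

lemma Cc_infinity_add_scaled:
  assumes "f \<in> Cc_infinity UNIV" "g \<in> Cc_infinity UNIV"
  shows "(\<lambda>x. f x + c * g x) \<in> Cc_infinity UNIV"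
proof (rule Cc_infinity_UNIV_I)
  show "smooth (\<lambda>x. f x + c * g x)" using assms[THEN Cc_infinityD(1)] by (intro smooth_add smooth_mult smooth_const)
  show "bounded {x. f x + c * g x \<noteq> 0}"
    by (rule bounded_subset[of "{x. f x \<noteq> 0} \<union> {x. g x \<noteq> 0}"])
      (use assms[THEN Cc_infinityD(2)] in auto)
qed

lemma Cc_infinity_mult:
  assumes "f \<in> Cc_infinity UNIV" "g \<in> Cc_infinity UNIV"
  shows "(\<lambda>x. f x * g x) \<in> Cc_infinity UNIV"
proof (rule Cc_infinity_UNIV_I)
  show "smooth (\<lambda>x. f x * g x)" using assms[THEN Cc_infinityD(1)] by (intro smooth_mult)
  show "bounded {x. f x * g x \<noteq> 0}"
    by (rule bounded_subset[OF Cc_infinityD(2)[OF assms(1)]]) auto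
qed

text \<open>The classical bump \<open>exp (- 1 / (1 - (dist c x)\<^sup>2))\<close>, extended by 0.
  The squared distance is written in coordinates, as a polynomial, so that smoothness follows from
  the rules for sums and products.\<close>

lemma ex_bump:
  fixes c :: "'a::euclidean_space"
  shows "\<exists>f\<in>Cc_infinity UNIV. (\<forall>x. 0 \<le> f x) \<and> (\<forall>x\<in>ball c 1. 0 < f x)"
proof (rule bexI[of _ "\<lambda>x. exp_inverse_power 0 (1 - (\<Sum>i\<in>Basis. ((x - c) \<bullet> i)\<^sup>2))"])
  have n: "(\<Sum>i\<in>Basis. ((x - c) \<bullet> i)\<^sup>2) = (dist c x)\<^sup>2" for x
  proof -
    have "(dist c x)\<^sup>2 = (x - c) \<bullet> (x - c)"
      unfolding dist_norm by (subst norm_minus_commute) (rule power2_norm_eq_inner)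
    also have "\<dots> = (\<Sum>i\<in>Basis. ((x - c) \<bullet> i) * ((x - c) \<bullet> i))" by (rule euclidean_inner)
    finally show ?thesis by (simp only: power2_eq_square)
  qed
  have lin: "C_times k (\<lambda>x. x \<bullet> i + (- (c \<bullet> i)))" for i k
    by (intro C_times_add C_times_const C_times_linear bounded_linear_inner_left)
  have "C_times k (\<lambda>x. 1 + (-1) * (\<Sum>i\<in>Basis. (x \<bullet> i + (- (c \<bullet> i))) * (x \<bullet> i + (- (c \<bullet> i)))))" for k
    by (intro C_times_add C_times_mult C_times_const C_times_sum lin)
  then have "C_times k (\<lambda>x. 1 - (\<Sum>i\<in>Basis. ((x - c) \<bullet> i)\<^sup>2))" for k
    by (simp add: inner_diff_left power2_eq_square)
  then have "smooth (\<lambda>x. exp_inverse_power 0 (1 - (\<Sum>i\<in>Basis. ((x - c) \<bullet> i)\<^sup>2)))"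
    by (intro smoothI C_times_bump)
  moreover have "{x. exp_inverse_power 0 (1 - (\<Sum>i\<in>Basis. ((x - c) \<bullet> i)\<^sup>2)) \<noteq> 0} \<subseteq> ball c 1"
    unfolding n by (auto simp: exp_inverse_power_def abs_square_less_1 split: if_splits)
  ultimately show "(\<lambda>x. exp_inverse_power 0 (1 - (\<Sum>i\<in>Basis. ((x - c) \<bullet> i)\<^sup>2))) \<in> Cc_infinity UNIV"
    by (intro Cc_infinity_UNIV_I bounded_subset[OF bounded_ball])
  show "(\<forall>x. 0 \<le> exp_inverse_power 0 (1 - (\<Sum>i\<in>Basis. ((x - c) \<bullet> i)\<^sup>2))) \<and>
     (\<forall>x\<in>ball c 1. 0 < exp_inverse_power 0 (1 - (\<Sum>i\<in>Basis. ((x - c) \<bullet> i)\<^sup>2)))"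
    unfolding n by (auto simp: exp_inverse_power_def abs_square_less_1)
qed

subsection \<open>Integration by parts and Hardy's inequality\<close>

lemma lborel_integral_translate:
  fixes f :: "'a::euclidean_space \<Rightarrow> real"
  assumes [measurable]: "f \<in> borel_measurable borel"
  shows "(\<integral>x. f (x + c) \<partial>lborel) = (\<integral>x. f x \<partial>lborel)"
    and "integrable lborel (\<lambda>x. f (x + c)) \<longleftrightarrow> integrable lborel f"
proof -
  have e: "(\<lambda>x. f (x + c)) = (\<lambda>x. f (c + x))" by (simp add: add.commute)
  show "(\<integral>x. f (x + c) \<partial>lborel) = (\<integral>x. f x \<partial>lborel)"
    unfolding e by (subst (2) lborel_distr_plus[of c, symmetric]) (simp add: integral_distr)
  show "integrable lborel (\<lambda>x. f (x + c)) \<longleftrightarrow> integrable lborel f"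
    unfolding e by (subst (2) lborel_distr_plus[of c, symmetric]) (simp add: integrable_distr_eq)
qed

lemma integrable_indicator_cball:
  "integrable lborel (\<lambda>x::'a::euclidean_space. B * indicator (cball c R) x :: real)"
  using emeasure_bounded_finite[OF bounded_cball[of c R]]
  by (intro integrable_mult_right integrable_real_indicator) auto

lemma integrable_bounded_support:
  fixes f :: "'a::euclidean_space \<Rightarrow> real"
  assumes "f \<in> borel_measurable lborel" "\<And>x. \<bar>f x\<bar> \<le> B" "\<And>x. R < norm x \<Longrightarrow> f x = 0"
  shows "integrable lborel f"
proof (rule Bochner_Integration.integrable_bound)
  show "integrable lborel (\<lambda>x. B * indicator (cball 0 R) x :: real)"
    by (rule integrable_indicator_cball)
  show "AE x in lborel. norm (f x) \<le> norm (B * indicator (cball 0 R) x :: real)"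
    using assms(2,3) by (intro AE_I2) (auto simp: indicator_def not_le intro: order_trans[OF assms(2)])
qed (use assms in auto)

text \<open>Translation invariance of Lebesgue measure, applied to difference quotients, replaces Fubini's theorem and the
  fundamental theorem of calculus.\<close>

lemma translation_quotient_tendsto:
  fixes G D :: "'a::euclidean_space \<Rightarrow> real"
  assumes \<Omega>: "open \<Omega>" "\<And>x t. x \<in> \<Omega> \<Longrightarrow> 0 \<le> t \<Longrightarrow> x + t *\<^sub>R e \<in> \<Omega>"
    and der: "\<And>x. x \<in> \<Omega> \<Longrightarrow> ((\<lambda>t. G (x + t *\<^sub>R e)) has_real_derivative D x) (at 0)"
    and cont: "continuous_on \<Omega> G"
    and B: "\<And>x. x \<in> \<Omega> \<Longrightarrow> \<bar>G x\<bar> \<le> B" "\<And>x. x \<in> \<Omega> \<Longrightarrow> \<bar>D x\<bar> \<le> B"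
    and R: "\<And>x. x \<in> \<Omega> \<Longrightarrow> R < norm x \<Longrightarrow> G x = 0"
  defines "H \<equiv> \<lambda>x. indicator \<Omega> x * G x"
  shows "set_integrable lebesgue \<Omega> D" "integrable lborel H"
    "(\<lambda>n. ((\<integral>x. indicator \<Omega> x * H (x + (1 / real (Suc n)) *\<^sub>R e) \<partial>lborel) - (\<integral>x. H x \<partial>lborel)) / (1 / real (Suc n)))
      \<longlonglongrightarrow> (LINT x:\<Omega>|lebesgue. D x)"
proof -
  define t where "t n = 1 / real (Suc n)" for n
  have t: "0 < t n" "t n \<le> 1" for n by (auto simp: t_def)
  have \<Omega>b [measurable]: "\<Omega> \<in> sets borel" using \<Omega>(1) by simp
  have Hm [measurable]: "H \<in> borel_measurable borel" unfolding H_def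
    using borel_measurable_continuous_on_indicator[OF \<Omega>b cont] by simp
  have Hi: "integrable lborel H"
  proof (rule integrable_bounded_support[of _ "max 0 B" R])
    show "\<bar>H x\<bar> \<le> max 0 B" "R < norm x \<Longrightarrow> H x = 0" for x
      using B R by (auto simp: H_def indicator_def le_max_iff_disj)
  qed (use Hm in simp)
  then show "integrable lborel H" .
  have Ht: "integrable lborel (\<lambda>x. indicator \<Omega> x * H (x + c))" for c
    by (rule Bochner_Integration.integrable_bound[OF lborel_integral_translate(2)[OF Hm, THEN iffD2, OF Hi, of c]])
      (auto simp: indicator_def)
  \<comment> \<open>The indicator discards points outside \<open>\<Omega>\<close> that the
    translation moves into it, so \<open>q n\<close> is the genuine difference quotient of
    \<open>G\<close> on \<open>\<Omega>\<close> and 0 elsewhere.\<close>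
  define q where "q n x = (indicator \<Omega> x * H (x + t n *\<^sub>R e) - H x) / t n" for n x
  have qm [measurable]: "q n \<in> borel_measurable lborel" for n unfolding q_def by measurable
  have q\<Omega>: "q n x = (G (x + t n *\<^sub>R e) - G x) / t n" if "x \<in> \<Omega>" for n x
    using that \<Omega>(2)[of x "t n"] t[of n] by (simp add: q_def H_def)
  have q0: "q n x = 0" if "x \<notin> \<Omega>" for n x using that by (simp add: q_def H_def)
  have lim: "(\<lambda>n. q n x) \<longlonglongrightarrow> indicator \<Omega> x * D x" for x
  proof (cases "x \<in> \<Omega>")
    case True
    have "filterlim t (at 0) sequentially" unfolding t_def
      using LIMSEQ_Suc[OF lim_1_over_n[where 'a=real]] by (auto simp: filterlim_at)
    moreover have "((\<lambda>s. (G (x + s *\<^sub>R e) - G x) / s) \<longlongrightarrow> D x) (at 0)"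
      using der[OF True] by (simp add: DERIV_def)
    ultimately show ?thesis using True filterlim_compose by (fastforce simp: q\<Omega>)
  qed (simp add: q0)
  \<comment> \<open>Domination: the ray from \<open>x\<close> stays in \<open>\<Omega>\<close>, so
    the mean value theorem bounds the quotient by \<open>B\<close>. Outside the enlarged ball both
    values of \<open>G\<close> vanish, since the step is at most \<open>norm e\<close>.\<close>
  have qB: "\<bar>q n x\<bar> \<le> max 0 B * indicator (cball 0 (R + norm e)) x" for n x
  proof (cases "x \<in> \<Omega>")
    case False
    then show ?thesis by (simp add: q0)
  next
    case True
    show ?thesis
    proof (cases "norm x \<le> R + norm e")
      case False
      have "norm x \<le> norm (x + t n *\<^sub>R e) + norm (t n *\<^sub>R e)" using norm_triangle_ineq4[of "x + t n *\<^sub>R e" "t n *\<^sub>R e"] by simp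
      also have "norm (t n *\<^sub>R e) \<le> norm e" using t[of n] by (simp add: mult_left_le_one_le)
      finally have "R < norm (x + t n *\<^sub>R e)" "R < norm x" using False norm_ge_zero[of e] by linarith+
      then show ?thesis using R[OF True] R[OF \<Omega>(2)[OF True less_imp_le[OF t(1)[of n]]]] True False by (simp add: q\<Omega>)
    next
      case inb: True
      have d: "((\<lambda>s. G (x + s *\<^sub>R e)) has_real_derivative D (x + s *\<^sub>R e)) (at s)" if "0 \<le> s" for s
      proof -
        have "((\<lambda>h. G (x + (h + s) *\<^sub>R e)) has_real_derivative D (x + s *\<^sub>R e)) (at 0)"
          using der[OF \<Omega>(2)[OF True that]] by (simp add: algebra_simps)
        then show ?thesis using DERIV_shift[of "\<lambda>s. G (x + s *\<^sub>R e)" "D (x + s *\<^sub>R e)" 0 s] by simp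
      qed
      obtain z where z: "0 < z" "G (x + t n *\<^sub>R e) - G x = t n * D (x + z *\<^sub>R e)"
        using MVT2[OF t(1)[of n], of "\<lambda>s. G (x + s *\<^sub>R e)" "\<lambda>s. D (x + s *\<^sub>R e)"] d by auto
      have "q n x = D (x + z *\<^sub>R e)" using z t[of n] True by (simp add: q\<Omega>)
      then show ?thesis using B(2)[OF \<Omega>(2)[OF True], of z] z inb by (simp add: le_max_iff_disj)
    qed
  qed
  have bi: "integrable lborel (\<lambda>x. max 0 B * indicator (cball 0 (R + norm e)) x :: real)"
    by (rule integrable_indicator_cball)
  have Dm: "(\<lambda>x. indicator \<Omega> x * D x) \<in> borel_measurable lborel"
    by (rule borel_measurable_LIMSEQ_real[OF lim qm])
  have Di: "integrable lborel (\<lambda>x. indicator \<Omega> x * D x)"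
    by (rule integrable_dominated_convergence[where s = q, OF Dm _ bi]) (use qm lim qB in auto)
  have Dl: "(\<lambda>n. \<integral>x. q n x \<partial>lborel) \<longlonglongrightarrow> (\<integral>x. indicator \<Omega> x * D x \<partial>lborel)"
    by (rule integral_dominated_convergence[where s = q, OF Dm _ bi]) (use qm lim qB in auto)
  show "set_integrable lebesgue \<Omega> D" unfolding set_integrable_def real_scaleR_def
    using Di Dm by (simp add: integrable_completion)
  have "(LINT x:\<Omega>|lebesgue. D x) = (\<integral>x. indicator \<Omega> x * D x \<partial>lborel)"
    unfolding set_lebesgue_integral_def real_scaleR_def by (rule integral_completion[OF Dm])
  moreover have "(\<integral>x. q n x \<partial>lborel) = ((\<integral>x. indicator \<Omega> x * H (x + t n *\<^sub>R e) \<partial>lborel) - (\<integral>x. H x \<partial>lborel)) / t n" for n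
    unfolding q_def using Ht Hi by simp
  ultimately show "(\<lambda>n. ((\<integral>x. indicator \<Omega> x * H (x + (1 / real (Suc n)) *\<^sub>R e) \<partial>lborel) - (\<integral>x. H x \<partial>lborel)) / (1 / real (Suc n)))
      \<longlonglongrightarrow> (LINT x:\<Omega>|lebesgue. D x)" using Dl by (simp add: t_def)
qed

text \<open>The translation maps \<open>\<Omega>\<close> into itself, so translating a nonnegative
  function can only lose mass and all difference quotients of the integral are nonpositive. This is
  the sign of the boundary term in the divergence theorem.\<close>

lemma integral_directional_derivative_le_0:
  fixes G D :: "'a::euclidean_space \<Rightarrow> real"
  assumes \<Omega>: "open \<Omega>" "\<And>x t. x \<in> \<Omega> \<Longrightarrow> 0 \<le> t \<Longrightarrow> x + t *\<^sub>R e \<in> \<Omega>"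
    and der: "\<And>x. x \<in> \<Omega> \<Longrightarrow> ((\<lambda>t. G (x + t *\<^sub>R e)) has_real_derivative D x) (at 0)"
    and cont: "continuous_on \<Omega> G"
    and B: "\<And>x. x \<in> \<Omega> \<Longrightarrow> \<bar>G x\<bar> \<le> B" "\<And>x. x \<in> \<Omega> \<Longrightarrow> \<bar>D x\<bar> \<le> B"
    and R: "\<And>x. x \<in> \<Omega> \<Longrightarrow> R < norm x \<Longrightarrow> G x = 0"
    and nn: "\<And>x. x \<in> \<Omega> \<Longrightarrow> 0 \<le> G x"
  shows "(LINT x:\<Omega>|lebesgue. D x) \<le> 0"
proof -
  define H where "H = (\<lambda>x. indicator \<Omega> x * G x)"
  have Hi: "integrable lborel H" unfolding H_def by (rule translation_quotient_tendsto(2)[OF assms(1-7)])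
  have lim: "(\<lambda>n. ((\<integral>x. indicator \<Omega> x * H (x + (1 / real (Suc n)) *\<^sub>R e) \<partial>lborel) - (\<integral>x. H x \<partial>lborel)) / (1 / real (Suc n)))
      \<longlonglongrightarrow> (LINT x:\<Omega>|lebesgue. D x)"
    unfolding H_def by (rule translation_quotient_tendsto(3)[OF assms(1-7)])
  have Hm: "H \<in> borel_measurable borel" using borel_measurable_integrable[OF Hi] by simp
  have H0: "0 \<le> H x" for x using nn by (simp add: H_def indicator_def)
  have "(\<integral>x. indicator \<Omega> x * H (x + c) \<partial>lborel) \<le> (\<integral>x. H x \<partial>lborel)" for c
  proof -
    have i: "integrable lborel (\<lambda>x. H (x + c))" using lborel_integral_translate(2)[OF Hm] Hi by simp
    have "(\<integral>x. indicator \<Omega> x * H (x + c) \<partial>lborel) \<le> (\<integral>x. H (x + c) \<partial>lborel)"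
    proof (rule integral_mono_AE'[OF i])
      show "AE x in lborel. indicator \<Omega> x * H (x + c) \<le> H (x + c)" using H0 by (simp add: indicator_def)
      show "AE x in lborel. 0 \<le> H (x + c)" using H0 by simp
    qed
    then show ?thesis using lborel_integral_translate(1)[OF Hm] by simp
  qed
  then have "((\<integral>x. indicator \<Omega> x * H (x + (1 / real (Suc n)) *\<^sub>R e) \<partial>lborel) - (\<integral>x. H x \<partial>lborel)) / (1 / real (Suc n)) \<le> 0" for n
    by (intro divide_nonpos_nonneg) auto
  then show ?thesis using LIMSEQ_le_const2[OF lim] by blast
qed

section \<open>Integration by parts for test functions\<close>

lemma integrable_continuous_compact_support:
  fixes h :: "'a::euclidean_space \<Rightarrow> 'b::euclidean_space"
  assumes "continuous_on UNIV h" "\<And>x. R < norm x \<Longrightarrow> h x = 0"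
  shows "integrable lebesgue h"
proof -
  have "integrable lborel (\<lambda>x. indicator (cball 0 R) x *\<^sub>R h x)"
    by (rule borel_integrable_compact) (auto intro: continuous_on_subset[OF assms(1)])
  moreover have "(\<lambda>x. indicator (cball 0 R) x *\<^sub>R h x) = h" using assms(2) by (auto simp: indicator_def not_le fun_eq_iff)
  ultimately show ?thesis using assms(1) by (simp add: integrable_completion borel_measurable_continuous_onI)
qed

lemma smooth_DERIV:
  assumes "smooth f"
  shows "((\<lambda>t. f (x + t *\<^sub>R e)) has_real_derivative grad f x \<bullet> e) (at 0)"
proof -
  have "((\<lambda>t. x + t *\<^sub>R e) has_derivative (\<lambda>t. t *\<^sub>R e)) (at 0)" by (auto intro!: derivative_eq_intros)
  then have "((\<lambda>t. f (x + t *\<^sub>R e)) has_derivative (\<lambda>t. grad f x \<bullet> (t *\<^sub>R e))) (at 0)"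
    by (rule has_derivative_compose) (use smooth_has_derivative[OF assms, of x] in simp)
  then show ?thesis by (simp add: has_field_derivative_def mult_commute_abs)
qed

text \<open>On the whole space translation preserves the integral, so in each coordinate direction
  the difference quotients are identically 0.\<close>

lemma integral_grad_eq_0:
  fixes f :: "'a::euclidean_space \<Rightarrow> real"
  assumes f: "f \<in> Cc_infinity UNIV"
  shows "integrable lebesgue (grad f)" "(\<integral>x. grad f x \<partial>lebesgue) = 0"
proof -
  obtain B R where B: "\<And>x. \<bar>f x\<bar> \<le> B" "\<And>x. norm (grad f x) \<le> B"
    "\<And>x. R < norm x \<Longrightarrow> f x = 0" "\<And>x. R < norm x \<Longrightarrow> grad f x = 0" "0 < B" using Cc_infinity_bounds[OF f] by blast
  note s = Cc_infinityD(1)[OF f]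
  show i: "integrable lebesgue (grad f)"
    by (rule integrable_continuous_compact_support[OF continuous_on_grad[OF s] B(4)])
  have "(\<integral>x. grad f x \<bullet> e \<partial>lebesgue) = 0" if e: "e \<in> Basis" for e
  proof -
    have le: "\<bar>grad f x \<bullet> e\<bar> \<le> B" for x using Basis_le_norm[OF e, of "grad f x"] B(2)[of x] by linarith
    note T = translation_quotient_tendsto[OF open_UNIV _ smooth_DERIV[OF s, of _ e] continuous_on_smooth[OF s] B(1) le B(3), simplified]
    have m: "f \<in> borel_measurable borel" using continuous_on_smooth[OF s] by (intro borel_measurable_continuous_onI)
    have "(\<lambda>n::nat. 0::real) \<longlonglongrightarrow> (LINT x:UNIV|lebesgue. grad f x \<bullet> e)"
      using T(3) by (simp add: lborel_integral_translate(1)[OF m])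
    then have "(LINT x:UNIV|lebesgue. grad f x \<bullet> e) = 0" using LIMSEQ_unique tendsto_const by blast
    then show ?thesis by (simp add: set_lebesgue_integral_def)
  qed
  then show "(\<integral>x. grad f x \<partial>lebesgue) = 0"
    by (intro euclidean_eqI[of _ 0]) (simp add: integral_inner_left[OF i, symmetric])
qed

text \<open>Only \<open>\<phi>\<close> has its support in \<open>\<Omega>\<close>; \<open>f\<close>
  may be nonzero on the boundary. Both integrands vanish off \<open>\<Omega>\<close>, so the product
  rule can be integrated over the whole space.\<close>

lemma integral_grad_by_parts:
  fixes f \<phi> :: "'a::euclidean_space \<Rightarrow> real"
  assumes f: "f \<in> Cc_infinity UNIV" and \<phi>: "\<phi> \<in> Cc_infinity \<Omega>"
  shows "(LINT x:\<Omega>|lebesgue. f x *\<^sub>R grad \<phi> x) = - (LINT x:\<Omega>|lebesgue. \<phi> x *\<^sub>R grad f x)"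
proof -
  have \<phi>': "\<phi> \<in> Cc_infinity UNIV" by (rule Cc_infinity_UNIV[OF \<phi>])
  note s = Cc_infinityD(1)[OF f] Cc_infinityD(1)[OF \<phi>]
  obtain B R where R: "\<And>x. \<bar>f x\<bar> \<le> B" "\<And>x. norm (grad f x) \<le> B"
    "\<And>x. R < norm x \<Longrightarrow> f x = 0" "\<And>x. R < norm x \<Longrightarrow> grad f x = 0" "0 < B" using Cc_infinity_bounds[OF f] by blast
  have i1: "integrable lebesgue (\<lambda>x. f x *\<^sub>R grad \<phi> x)"
    using R(3) by (intro integrable_continuous_compact_support[of _ R] continuous_on_scaleR continuous_on_grad continuous_on_smooth s) auto
  have i2: "integrable lebesgue (\<lambda>x. \<phi> x *\<^sub>R grad f x)"
    using R(4) by (intro integrable_continuous_compact_support[of _ R] continuous_on_scaleR continuous_on_grad continuous_on_smooth s) auto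
  have out: "\<phi> x = 0" "grad \<phi> x = 0" if "x \<notin> \<Omega>" for x
    using that \<phi> closure_subset[of "{x. \<phi> x \<noteq> 0}"] grad_eq_0_outside_support[of x \<phi>] by (auto simp: Cc_infinity_def)
  have "(\<integral>x. f x *\<^sub>R grad \<phi> x \<partial>lebesgue) + (\<integral>x. \<phi> x *\<^sub>R grad f x \<partial>lebesgue) = (\<integral>x. grad (\<lambda>x. f x * \<phi> x) x \<partial>lebesgue)"
    using i1 i2 by (simp add: grad_mult[OF s])
  also have "\<dots> = 0" by (rule integral_grad_eq_0(2)[OF Cc_infinity_mult[OF f \<phi>']])
  finally have "(\<integral>x. f x *\<^sub>R grad \<phi> x \<partial>lebesgue) = - (\<integral>x. \<phi> x *\<^sub>R grad f x \<partial>lebesgue)"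
    by (simp add: eq_neg_iff_add_eq_0)
  moreover have "indicator \<Omega> x *\<^sub>R f x *\<^sub>R grad \<phi> x = f x *\<^sub>R grad \<phi> x" "indicator \<Omega> x *\<^sub>R \<phi> x *\<^sub>R grad f x = \<phi> x *\<^sub>R grad f x" for x
    using out[of x] by (auto simp: indicator_def)
  ultimately show ?thesis unfolding set_lebesgue_integral_def by (simp only:)
qed

section \<open>Hardy's inequality\<close>

lemma has_real_derivative_abs_powr:
  assumes p: "1 < (p::real)"
  shows "((\<lambda>y. \<bar>y\<bar> powr p) has_real_derivative p * \<bar>y\<bar> powr (p - 1) * sgn y) (at y)"
proof -
  consider "0 < y" | "y < 0" | "y = 0" by linarith
  then show ?thesis
  proof cases
    case 1
    have "((\<lambda>y. y powr p) has_real_derivative p * y powr (p - 1)) (at y)" using 1 by (rule has_real_derivative_powr)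
    then have "((\<lambda>y. \<bar>y\<bar> powr p) has_real_derivative p * y powr (p - 1)) (at y)"
      by (rule has_field_derivative_transform_within_open[of _ _ _ "{0<..}"]) (use 1 in auto)
    then show ?thesis using 1 by simp
  next
    case 2
    have "((\<lambda>y. (- y) powr p) has_real_derivative p * (- y) powr (p - 1) * (- 1)) (at y)"
      by (rule DERIV_chain2[OF has_real_derivative_powr]) (use 2 in \<open>auto intro!: derivative_eq_intros\<close>)
    then have "((\<lambda>y. \<bar>y\<bar> powr p) has_real_derivative p * (- y) powr (p - 1) * (- 1)) (at y)"
      by (rule has_field_derivative_transform_within_open[of _ _ _ "{..<0}"]) (use 2 in auto)
    then show ?thesis using 2 by simp
  next
    case 3
    have "((\<lambda>h::real. \<bar>h\<bar> powr (p - 1)) \<longlongrightarrow> \<bar>0\<bar> powr (p - 1)) (at 0)"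
      using p by (intro tendsto_powr' tendsto_rabs tendsto_ident_at tendsto_const) auto
    then have "((\<lambda>h::real. \<bar>h\<bar> powr (p - 1)) \<longlongrightarrow> 0) (at 0)" by simp
    moreover have "norm (\<bar>h\<bar> powr p / h) = \<bar>h\<bar> powr (p - 1)" for h :: real
      by (cases "h = 0") (auto simp: powr_diff abs_mult)
    ultimately have "((\<lambda>h::real. \<bar>h\<bar> powr p / h) \<longlongrightarrow> 0) (at 0)" by (subst tendsto_norm_zero_iff[symmetric]) simp
    then show ?thesis using 3 by (simp add: DERIV_def)
  qed
qed

text \<open>A form of Young's inequality that allows the first term to be absorbed. If
  \<open>p * B \<le> \<epsilon> * A\<close>, the first term suffices; otherwise
  \<open>A \<le> p / \<epsilon> * B\<close>, and inserting this into the power yields the constant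
  of the second term.\<close>

lemma powr_Young_absorb:
  fixes A B p \<epsilon> :: real
  assumes "1 < p" "0 < \<epsilon>" "0 \<le> A" "0 \<le> B"
  shows "p * A powr (p - 1) * B \<le> \<epsilon> * A powr p + p * (p / \<epsilon>) powr (p - 1) * B powr p"
proof -
  have split: "t powr p = t * t powr (p - 1)" if "0 \<le> t" for t :: real
    using that by (cases "t = 0") (auto simp: powr_diff)
  show ?thesis
  proof (cases "p * B \<le> \<epsilon> * A")
    case True
    have "(p * B) * A powr (p - 1) \<le> (\<epsilon> * A) * A powr (p - 1)" using True by (intro mult_right_mono) auto
    then have "p * A powr (p - 1) * B \<le> \<epsilon> * A powr p" using split[of A] assms by (simp add: algebra_simps)
    moreover have "0 \<le> p * (p / \<epsilon>) powr (p - 1) * B powr p" using assms by simp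
    ultimately show ?thesis by linarith
  next
    case False
    then have "A \<le> p / \<epsilon> * B" using assms by (simp add: field_simps)
    then have "A powr (p - 1) \<le> (p / \<epsilon> * B) powr (p - 1)" using assms by (intro powr_mono2) auto
    also have "\<dots> = (p / \<epsilon>) powr (p - 1) * B powr (p - 1)" by (rule powr_mult)
    finally have "p * B * A powr (p - 1) \<le> p * B * ((p / \<epsilon>) powr (p - 1) * B powr (p - 1))"
      using assms by (intro mult_left_mono) auto
    also have "\<dots> = p * (p / \<epsilon>) powr (p - 1) * B powr p" using split[of B] assms by (simp add: algebra_simps)
    finally have "p * A powr (p - 1) * B \<le> p * (p / \<epsilon>) powr (p - 1) * B powr p" by (simp add: algebra_simps)
    moreover have "0 \<le> \<epsilon> * A powr p" using assms by simp
    ultimately show ?thesis by linarith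
  qed
qed

lemma open_half_space: "open half_space"
  unfolding half_space_def by (intro open_Collect_less continuous_intros)

lemma half_space_borel [measurable, simp]: "half_space \<in> sets borel"
  using open_half_space by (rule borel_open)

lemma half_space_lebesgue [measurable, simp]: "half_space \<in> sets lebesgue"
  by (rule sets_completionI_sets) simp

lemma set_integral_half_space:
  fixes f :: "'n::finite space \<Rightarrow> 'b::{banach, second_countable_topology}"
  shows "set_integrable lebesgue half_space f \<longleftrightarrow> integrable (lebesgue_on half_space) f"
    and "(LINT x:half_space|lebesgue. f x) = (\<integral>x. f x \<partial>lebesgue_on half_space)"
  unfolding set_integrable_def set_lebesgue_integral_def
  by (simp_all add: integrable_restrict_space integral_restrict_space)

lemma integrable_half_space_bounded_support:
  fixes f :: "'n::finite space \<Rightarrow> real"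
  assumes "continuous_on half_space f" "\<And>x. x \<in> half_space \<Longrightarrow> \<bar>f x\<bar> \<le> B" "\<And>x. R < norm x \<Longrightarrow> f x = 0"
  shows "integrable (lebesgue_on half_space) f"
proof -
  have m: "(\<lambda>x. indicator half_space x *\<^sub>R f x) \<in> borel_measurable lborel"
    using borel_measurable_continuous_on_indicator[OF half_space_borel assms(1)] by simp
  have "integrable lborel (\<lambda>x. indicator half_space x *\<^sub>R f x)"
    by (rule integrable_bounded_support[OF m, of "max 0 B" R]) (use assms in \<open>auto simp: indicator_def le_max_iff_disj\<close>)
  then show ?thesis
    using m by (simp add: integrable_restrict_space integrable_completion)
qed

lemma half_space_weighted_integrable:
  fixes f :: "'n::finite space \<Rightarrow> real" and h :: "'n space \<Rightarrow> 'v::euclidean_space"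
  assumes "continuous_on UNIV h" "\<And>x. norm (h x) \<le> B" "\<And>x. R < norm x \<Longrightarrow> h x = 0" "0 < r"
  shows "integrable (lebesgue_on half_space) (\<lambda>x. (1 + snd x) powr \<beta> * norm (h x) powr r)"
proof (rule integrable_half_space_bounded_support)
  show "continuous_on half_space (\<lambda>x. (1 + snd x) powr \<beta> * norm (h x) powr r)"
    using assms(4) by (intro continuous_on_mult continuous_on_norm_powr continuous_on_subset[OF assms(1)] continuous_intros)
      (auto simp: half_space_def)
  fix x :: "'n space"
  show "R < norm x \<Longrightarrow> (1 + snd x) powr \<beta> * norm (h x) powr r = 0" using assms(3) by simp
  assume x: "x \<in> half_space"
  show "\<bar>(1 + snd x) powr \<beta> * norm (h x) powr r\<bar> \<le> (1 + \<bar>R\<bar>) powr \<bar>\<beta>\<bar> * B powr r"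
  proof (cases "R < norm x")
    case False
    have s: "0 < snd x" "snd x \<le> \<bar>R\<bar>" using x False norm_snd_le[of "snd x" "fst x"] by (auto simp: half_space_def)
    have "(1 + snd x) powr \<beta> \<le> (1 + snd x) powr \<bar>\<beta>\<bar>" using s by (intro powr_mono) auto
    also have "\<dots> \<le> (1 + \<bar>R\<bar>) powr \<bar>\<beta>\<bar>" using s by (intro powr_mono2) auto
    finally show ?thesis using assms(2)[of x] assms(4) by (auto simp: abs_mult intro!: mult_mono powr_mono2)
  qed (use assms(3) in simp)
qed

lemma Cc_weighted_integrable:
  fixes f :: "'n::finite space \<Rightarrow> real"
  assumes f: "f \<in> Cc_infinity UNIV" and r: "0 < r"
  shows "integrable (lebesgue_on half_space) (\<lambda>x. (1 + snd x) powr \<beta> * \<bar>f x\<bar> powr r)"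
    and "integrable (lebesgue_on half_space) (\<lambda>x. (1 + snd x) powr \<beta> * norm (grad f x) powr r)"
proof -
  obtain B R where B: "\<And>x. \<bar>f x\<bar> \<le> B" "\<And>x. norm (grad f x) \<le> B"
    "\<And>x. R < norm x \<Longrightarrow> f x = 0" "\<And>x. R < norm x \<Longrightarrow> grad f x = 0" "0 < B" using Cc_infinity_bounds[OF f] by blast
  note s = Cc_infinityD(1)[OF f]
  show "integrable (lebesgue_on half_space) (\<lambda>x. (1 + snd x) powr \<beta> * \<bar>f x\<bar> powr r)"
    unfolding real_norm_def[symmetric]
    by (rule half_space_weighted_integrable[OF continuous_on_smooth[OF s] _ B(3) r, of B]) (use B(1) in auto)
  show "integrable (lebesgue_on half_space) (\<lambda>x. (1 + snd x) powr \<beta> * norm (grad f x) powr r)"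
    by (rule half_space_weighted_integrable[OF continuous_on_grad[OF s] B(2,4) r])
qed

text \<open>The vertical derivative of \<open>(1 + x\<^sub>N) powr (\<gamma> - p + 1) * \<bar>f\<bar> powr p\<close> has nonpositive integral, because this
  function is nonnegative on the boundary.\<close>

lemma Hardy_inequality:
  fixes p \<gamma> :: real
  assumes p: "1 < p" and \<gamma>: "p - 1 < \<gamma>"
  obtains K where "0 < K" "\<And>f :: 'n::finite space \<Rightarrow> real. f \<in> Cc_infinity UNIV \<Longrightarrow>
    (\<integral>x. (1 + snd x) powr (\<gamma> - p) * \<bar>f x\<bar> powr p \<partial>lebesgue_on half_space)
    \<le> K * (\<integral>x. (1 + snd x) powr \<gamma> * norm (grad f x) powr p \<partial>lebesgue_on half_space)"
proof -
  \<comment> \<open>Positivity of \<open>\<alpha>\<close> is the assumption on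
    \<open>\<gamma>\<close>, and \<open>\<alpha> - 1\<close> is the exponent of the Hardy weight:
    differentiating the weight of exponent \<open>\<alpha>\<close> produces the left-hand side of
    the inequality.\<close>
  define \<alpha> where "\<alpha> = \<gamma> - p + 1"
  have \<alpha>: "0 < \<alpha>" using \<gamma> by (simp add: \<alpha>_def)
  \<comment> \<open>The constant of \<open>powr_Young_absorb\<close> with
    \<open>\<epsilon> = \<alpha> / 2\<close>, which leaves half of the term with factor
    \<open>\<alpha>\<close> after absorption.\<close>
  define L where "L = p * (p / (\<alpha> / 2)) powr (p - 1)"
  have L: "0 < L" using p \<alpha> by (simp add: L_def)
  show thesis
  proof (rule that[of "2 / \<alpha> * L"])
    show "0 < 2 / \<alpha> * L" using L \<alpha> by simp
    fix f :: "'n space \<Rightarrow> real"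
    assume f: "f \<in> Cc_infinity UNIV"
    obtain B R where B: "\<And>x. \<bar>f x\<bar> \<le> B" "\<And>x. norm (grad f x) \<le> B"
      "\<And>x. R < norm x \<Longrightarrow> f x = 0" "\<And>x. R < norm x \<Longrightarrow> grad f x = 0" "0 < B" using Cc_infinity_bounds[OF f] by blast
    note s = Cc_infinityD(1)[OF f]
    define e :: "'n space" where "e = (0, 1)"
    have ne: "norm e = 1" by (simp add: e_def)
    define G where "G x = (1 + snd x) powr \<alpha> * \<bar>f x\<bar> powr p" for x
    define D where "D x = \<alpha> * (1 + snd x) powr (\<alpha> - 1) * \<bar>f x\<bar> powr p
      + (1 + snd x) powr \<alpha> * (p * \<bar>f x\<bar> powr (p - 1) * sgn (f x) * (grad f x \<bullet> e))" for x
    have ge: "\<bar>grad f x \<bullet> e\<bar> \<le> norm (grad f x)" for x using Cauchy_Schwarz_ineq2[of "grad f x" e] ne by simp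
    have der: "((\<lambda>t. G (x + t *\<^sub>R e)) has_real_derivative D x) (at 0)" if x: "x \<in> half_space" for x
    proof -
      have 1: "((\<lambda>t. (1 + snd (x + t *\<^sub>R e)) powr \<alpha>) has_real_derivative \<alpha> * (1 + snd x) powr (\<alpha> - 1)) (at 0)"
        using x by (auto simp: e_def half_space_def intro!: derivative_eq_intros)
      have 2: "((\<lambda>t. \<bar>f (x + t *\<^sub>R e)\<bar> powr p) has_real_derivative p * \<bar>f x\<bar> powr (p - 1) * sgn (f x) * (grad f x \<bullet> e)) (at 0)"
        using DERIV_chain2[OF has_real_derivative_abs_powr[OF p] smooth_DERIV[OF s, of x e]] by simp
      show ?thesis unfolding G_def D_def using DERIV_mult[OF 1 2] by (simp add: algebra_simps)
    qed
    have w: "(1 + snd x) powr \<alpha> \<le> (1 + \<bar>R\<bar>) powr \<alpha>" "(1 + snd x) powr (\<alpha> - 1) \<le> (1 + \<bar>R\<bar>) powr \<alpha>"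
      if "x \<in> half_space" "norm x \<le> R" for x :: "'n space"
    proof -
      have s: "0 < snd x" "snd x \<le> \<bar>R\<bar>" using that norm_snd_le[of "snd x" "fst x"] by (auto simp: half_space_def)
      show 1: "(1 + snd x) powr \<alpha> \<le> (1 + \<bar>R\<bar>) powr \<alpha>" using s \<alpha> by (intro powr_mono2) auto
      have "(1 + snd x) powr (\<alpha> - 1) \<le> (1 + snd x) powr \<alpha>" using s by (intro powr_mono) auto
      then show "(1 + snd x) powr (\<alpha> - 1) \<le> (1 + \<bar>R\<bar>) powr \<alpha>" using 1 by linarith
    qed
    define W where "W = (1 + \<bar>R\<bar>) powr \<alpha>"
    have fp: "\<bar>f x\<bar> powr r \<le> B powr r" if "0 < r" for x r using B(1) that by (intro powr_mono2) auto
    have GB: "\<bar>G x\<bar> \<le> W * B powr p" and DB: "\<bar>D x\<bar> \<le> \<alpha> * W * B powr p + W * (p * B powr (p - 1) * B)"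
      if x: "x \<in> half_space" for x
    proof -
      have W0: "0 \<le> W" by (simp add: W_def)
      have "\<bar>G x\<bar> \<le> W * B powr p \<and> \<bar>D x\<bar> \<le> \<alpha> * W * B powr p + W * (p * B powr (p - 1) * B)"
      proof (cases "R < norm x")
        case True
        then show ?thesis using B(3,5) W0 \<alpha> p by (simp add: G_def D_def)
      next
        case False
        note w' = w[OF x, unfolded W_def[symmetric]]
        have "\<bar>G x\<bar> = (1 + snd x) powr \<alpha> * \<bar>f x\<bar> powr p" by (simp add: G_def)
        also have "\<dots> \<le> W * B powr p" using w' False p W0 fp by (intro mult_mono) auto
        finally have 1: "\<bar>G x\<bar> \<le> W * B powr p" .
        have 2: "\<bar>\<alpha> * (1 + snd x) powr (\<alpha> - 1) * \<bar>f x\<bar> powr p\<bar> \<le> \<alpha> * W * B powr p"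
          using w' False p \<alpha> W0 fp by (simp add: abs_mult) (intro mult_mono; simp)
        have "\<bar>(1 + snd x) powr \<alpha> * (p * \<bar>f x\<bar> powr (p - 1) * sgn (f x) * (grad f x \<bullet> e))\<bar>
          = (1 + snd x) powr \<alpha> * (p * \<bar>f x\<bar> powr (p - 1) * \<bar>sgn (f x)\<bar> * \<bar>grad f x \<bullet> e\<bar>)"
          using p by (simp add: abs_mult)
        also have "\<dots> \<le> W * (p * B powr (p - 1) * 1 * B)"
          using w' False p W0 fp[of "p - 1"] ge[of x] B(2)[of x]
          by (intro mult_mono) (auto simp: abs_sgn_eq intro: order_trans)
        finally show ?thesis using 1 2 unfolding D_def by (intro conjI) (auto intro: order_trans[OF abs_triangle_ineq])
      qed
      then show "\<bar>G x\<bar> \<le> W * B powr p" "\<bar>D x\<bar> \<le> \<alpha> * W * B powr p + W * (p * B powr (p - 1) * B)" by auto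
    qed
    define C where "C = max (W * B powr p) (\<alpha> * W * B powr p + W * (p * B powr (p - 1) * B))"
    have GC: "\<bar>G x\<bar> \<le> C" "\<bar>D x\<bar> \<le> C" if "x \<in> half_space" for x using GB[OF that] DB[OF that] by (auto simp: C_def)
    have shift: "x + t *\<^sub>R e \<in> half_space" if "x \<in> half_space" "0 \<le> t" for x t
      using that by (simp add: half_space_def e_def)
    have contG: "continuous_on half_space G" unfolding G_def real_norm_def[symmetric] using p
      by (intro continuous_on_mult continuous_on_norm_powr continuous_on_smooth s continuous_intros) (auto simp: half_space_def)
    have G0: "G x = 0" if "x \<in> half_space" "R < norm x" for x using B(3)[OF that(2)] by (simp add: G_def)
    have Gnn: "0 \<le> G x" if "x \<in> half_space" for x by (simp add: G_def)
    have Di: "integrable (lebesgue_on half_space) D"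
      using translation_quotient_tendsto(1)[OF open_half_space shift der contG GC G0] by (simp add: set_integral_half_space)
    have D0: "(\<integral>x. D x \<partial>lebesgue_on half_space) \<le> 0"
      using integral_directional_derivative_le_0[OF open_half_space shift der contG GC G0 Gnn] by (simp add: set_integral_half_space)
    have p0: "0 < p" using p by simp
    note i1 = Cc_weighted_integrable(1)[OF f p0, of "\<gamma> - p"] and i2 = Cc_weighted_integrable(2)[OF f p0, of \<gamma>]
    have pt: "\<alpha> / 2 * ((1 + snd x) powr (\<gamma> - p) * \<bar>f x\<bar> powr p) \<le> D x + L * ((1 + snd x) powr \<gamma> * norm (grad f x) powr p)"
      if x: "x \<in> half_space" for x
    proof -
      define y where "y = 1 + snd x"
      have y: "0 < y" using x by (simp add: y_def half_space_def)
      have e1: "y powr \<alpha> = y powr (\<gamma> - p) * y" using y by (simp add: \<alpha>_def powr_add)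
      have e2: "y powr (\<gamma> - p) * y powr p = y powr \<gamma>" using y by (simp flip: powr_add)
      have e3: "\<alpha> - 1 = \<gamma> - p" by (simp add: \<alpha>_def)
      \<comment> \<open>One factor \<open>y\<close> is taken from \<open>y powr \<alpha>\<close> and
        attached to the gradient. The remaining weight \<open>y powr (\<gamma> - p)\<close> is the
        one required for \<open>f\<close>, and together with \<open>y powr p\<close> it becomes the
        weight \<open>y powr \<gamma>\<close> of the gradient.\<close>
      have "p * \<bar>f x\<bar> powr (p - 1) * (y * norm (grad f x)) \<le> \<alpha> / 2 * \<bar>f x\<bar> powr p + L * (y * norm (grad f x)) powr p"
        unfolding L_def using p \<alpha> y by (intro powr_Young_absorb) auto
      then have "y powr (\<gamma> - p) * (p * \<bar>f x\<bar> powr (p - 1) * (y * norm (grad f x)))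
        \<le> y powr (\<gamma> - p) * (\<alpha> / 2 * \<bar>f x\<bar> powr p + L * (y * norm (grad f x)) powr p)" by (intro mult_left_mono) auto
      also have "\<dots> = \<alpha> / 2 * (y powr (\<gamma> - p) * \<bar>f x\<bar> powr p) + L * (y powr \<gamma> * norm (grad f x) powr p)"
        by (simp add: powr_mult e2[symmetric] algebra_simps)
      finally have Y: "y powr \<alpha> * (p * \<bar>f x\<bar> powr (p - 1) * norm (grad f x))
        \<le> \<alpha> / 2 * (y powr (\<gamma> - p) * \<bar>f x\<bar> powr p) + L * (y powr \<gamma> * norm (grad f x) powr p)"
        by (simp add: e1 algebra_simps)
      have "\<bar>sgn (f x) * (grad f x \<bullet> e)\<bar> \<le> norm (grad f x)"
        using ge[of x] by (simp add: abs_mult abs_sgn_eq)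
      then have "- norm (grad f x) \<le> sgn (f x) * (grad f x \<bullet> e)" by linarith
      then have "y powr \<alpha> * (p * \<bar>f x\<bar> powr (p - 1)) * (- norm (grad f x))
        \<le> y powr \<alpha> * (p * \<bar>f x\<bar> powr (p - 1)) * (sgn (f x) * (grad f x \<bullet> e))"
        using p by (intro mult_left_mono) auto
      then have "\<alpha> * (y powr (\<gamma> - p) * \<bar>f x\<bar> powr p) - y powr \<alpha> * (p * \<bar>f x\<bar> powr (p - 1) * norm (grad f x)) \<le> D x"
        unfolding D_def y_def[symmetric] e3 by (simp add: mult.assoc)
      then show ?thesis using Y unfolding y_def[symmetric] by (simp add: field_simps)
    qed
    have "\<alpha> / 2 * (\<integral>x. (1 + snd x) powr (\<gamma> - p) * \<bar>f x\<bar> powr p \<partial>lebesgue_on half_space)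
      = (\<integral>x. \<alpha> / 2 * ((1 + snd x) powr (\<gamma> - p) * \<bar>f x\<bar> powr p) \<partial>lebesgue_on half_space)" by simp
    also have "\<dots> \<le> (\<integral>x. D x + L * ((1 + snd x) powr \<gamma> * norm (grad f x) powr p) \<partial>lebesgue_on half_space)"
      using i1 i2 Di pt by (intro integral_mono) auto
    also have "\<dots> \<le> L * (\<integral>x. (1 + snd x) powr \<gamma> * norm (grad f x) powr p \<partial>lebesgue_on half_space)"
      using Di i2 D0 by simp
    finally show "(\<integral>x. (1 + snd x) powr (\<gamma> - p) * \<bar>f x\<bar> powr p \<partial>lebesgue_on half_space)
      \<le> 2 / \<alpha> * L * (\<integral>x. (1 + snd x) powr \<gamma> * norm (grad f x) powr p \<partial>lebesgue_on half_space)"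
      using \<alpha> by (simp add: field_simps)
  qed
qed

subsection \<open>The abstract minimization problem\<close>

text \<open>The assumption \<open>power_mean\<close> is the hidden convexity of the gradient term: along \<open>v = \<bar>f\<bar> powr q\<close> it is midpoint
  convex. The power mean itself need not lie in \<open>\<C>\<close>, hence the approximating sequence.\<close>

locale variational_problem =
  R: weighted_measure M \<rho> + A: weighted_measure M a + B: weighted_measure M b
  for M :: "'a measure" and \<rho> a b :: "'a \<Rightarrow> real" +
  fixes \<C> :: "('a \<Rightarrow> real) set" and D :: "('a \<Rightarrow> real) \<Rightarrow> 'a \<Rightarrow> 'v::euclidean_space" and p q s \<kappa> :: real
  assumes q1: "1 < q" and qp: "q < p" and qs: "q < s"
    and a_integrable: "integrable M a"
    and grad_Lp: "f \<in> \<C> \<Longrightarrow> D f \<in> R.Lp p"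
    and a_Lp: "f \<in> \<C> \<Longrightarrow> f \<in> A.Lp p"
    and b_Lp: "f \<in> \<C> \<Longrightarrow> f \<in> B.Lp s"
    and add_scaled: "f \<in> \<C> \<Longrightarrow> g \<in> \<C> \<Longrightarrow> (\<lambda>x. f x + c * g x) \<in> \<C>"
    and D_add_scaled: "f \<in> \<C> \<Longrightarrow> g \<in> \<C> \<Longrightarrow> D (\<lambda>x. f x + c * g x) = (\<lambda>x. D f x + c *\<^sub>R D g x)"
    and \<kappa>: "0 < \<kappa>"
    and Hardy: "f \<in> \<C> \<Longrightarrow> A.Np p f \<le> \<kappa> * R.Np p (D f)"
    and power_mean: "f \<in> \<C> \<Longrightarrow> g \<in> \<C> \<Longrightarrow> \<exists>w. (\<forall>n. w n \<in> \<C> \<and> (\<forall>x. 0 \<le> w n x \<and> w n x \<le> \<bar>f x\<bar> + \<bar>g x\<bar>)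
      \<and> R.Np p (D (w n)) \<le> (R.Np p (D f) + R.Np p (D g)) / 2)
      \<and> (\<forall>x. (\<lambda>n. w n x) \<longlonglongrightarrow> ((\<bar>f x\<bar> powr q + \<bar>g x\<bar> powr q) / 2) powr (1 / q))"
    and nontrivial: "\<exists>f\<in>\<C>. 0 < A.Np q f"
begin

lemma exponents: "1 < p" "1 < s" "0 < p" "0 < q" "0 < s" using q1 qp qs by auto

text \<open>Vitali's theorem for a constant sequence; finiteness of the mass of \<open>a\<close> is
  what matters.\<close>

lemma a_Lq: "A.Lp p \<subseteq> A.Lp q"
  using A.Lp_Vitali(2)[OF exponents(4) qp a_integrable, of "\<lambda>_. h" for h] A.LpD(1) by fastforce

lemma a_Lp_q: "f \<in> \<C> \<Longrightarrow> f \<in> A.Lp q"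
  using a_Lq a_Lp by auto

text \<open>Gradient and function are separate arguments, because the limit of a minimizing sequence
  is only a pair \<open>g\<close>, \<open>u\<close>: \<open>u\<close> need not lie in
  \<open>\<C>\<close>, and \<open>D u\<close> need not be its gradient.\<close>

definition J :: "('a \<Rightarrow> 'v) \<Rightarrow> ('a \<Rightarrow> real) \<Rightarrow> real" where
  "J h v = R.Np p h / p - A.Np q v / q + B.Np s v / s"

abbreviation \<Phi> where "\<Phi> f \<equiv> J (D f) f"

lemma scaled: "f \<in> \<C> \<Longrightarrow> (\<lambda>x. c * f x) \<in> \<C>"
  and D_scaled: "f \<in> \<C> \<Longrightarrow> D (\<lambda>x. c * f x) = (\<lambda>x. c *\<^sub>R D f x)"
  using add_scaled[of f f "c - 1"] D_add_scaled[of f f "c - 1"] by (auto simp: algebra_simps)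

lemma midpoint: "f \<in> \<C> \<Longrightarrow> g \<in> \<C> \<Longrightarrow> (\<lambda>x. (1/2) *\<^sub>R (f x + g x)) \<in> \<C>"
  and D_midpoint: "f \<in> \<C> \<Longrightarrow> g \<in> \<C> \<Longrightarrow> D (\<lambda>x. (1/2) *\<^sub>R (f x + g x)) = (\<lambda>x. (1/2) *\<^sub>R (D f x + D g x))"
  using scaled[OF add_scaled[of f g 1], of "1/2"] D_scaled[OF add_scaled[of f g 1], of "1/2"] D_add_scaled[of f g 1]
  by auto

lemma coercive:
  obtains C where "\<And>f. f \<in> \<C> \<Longrightarrow> R.Np p (D f) / (2 * p) + B.Np s f / s \<le> \<Phi> f + C"
proof -
  \<comment> \<open>The solution of \<open>m powr (q - p) * \<kappa> / q = 1 / (2 * p)\<close>: by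
    Hardy's inequality the tail of the \<open>a\<close>-term then costs exactly half of the gradient
    term.\<close>
  define m where "m = (q / (2 * p * \<kappa>)) powr (1 / (q - p))"
  have m: "0 < m" "m powr (q - p) = q / (2 * p * \<kappa>)"
    using exponents \<kappa> qp by (auto simp: m_def powr_powr)
  define C where "C = m powr q * (\<integral>x. a x \<partial>M) / q"
  show thesis
  proof (rule that[of C])
    fix f assume f: "f \<in> \<C>"
    have "A.Np q f \<le> (\<integral>x. m powr q * a x + m powr (q - p) * (a x * norm (f x) powr p) \<partial>M)"
      unfolding A.Np_def
    proof (rule integral_mono)
      fix x assume x: "x \<in> space M"
      have "min \<bar>f x\<bar> m powr q \<le> m powr q" using m exponents by (intro powr_mono2) auto
      then have "\<bar>f x\<bar> powr q \<le> m powr q + m powr (q - p) * \<bar>f x\<bar> powr p"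
        using powr_le_min_plus[OF qp m(1), of "\<bar>f x\<bar>"] by simp
      then show "a x * norm (f x) powr q \<le> m powr q * a x + m powr (q - p) * (a x * norm (f x) powr p)"
        using mult_left_mono[of "\<bar>f x\<bar> powr q" _ "a x"] A.w_pos[OF x] by (fastforce simp: algebra_simps)
    qed (use A.LpD(2)[OF a_Lp[OF f]] A.LpD(2)[OF a_Lp_q[OF f]] a_integrable in auto)
    also have "\<dots> = m powr q * (\<integral>x. a x \<partial>M) + m powr (q - p) * A.Np p f"
      unfolding A.Np_def using A.LpD(2)[OF a_Lp[OF f]] a_integrable by simp
    also have "\<dots> \<le> m powr q * (\<integral>x. a x \<partial>M) + m powr (q - p) * (\<kappa> * R.Np p (D f))"
      using Hardy[OF f] by (intro add_left_mono mult_left_mono) auto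
    finally have "A.Np q f / q \<le> C + R.Np p (D f) / (2 * p)"
      using exponents \<kappa> unfolding m(2) C_def by (simp add: field_simps)
    then show "R.Np p (D f) / (2 * p) + B.Np s f / s \<le> \<Phi> f + C"
      unfolding J_def by (simp add: field_simps)
  qed
qed

lemma energy_bounded:
  assumes f: "\<And>n. f n \<in> \<C>" and lim: "(\<lambda>n. \<Phi> (f n)) \<longlonglongrightarrow> L"
  obtains C where "\<And>n. R.Np p (D (f n)) \<le> C" "\<And>n. B.Np s (f n) \<le> C"
proof -
  obtain C where C: "\<And>f. f \<in> \<C> \<Longrightarrow> R.Np p (D f) / (2 * p) + B.Np s f / s \<le> \<Phi> f + C" using coercive by blast
  obtain C1 where "\<forall>n. norm (\<Phi> (f n)) \<le> C1"
    using convergent_imp_Bseq[OF convergentI[OF lim]] by (auto elim!: BseqE)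
  then have C1: "\<Phi> (f n) \<le> C1" for n by (metis abs_le_D1 real_norm_def)
  have nn: "0 \<le> R.Np p (D (f n)) / (2 * p)" "0 \<le> B.Np s (f n) / s" for n
    using R.Np_nonneg B.Np_nonneg exponents by (auto intro!: divide_nonneg_nonneg)
  have "R.Np p (D (f n)) / (2 * p) \<le> C1 + C" "B.Np s (f n) / s \<le> C1 + C" for n
    using C[OF f[of n]] C1[of n] nn[of n] by linarith+
  then have "R.Np p (D (f n)) \<le> 2 * p * (C1 + C)" "B.Np s (f n) \<le> s * (C1 + C)" for n
    using exponents by (simp_all add: field_simps)
  then show thesis using that[of "max (2 * p * (C1 + C)) (s * (C1 + C))"] by (simp add: le_max_iff_disj)
qed

lemma bdd_below: "bdd_below (\<Phi> ` \<C>)"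
proof -
  obtain C where C: "\<And>f. f \<in> \<C> \<Longrightarrow> R.Np p (D f) / (2 * p) + B.Np s f / s \<le> \<Phi> f + C" using coercive by blast
  have "- C \<le> \<Phi> f" if "f \<in> \<C>" for f
  proof -
    have "0 \<le> R.Np p (D f) / (2 * p) + B.Np s f / s"
      using R.Np_nonneg B.Np_nonneg exponents by (intro add_nonneg_nonneg divide_nonneg_nonneg) auto
    then show ?thesis using C[OF that] by linarith
  qed
  then show ?thesis by (auto intro!: bdd_belowI[of _ "- C"])
qed

definition m where "m = Inf (\<Phi> ` \<C>)"

lemma m_le: "f \<in> \<C> \<Longrightarrow> m \<le> \<Phi> f"
  unfolding m_def by (intro cINF_lower bdd_below)

lemma m_neg: "m < 0"
proof -
  obtain f where f: "f \<in> \<C>" "0 < A.Np q f" using nontrivial by blast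
  define t where "t n = 1 / real (Suc n)" for n
  have t: "0 < t n" for n by (simp add: t_def)
  have t0: "t \<longlonglongrightarrow> 0" unfolding t_def using LIMSEQ_Suc[OF lim_1_over_n[where 'a=real]] .
  \<comment> \<open>This is the energy of \<open>t n * f\<close> divided by
    \<open>t n powr q\<close>. As \<open>q\<close> is the smallest of the three exponents, only the
    negative term survives in the limit.\<close>
  have "(\<lambda>n. t n powr (p - q) * (R.Np p (D f) / p) - A.Np q f / q + t n powr (s - q) * (B.Np s f / s))
    \<longlonglongrightarrow> 0 powr (p - q) * (R.Np p (D f) / p) - A.Np q f / q + 0 powr (s - q) * (B.Np s f / s)"
    using qp qs t by (intro tendsto_intros tendsto_powr'[OF t0]) (auto intro!: always_eventually less_imp_le)
  then have "(\<lambda>n. t n powr (p - q) * (R.Np p (D f) / p) - A.Np q f / q + t n powr (s - q) * (B.Np s f / s))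
    \<longlonglongrightarrow> - (A.Np q f / q)" by simp
  moreover have "- (A.Np q f / q) < 0" using f exponents by simp
  ultimately have "\<forall>\<^sub>F n in sequentially. t n powr (p - q) * (R.Np p (D f) / p) - A.Np q f / q + t n powr (s - q) * (B.Np s f / s) < 0"
    by (rule order_tendstoD(2))
  then obtain n where n: "t n powr (p - q) * (R.Np p (D f) / p) - A.Np q f / q + t n powr (s - q) * (B.Np s f / s) < 0"
    using eventually_happens'[OF sequentially_bot] by blast
  have "\<Phi> (\<lambda>x. t n * f x) = t n powr p * R.Np p (D f) / p - t n powr q * A.Np q f / q + t n powr s * B.Np s f / s"
    unfolding J_def D_scaled[OF f(1)] R.Np_scaleR
    using A.Np_scaleR[of q "t n" f] B.Np_scaleR[of s "t n" f] t[of n] by simp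
  also have "\<dots> = t n powr q * (t n powr (p - q) * (R.Np p (D f) / p) - A.Np q f / q + t n powr (s - q) * (B.Np s f / s))"
    using t[of n] by (simp add: right_diff_distrib distrib_left flip: mult.assoc powr_add)
  also have "\<dots> < 0" using n t[of n] by (intro mult_pos_neg) auto
  finally show ?thesis using m_le[OF scaled[OF f(1), of "t n"]] by linarith
qed

text \<open>The \<open>q\<close>-th power of \<open>P\<close> is the arithmetic mean of the
  \<open>q\<close>-th powers, so the \<open>a\<close>-term is averaged exactly, while the
  \<open>b\<close>-term keeps its midpoint defect. The slack \<open>e\<close> pays for replacing
  \<open>P\<close> by an admissible \<open>w n\<close>; dominated convergence with majorant
  \<open>\<bar>f x\<bar> + \<bar>g x\<bar>\<close> handles the two lower order terms.\<close>

lemma power_mean_energy: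
  assumes f: "f \<in> \<C>" and g: "g \<in> \<C>" and e: "0 < e"
  defines "P \<equiv> \<lambda>x. ((\<bar>f x\<bar> powr q + \<bar>g x\<bar> powr q) / 2) powr (1 / q)"
  obtains w where "w \<in> \<C>" "\<And>x. 0 \<le> w x"
    "\<Phi> w < (\<Phi> f + \<Phi> g) / 2 - ((B.Np s f + B.Np s g) / 2 - B.Np s P) / s + e"
proof -
  obtain w where w: "\<And>n. w n \<in> \<C>" "\<And>n x. 0 \<le> w n x" "\<And>n x. w n x \<le> \<bar>f x\<bar> + \<bar>g x\<bar>"
      "\<And>n. R.Np p (D (w n)) \<le> (R.Np p (D f) + R.Np p (D g)) / 2"
    and lim: "\<And>x. (\<lambda>n. w n x) \<longlonglongrightarrow> P x"
    using power_mean[OF f g] unfolding P_def by blast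
  have absb: "(\<lambda>x. \<bar>f x\<bar> + \<bar>g x\<bar>) \<in> B.Lp s"
    using b_Lp[OF f] b_Lp[OF g] B.LpD(1)[OF b_Lp[OF f]] B.LpD(1)[OF b_Lp[OF g]]
    by (intro B.Lp_add(1) exponents B.Np_mono(1)[of "\<lambda>x. \<bar>f x\<bar>" f] B.Np_mono(1)[of "\<lambda>x. \<bar>g x\<bar>" g]) auto
  have absa: "(\<lambda>x. \<bar>f x\<bar> + \<bar>g x\<bar>) \<in> A.Lp q"
    using a_Lp_q[OF f] a_Lp_q[OF g] A.LpD(1)[OF a_Lp[OF f]] A.LpD(1)[OF a_Lp[OF g]]
    by (intro A.Lp_add(1) exponents A.Np_mono(1)[of "\<lambda>x. \<bar>f x\<bar>" f] A.Np_mono(1)[of "\<lambda>x. \<bar>g x\<bar>" g]) auto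
  have la: "(\<lambda>n. A.Np q (w n)) \<longlonglongrightarrow> A.Np q P"
    by (rule A.Np_dominated_convergence[OF exponents(4) A.LpD(1)[OF a_Lp[OF w(1)]] absa _ lim]) (use w(2,3) in auto)
  have lb: "(\<lambda>n. B.Np s (w n)) \<longlonglongrightarrow> B.Np s P"
    by (rule B.Np_dominated_convergence[OF exponents(5) A.LpD(1)[OF a_Lp[OF w(1)]] absb _ lim]) (use w(2,3) in auto)
  have Pq: "A.Np q P = (A.Np q f + A.Np q g) / 2"
  proof -
    have "norm (P x) powr q = (\<bar>f x\<bar> powr q + \<bar>g x\<bar> powr q) / 2" for x
      unfolding P_def using exponents by (simp add: powr_powr)
    then show ?thesis unfolding A.Np_def
      using A.LpD(2)[OF a_Lp_q[OF f]] A.LpD(2)[OF a_Lp_q[OF g]] by (simp add: distrib_left add_divide_distrib)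
  qed
  define E where "E = (R.Np p (D f) + R.Np p (D g)) / 2"
  have "(\<lambda>n. E / p - A.Np q (w n) / q + B.Np s (w n) / s) \<longlonglongrightarrow> E / p - A.Np q P / q + B.Np s P / s"
    using exponents by (intro tendsto_intros la lb) auto
  moreover have "E / p - A.Np q P / q + B.Np s P / s < E / p - A.Np q P / q + B.Np s P / s + e" using e by simp
  ultimately have "\<forall>\<^sub>F n in sequentially. E / p - A.Np q (w n) / q + B.Np s (w n) / s < E / p - A.Np q P / q + B.Np s P / s + e"
    by (rule order_tendstoD(2))
  then obtain n where n: "E / p - A.Np q (w n) / q + B.Np s (w n) / s < E / p - A.Np q P / q + B.Np s P / s + e"
    using eventually_happens'[OF sequentially_bot] by blast
  have "R.Np p (D (w n)) / p \<le> E / p" using w(4)[of n] exponents unfolding E_def by (intro divide_right_mono) auto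
  then have "\<Phi> (w n) < E / p - A.Np q P / q + B.Np s P / s + e" using n by (simp add: J_def)
  also have "\<dots> = (\<Phi> f + \<Phi> g) / 2 - ((B.Np s f + B.Np s g) / 2 - B.Np s P) / s + e"
    unfolding J_def E_def Pq by (simp add: add_divide_distrib diff_divide_distrib)
  finally show thesis using that w(1,2) by blast
qed

text \<open>The power mean of \<open>f\<close> with itself is the absolute value of
  \<open>f\<close>, which need not be admissible. \<open>power_mean_energy\<close> with equal
  arguments supplies nonnegative admissible functions of almost the same energy.\<close>

lemma nonneg_minimizing_sequence:
  obtains f where "\<And>n. f n \<in> \<C>" "\<And>n x. 0 \<le> f n x" "(\<lambda>n. \<Phi> (f n)) \<longlonglongrightarrow> m"
proof -
  have "\<exists>w\<in>\<C>. (\<forall>x. 0 \<le> w x) \<and> \<Phi> w < m + 1 / real (Suc n)" for n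
  proof -
    have "\<C> \<noteq> {}" using nontrivial by auto
    then obtain f where f: "f \<in> \<C>" "\<Phi> f < m + 1 / real (Suc n)"
      using cINF_less_iff[OF _ bdd_below, of "m + 1 / real (Suc n)"] unfolding m_def by auto
    define e where "e = m + 1 / real (Suc n) - \<Phi> f"
    obtain w where w: "w \<in> \<C>" "\<And>x. 0 \<le> w x" "\<Phi> w < (\<Phi> f + \<Phi> f) / 2 - ((B.Np s f + B.Np s f) / 2
      - B.Np s (\<lambda>x. ((\<bar>f x\<bar> powr q + \<bar>f x\<bar> powr q) / 2) powr (1 / q))) / s + e"
      using power_mean_energy[OF f(1) f(1), of e] f(2) unfolding e_def by auto
    have "B.Np s (\<lambda>x. ((\<bar>f x\<bar> powr q + \<bar>f x\<bar> powr q) / 2) powr (1 / q)) = B.Np s f"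
      unfolding B.Np_def using exponents by (simp add: powr_powr)
    then show ?thesis using w by (intro bexI[of _ w]) (auto simp: e_def)
  qed
  then obtain f where f: "\<And>n. f n \<in> \<C>" "\<And>n x. 0 \<le> f n x" "\<And>n. \<Phi> (f n) < m + 1 / real (Suc n)" by metis
  have "(\<lambda>n. \<Phi> (f n)) \<longlonglongrightarrow> m"
  proof (rule tendsto_sandwich)
    show "\<forall>\<^sub>F n in sequentially. m \<le> \<Phi> (f n)" using m_le f(1) by auto
    show "\<forall>\<^sub>F n in sequentially. \<Phi> (f n) \<le> m + 1 / real (Suc n)" using less_imp_le[OF f(3)] by (intro always_eventually allI)
    show "(\<lambda>n. m + 1 / real (Suc n)) \<longlonglongrightarrow> m"
      using tendsto_add[OF tendsto_const LIMSEQ_Suc[OF lim_1_over_n[where 'a=real]], of m] by simp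
  qed simp
  then show thesis using that f by blast
qed

text \<open>In terms of \<open>v = u powr q\<close> the gradient term is convex, the \<open>a\<close>-term is linear and the \<open>b\<close>-term is uniformly convex.
  So the powers of a nonnegative minimizing sequence form a Cauchy sequence, without any compactness.\<close>

lemma minimizing_sequence_converges:
  obtains f u where "\<And>n. f n \<in> \<C>" "\<And>n x. 0 \<le> f n x" "(\<lambda>n. \<Phi> (f n)) \<longlonglongrightarrow> m" "\<And>x. 0 \<le> u x"
    "AE x in M. (\<lambda>n. f n x) \<longlonglongrightarrow> u x" "u \<in> B.Lp s" "(\<lambda>n. B.Np s (\<lambda>x. f n x - u x)) \<longlonglongrightarrow> 0"
proof -
  obtain f where f: "\<And>n. f n \<in> \<C>" "\<And>n x. 0 \<le> f n x" "(\<lambda>n. \<Phi> (f n)) \<longlonglongrightarrow> m"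
    using nonneg_minimizing_sequence by blast
  define v where "v n x = f n x powr q" for n x
  \<comment> \<open>With this exponent the \<open>r\<close>-th power of \<open>v n\<close> is the
    \<open>s\<close>-th power of \<open>f n\<close>, so the \<open>b\<close>-term is the
    \<open>r\<close>-th power integral of \<open>v n\<close>; \<open>r > 1\<close> gives uniform
    convexity.\<close>
  define r where "r = s / q"
  have r: "1 < r" "0 < r" using qs exponents by (auto simp: r_def)
  have qr: "q * r = s" using exponents by (simp add: r_def)
  have vs: "norm (v n x) powr r = norm (f n x) powr s" for n x
    using f(2)[of n x] by (simp add: v_def powr_powr qr)
  have fm: "f n \<in> borel_measurable M" for n using B.LpD(1)[OF b_Lp[OF f(1)]] .
  have vm: "v n \<in> borel_measurable M" for n unfolding v_def using fm by measurable
  have vL: "v n \<in> B.Lp r" for n using B.LpD(2)[OF b_Lp[OF f(1)]] vm unfolding B.Lp_def mem_Collect_eq vs by blast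
  have vN: "B.Np r (v n) = B.Np s (f n)" for n unfolding B.Np_def vs ..
  obtain C where C: "\<And>n. R.Np p (D (f n)) \<le> C" "\<And>n. B.Np s (f n) \<le> C" using energy_bounded[OF f(1,3)] by blast
  have vC: "B.Np r (v n) \<le> C" for n using C(2) by (simp add: vN)
  have defect: "\<exists>n0. \<forall>i\<ge>n0. \<forall>j\<ge>n0. (B.Np r (v i) + B.Np r (v j)) / 2 - B.Np r (\<lambda>x. (1/2) *\<^sub>R (v i x + v j x)) < e"
    if e: "0 < e" for e
  proof -
    have "0 < e / (2 * s)" using e exponents by simp
    then have "\<forall>\<^sub>F n in sequentially. \<Phi> (f n) < m + e / (2 * s)" by (intro order_tendstoD(2)[OF f(3)]) simp
    then obtain n0 where n0: "\<And>n. n0 \<le> n \<Longrightarrow> \<Phi> (f n) < m + e / (2 * s)"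
      unfolding eventually_sequentially by blast
    have "(B.Np r (v i) + B.Np r (v j)) / 2 - B.Np r (\<lambda>x. (1/2) *\<^sub>R (v i x + v j x)) < e" if ij: "n0 \<le> i" "n0 \<le> j" for i j
    proof -
      define P where "P = (\<lambda>x. ((\<bar>f i x\<bar> powr q + \<bar>f j x\<bar> powr q) / 2) powr (1 / q))"
      obtain w where w: "w \<in> \<C>" "\<And>x. 0 \<le> w x" "\<Phi> w < (\<Phi> (f i) + \<Phi> (f j)) / 2 - ((B.Np s (f i) + B.Np s (f j)) / 2 - B.Np s P) / s + e / (2 * s)"
        using power_mean_energy[OF f(1)[of i] f(1)[of j] \<open>0 < e / (2 * s)\<close>] unfolding P_def by blast
      have "norm (P x) powr s = norm ((1/2) *\<^sub>R (v i x + v j x)) powr r" for x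
        using f(2)[of i x] f(2)[of j x] by (simp add: P_def v_def powr_powr r_def)
      then have P: "B.Np s P = B.Np r (\<lambda>x. (1/2) *\<^sub>R (v i x + v j x))" unfolding B.Np_def by (simp only:)
      \<comment> \<open>Both energies exceed \<open>m\<close> by less than
        \<open>e / (2 * s)\<close>, and \<open>w\<close> has energy at least \<open>m\<close>. With
        the slack of the same size this leaves less than \<open>e / s\<close> for the
        defect.\<close>
      have "((B.Np s (f i) + B.Np s (f j)) / 2 - B.Np s P) / s < e / s"
      proof -
        have "X < 2 * y" if "F < (F1 + F2) / 2 - X + y" "m \<le> F" "F1 < m + y" "F2 < m + y" for X F F1 F2 y :: real
          using that by (simp add: field_simps)
        from this[OF w(3) m_le[OF w(1)] n0[OF ij(1)] n0[OF ij(2)]] show ?thesis by simp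
      qed
      then show ?thesis using exponents unfolding P vN by (simp add: divide_less_cancel)
    qed
    then show ?thesis by blast
  qed
  obtain k \<sigma> where k: "k \<in> B.Lp r" "strict_mono (\<sigma> :: nat \<Rightarrow> nat)" "AE x in M. (\<lambda>n. v (\<sigma> n) x) \<longlonglongrightarrow> k x"
    "(\<lambda>n. B.Np r (\<lambda>x. v n x - k x)) \<longlonglongrightarrow> 0"
    using B.Lp_complete[OF r(2) vL B.Lp_Cauchy_of_midpoint_defect[OF r(1) vL vC defect]] by blast
  \<comment> \<open>The absolute value makes \<open>u\<close> nonnegative everywhere, although the
    limit \<open>k\<close> of the nonnegative \<open>v n\<close> is controlled only almost
    everywhere.\<close>
  define u where "u x = \<bar>k x\<bar> powr (1 / q)" for x
  have u0: "0 \<le> u x" for x by (simp add: u_def)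
  have uq: "u x powr q = \<bar>k x\<bar>" for x using exponents by (simp add: u_def powr_powr)
  have um: "u \<in> borel_measurable M" unfolding u_def using B.LpD(1)[OF k(1)] by measurable
  have us: "norm (u x) powr s = norm (k x) powr r" for x
    using exponents by (simp add: u_def powr_powr r_def)
  have uL: "u \<in> B.Lp s" using B.LpD(2)[OF k(1)] um unfolding B.Lp_def mem_Collect_eq us by blast
  have ae: "AE x in M. (\<lambda>n. f (\<sigma> n) x) \<longlonglongrightarrow> u x"
    using k(3)
  proof eventually_elim
    case (elim x)
    have "(\<lambda>n. \<bar>v (\<sigma> n) x\<bar> powr (1 / q)) \<longlonglongrightarrow> u x" unfolding u_def
      using elim exponents by (intro tendsto_powr' tendsto_rabs tendsto_const) auto
    then show ?case using f(2) exponents by (simp add: v_def powr_powr)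
  qed
  have le: "norm (f n x - u x) powr s \<le> norm (v n x - k x) powr r" for n x
  proof -
    have "\<bar>f n x - u x\<bar> powr q \<le> \<bar>v n x - \<bar>k x\<bar>\<bar>"
      using powr_diff_le[of q "f n x" "u x"] q1 f(2)[of n x] u0[of x] by (simp add: uq v_def)
    also have "\<dots> = \<bar>\<bar>v n x\<bar> - \<bar>k x\<bar>\<bar>" by (simp add: v_def)
    also have "\<dots> \<le> \<bar>v n x - k x\<bar>" by (rule abs_triangle_ineq3)
    finally have "(\<bar>f n x - u x\<bar> powr q) powr r \<le> \<bar>v n x - k x\<bar> powr r" using r by (intro powr_mono2) auto
    then show ?thesis by (simp add: powr_powr qr)
  qed
  have lim: "(\<lambda>n. B.Np s (\<lambda>x. f n x - u x)) \<longlonglongrightarrow> 0"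
  proof (rule tendsto_sandwich[OF _ _ tendsto_const k(4)])
    show "\<forall>\<^sub>F n in sequentially. B.Np s (\<lambda>x. f n x - u x) \<le> B.Np r (\<lambda>x. v n x - k x)"
    proof (intro always_eventually allI)
      fix n
      show "B.Np s (\<lambda>x. f n x - u x) \<le> B.Np r (\<lambda>x. v n x - k x)" unfolding B.Np_def
        using B.LpD(2)[OF B.Lp_diff[OF exponents(5) b_Lp[OF f(1)[of n]] uL]] B.LpD(2)[OF B.Lp_diff[OF r(2) vL[of n] k(1)]] le
          B.w_pos by (intro integral_mono) (auto intro!: mult_left_mono less_imp_le)
    qed
  qed (auto simp: B.Np_nonneg)
  show thesis
  proof (rule that[of "\<lambda>n. f (\<sigma> n)" u])
    show "(\<lambda>n. \<Phi> (f (\<sigma> n))) \<longlonglongrightarrow> m" "(\<lambda>n. B.Np s (\<lambda>x. f (\<sigma> n) x - u x)) \<longlonglongrightarrow> 0"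
      using LIMSEQ_subseq_LIMSEQ[OF f(3) k(2)] LIMSEQ_subseq_LIMSEQ[OF lim k(2)] by (simp_all add: o_def)
  qed (use f u0 ae uL in auto)
qed

text \<open>For the arithmetic midpoint, convexity of the \<open>b\<close>-term has the favourable
  sign, and the concave contribution of the \<open>a\<close>-term is negligible because all
  functions involved are close to \<open>u\<close> in \<open>A.Lp q\<close>. Near-minimality then
  makes the midpoint defect of the gradients small.\<close>

lemma gradients_converge:
  assumes f: "\<And>n. f n \<in> \<C>" "(\<lambda>n. \<Phi> (f n)) \<longlonglongrightarrow> m"
    and u: "u \<in> A.Lp q" "(\<lambda>n. A.Np q (\<lambda>x. f n x - u x)) \<longlonglongrightarrow> 0" and C: "\<And>n. R.Np p (D (f n)) \<le> C"
  obtains g where "g \<in> R.Lp p" "(\<lambda>n. R.Np p (\<lambda>x. D (f n) x - g x)) \<longlonglongrightarrow> 0"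
proof -
  have defect: "\<exists>n0. \<forall>i\<ge>n0. \<forall>j\<ge>n0. (R.Np p (D (f i)) + R.Np p (D (f j))) / 2
      - R.Np p (\<lambda>x. (1/2) *\<^sub>R (D (f i) x + D (f j) x)) < e" if e: "0 < e" for e
  proof -
    define \<epsilon> where "\<epsilon> = e / (4 * p)"
    have \<epsilon>: "0 < \<epsilon>" "4 * (\<epsilon> * p) = e" using e exponents by (auto simp: \<epsilon>_def)
    obtain \<delta> where \<delta>: "0 < \<delta>" "\<And>h. h \<in> A.Lp q \<Longrightarrow> A.Np q (\<lambda>x. h x - u x) < \<delta> \<Longrightarrow> \<bar>A.Np q h - A.Np q u\<bar> < \<epsilon>"
      using A.Np_continuous[OF exponents(4) u(1) \<epsilon>(1)] by blast
    have "\<forall>\<^sub>F n in sequentially. \<Phi> (f n) < m + \<epsilon>" using \<epsilon>(1) by (intro order_tendstoD(2)[OF f(2)]) simp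
    then obtain n1 where n1: "\<And>n. n1 \<le> n \<Longrightarrow> \<Phi> (f n) < m + \<epsilon>"
      unfolding eventually_sequentially by blast
    have "\<forall>\<^sub>F n in sequentially. A.Np q (\<lambda>x. f n x - u x) < \<delta> / 2"
      using \<delta>(1) by (intro order_tendstoD(2)[OF u(2)]) simp
    then obtain n2 where n2: "\<And>n. n2 \<le> n \<Longrightarrow> A.Np q (\<lambda>x. f n x - u x) < \<delta> / 2"
      unfolding eventually_sequentially by blast
    have "(R.Np p (D (f i)) + R.Np p (D (f j))) / 2 - R.Np p (\<lambda>x. (1/2) *\<^sub>R (D (f i) x + D (f j) x)) < e"
      if ij: "max n1 n2 \<le> i" "max n1 n2 \<le> j" for i j
    proof -
      define h where "h = (\<lambda>x. (1/2) *\<^sub>R (f i x + f j x))"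
      have h: "h \<in> \<C>" "D h = (\<lambda>x. (1/2) *\<^sub>R (D (f i) x + D (f j) x))"
        unfolding h_def using midpoint[OF f(1) f(1)] D_midpoint[OF f(1) f(1)] by auto
      note dL = A.Lp_diff[OF exponents(4) a_Lp_q[OF f(1)[of i]] u(1)] A.Lp_diff[OF exponents(4) a_Lp_q[OF f(1)[of j]] u(1)]
      have "A.Np q (\<lambda>x. h x - u x) = A.Np q (\<lambda>x. (1/2) *\<^sub>R ((f i x - u x) + (f j x - u x)))"
        by (simp add: h_def field_simps)
      \<comment> \<open>Halving gains \<open>(1/2) powr q\<close>, which cancels the constant of
        \<open>Lp_add\<close> exactly; distances below \<open>\<delta> / 2\<close> for both
        functions therefore keep the midpoint within \<open>\<delta>\<close>.\<close>
      also have "\<dots> = (1/2) powr q * A.Np q (\<lambda>x. (f i x - u x) + (f j x - u x))"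
        by (subst A.Np_scaleR) simp
      also have "\<dots> \<le> (1/2) powr q * (2 powr q * (A.Np q (\<lambda>x. f i x - u x) + A.Np q (\<lambda>x. f j x - u x)))"
        by (intro mult_left_mono A.Lp_add(2) exponents dL) auto
      also have "\<dots> = ((1/2) powr q * 2 powr q) * (A.Np q (\<lambda>x. f i x - u x) + A.Np q (\<lambda>x. f j x - u x))"
        by (rule mult.assoc[symmetric])
      also have "(1/2) powr q * 2 powr q = (1::real)" by (subst powr_mult[symmetric]) auto
      also have "1 * (A.Np q (\<lambda>x. f i x - u x) + A.Np q (\<lambda>x. f j x - u x)) < \<delta>" using n2[of i] n2[of j] ij by simp
      finally have Ah: "A.Np q u - \<epsilon> < A.Np q h" using \<delta>(2)[OF a_Lp_q[OF h(1)]] by (simp add: abs_less_iff)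
      have "A.Np q (f i) < A.Np q u + \<epsilon>" using \<delta>(2)[OF a_Lp_q[OF f(1)[of i]]] n2[of i] \<delta>(1) ij by (simp add: abs_less_iff)
      moreover have "A.Np q (f j) < A.Np q u + \<epsilon>" using \<delta>(2)[OF a_Lp_q[OF f(1)[of j]]] n2[of j] \<delta>(1) ij by (simp add: abs_less_iff)
      ultimately have "(A.Np q (f i) + A.Np q (f j)) / 2 - A.Np q h < 2 * \<epsilon>" using Ah by (simp add: field_simps)
      then have "((A.Np q (f i) + A.Np q (f j)) / 2 - A.Np q h) / q < 2 * \<epsilon> / q"
        using exponents by (intro divide_strict_right_mono) auto
      also have "2 * \<epsilon> / q \<le> 2 * \<epsilon>" using \<epsilon>(1) q1 by (simp add: field_simps)
      finally have a1: "((A.Np q (f i) + A.Np q (f j)) / 2 - A.Np q h) / q < 2 * \<epsilon>" .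
      have "B.Np s h \<le> (B.Np s (f i) + B.Np s (f j)) / 2"
      proof -
        have "B.Np s h \<le> (\<integral>x. (b x * norm (f i x) powr s + b x * norm (f j x) powr s) / 2 \<partial>M)" unfolding B.Np_def
        proof (rule integral_mono)
          fix x assume x: "x \<in> space M"
          show "b x * norm (h x) powr s \<le> (b x * norm (f i x) powr s + b x * norm (f j x) powr s) / 2"
            using mult_left_mono[OF norm_powr_midpoint_le[of s "f i x" "f j x"], of "b x"] B.w_pos[OF x] exponents
            by (simp add: h_def algebra_simps)
        qed (use B.LpD(2)[OF b_Lp[OF f(1)[of i]]] B.LpD(2)[OF b_Lp[OF f(1)[of j]]] B.LpD(2)[OF b_Lp[OF h(1)]] in auto)
        then show ?thesis unfolding B.Np_def
          using B.LpD(2)[OF b_Lp[OF f(1)[of i]]] B.LpD(2)[OF b_Lp[OF f(1)[of j]]] by simp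
      qed
      then have b1: "B.Np s h / s \<le> (B.Np s (f i) + B.Np s (f j)) / 2 / s" using exponents by (intro divide_right_mono) auto
      \<comment> \<open>The gradient defect is the energy defect plus the \<open>a\<close>-defect
        minus the nonnegative \<open>b\<close>-defect. The first is below \<open>\<epsilon>\<close>
        and the second below \<open>2 * \<epsilon>\<close>.\<close>
      have "((R.Np p (D (f i)) + R.Np p (D (f j))) / 2 - R.Np p (D h)) / p
        = (\<Phi> (f i) + \<Phi> (f j)) / 2 - \<Phi> h + ((A.Np q (f i) + A.Np q (f j)) / 2 - A.Np q h) / q
          - ((B.Np s (f i) + B.Np s (f j)) / 2 / s - B.Np s h / s)"
        unfolding J_def by (simp add: add_divide_distrib diff_divide_distrib)
      also have "\<dots> < \<epsilon> + 2 * \<epsilon>"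
      proof -
        have "(F1 + F2) / 2 - F + X - (Y - Z) < \<epsilon> + 2 * \<epsilon>"
          if "X < 2 * \<epsilon>" "Z \<le> Y" "m \<le> F" "F1 < m + \<epsilon>" "F2 < m + \<epsilon>" for X Y Z F F1 F2 :: real
          using that by (simp add: field_simps)
        from this[OF a1 b1 m_le[OF h(1)] n1 n1] show ?thesis using ij by simp
      qed
      also have "\<dots> \<le> 4 * \<epsilon>" using \<epsilon>(1) by simp
      also have "4 * \<epsilon> = e / p" using exponents by (simp add: \<epsilon>_def)
      finally show ?thesis using exponents unfolding h(2) by (simp add: divide_less_cancel)
    qed
    then show ?thesis by blast
  qed
  show thesis
    using R.Lp_complete[OF exponents(3) grad_Lp[OF f(1)] R.Lp_Cauchy_of_midpoint_defect[OF exponents(1) grad_Lp[OF f(1)] C defect]] that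
    by blast
qed

theorem minimizer:
  obtains f u g where "\<And>n. f n \<in> \<C>" "\<And>x. 0 \<le> u x" "AE x in M. (\<lambda>n. f n x) \<longlonglongrightarrow> u x"
    "u \<in> A.Lp q" "u \<in> B.Lp s" "g \<in> R.Lp p"
    "(\<lambda>n. A.Np q (\<lambda>x. f n x - u x)) \<longlonglongrightarrow> 0" "(\<lambda>n. R.Np p (\<lambda>x. D (f n) x - g x)) \<longlonglongrightarrow> 0"
    "\<And>\<phi>. \<phi> \<in> \<C> \<Longrightarrow> integrable M (\<lambda>x. \<rho> x * norm (g x) powr (p - 2) * (g x \<bullet> D \<phi> x))"
    "\<And>\<phi>. \<phi> \<in> \<C> \<Longrightarrow> integrable M (\<lambda>x. a x * \<bar>u x\<bar> powr (q - 2) * (u x * \<phi> x))"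
    "\<And>\<phi>. \<phi> \<in> \<C> \<Longrightarrow> integrable M (\<lambda>x. b x * \<bar>u x\<bar> powr (s - 2) * (u x * \<phi> x))"
    "\<And>\<phi>. \<phi> \<in> \<C> \<Longrightarrow> (\<integral>x. \<rho> x * norm (g x) powr (p - 2) * (g x \<bullet> D \<phi> x) \<partial>M)
      = (\<integral>x. a x * \<bar>u x\<bar> powr (q - 2) * (u x * \<phi> x) \<partial>M) - (\<integral>x. b x * \<bar>u x\<bar> powr (s - 2) * (u x * \<phi> x) \<partial>M)"
    "\<not> (AE x in M. u x = 0)"
proof -
  obtain f u where f: "\<And>n. f n \<in> \<C>" "\<And>n x. 0 \<le> f n x" "(\<lambda>n. \<Phi> (f n)) \<longlonglongrightarrow> m" and u: "\<And>x. 0 \<le> u x"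
    "AE x in M. (\<lambda>n. f n x) \<longlonglongrightarrow> u x" "u \<in> B.Lp s" "(\<lambda>n. B.Np s (\<lambda>x. f n x - u x)) \<longlonglongrightarrow> 0"
    using minimizing_sequence_converges by blast
  obtain C where E: "\<And>n. R.Np p (D (f n)) \<le> C" "\<And>n. B.Np s (f n) \<le> C" using energy_bounded[OF f(1,3)] by blast
  have "A.Np p (f n) \<le> \<kappa> * C" for n
    using Hardy[OF f(1)[of n]] mult_left_mono[OF E(1)[of n], of \<kappa>] \<kappa> by linarith
  note V = A.Lp_Vitali[OF exponents(4) qp a_integrable a_Lp[OF f(1)] this B.LpD(1)[OF u(3)] u(2)]
  obtain g where g: "g \<in> R.Lp p" "(\<lambda>n. R.Np p (\<lambda>x. D (f n) x - g x)) \<longlonglongrightarrow> 0"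
    using gradients_converge[OF f(1,3) V(2,3) E(1)] by blast
  \<comment> \<open>The perturbed functions \<open>f n + t * \<phi>\<close> are admissible, so their
    energies are at least \<open>m\<close>, and the bound passes to the limit pair.\<close>
  have Jlim: "(\<lambda>n. \<Phi> (\<lambda>x. f n x + t * \<phi> x)) \<longlonglongrightarrow> J (\<lambda>x. g x + t *\<^sub>R D \<phi> x) (\<lambda>x. u x + t *\<^sub>R \<phi> x)"
    if \<phi>: "\<phi> \<in> \<C>" for \<phi> t
  proof -
    have 1: "(\<lambda>n. R.Np p (\<lambda>x. D (f n) x + t *\<^sub>R D \<phi> x)) \<longlonglongrightarrow> R.Np p (\<lambda>x. g x + t *\<^sub>R D \<phi> x)"
      using g exponents by (intro R.Np_tendsto R.Lp_add(1) R.Lp_scaleR grad_Lp f \<phi>) auto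
    have 2: "(\<lambda>n. A.Np q (\<lambda>x. f n x + t *\<^sub>R \<phi> x)) \<longlonglongrightarrow> A.Np q (\<lambda>x. u x + t *\<^sub>R \<phi> x)"
      using V exponents a_Lp_q[OF \<phi>] by (intro A.Np_tendsto A.Lp_add(1) A.Lp_scaleR) auto
    have 3: "(\<lambda>n. B.Np s (\<lambda>x. f n x + t *\<^sub>R \<phi> x)) \<longlonglongrightarrow> B.Np s (\<lambda>x. u x + t *\<^sub>R \<phi> x)"
      using u exponents b_Lp[OF \<phi>] b_Lp[OF f(1)] by (intro B.Np_tendsto B.Lp_add(1) B.Lp_scaleR) auto
    show ?thesis unfolding J_def D_add_scaled[OF f(1) \<phi>]
      using exponents 2 3 by (intro tendsto_intros 1) auto
  qed
  have mle: "m \<le> J (\<lambda>x. g x + t *\<^sub>R D \<phi> x) (\<lambda>x. u x + t *\<^sub>R \<phi> x)" if \<phi>: "\<phi> \<in> \<C>" for \<phi> t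
    using LIMSEQ_le_const[OF Jlim[OF \<phi>, of t]] m_le[OF add_scaled[OF f(1) \<phi>]] by blast
  have Jm: "J g u = m"
  proof -
    have "(\<lambda>n. \<Phi> (f n)) \<longlonglongrightarrow> J g u" using Jlim[OF f(1)[of 0], of 0] by simp
    then show ?thesis using f(3) LIMSEQ_unique by blast
  qed
  define L where "L \<phi> = (\<integral>x. \<rho> x * norm (g x) powr (p - 2) * (g x \<bullet> D \<phi> x) \<partial>M)
    - (\<integral>x. a x * \<bar>u x\<bar> powr (q - 2) * (u x * \<phi> x) \<partial>M) + (\<integral>x. b x * \<bar>u x\<bar> powr (s - 2) * (u x * \<phi> x) \<partial>M)" for \<phi>
  \<comment> \<open>The first variation \<open>L\<close> is the limit of nonnegative quotients in
    the direction \<open>\<phi>\<close>. It is odd in \<open>\<phi>\<close>, so nonnegativity in all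
    directions forces \<open>L \<phi> = 0\<close>.\<close>
  have L0: "0 \<le> L \<phi>" if \<phi>: "\<phi> \<in> \<C>" for \<phi>
  proof -
    define t where "t n = 1 / real (Suc n)" for n
    have t: "0 < t n" for n by (simp add: t_def)
    note d1 = R.Np_directional_derivative(2)[OF exponents(1) g(1) grad_Lp[OF \<phi>], folded t_def]
    note d2 = A.Np_directional_derivative(2)[OF q1 V(2) a_Lp_q[OF \<phi>], folded t_def]
    note d3 = B.Np_directional_derivative(2)[OF exponents(2) u(3) b_Lp[OF \<phi>], folded t_def]
    have "(\<lambda>n. (R.Np p (\<lambda>x. g x + t n *\<^sub>R D \<phi> x) - R.Np p g) / t n / p
      - (A.Np q (\<lambda>x. u x + t n *\<^sub>R \<phi> x) - A.Np q u) / t n / q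
      + (B.Np s (\<lambda>x. u x + t n *\<^sub>R \<phi> x) - B.Np s u) / t n / s) \<longlonglongrightarrow> L \<phi>"
      using tendsto_add[OF tendsto_diff[OF tendsto_divide[OF d1 tendsto_const[of p]] tendsto_divide[OF d2 tendsto_const[of q]]]
          tendsto_divide[OF d3 tendsto_const[of s]]] exponents
      by (simp add: L_def)
    moreover have "(R.Np p (\<lambda>x. g x + t n *\<^sub>R D \<phi> x) - R.Np p g) / t n / p
      - (A.Np q (\<lambda>x. u x + t n *\<^sub>R \<phi> x) - A.Np q u) / t n / q
      + (B.Np s (\<lambda>x. u x + t n *\<^sub>R \<phi> x) - B.Np s u) / t n / s
      = (J (\<lambda>x. g x + t n *\<^sub>R D \<phi> x) (\<lambda>x. u x + t n *\<^sub>R \<phi> x) - J g u) / t n" for n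
      unfolding J_def by (simp add: add_divide_distrib diff_divide_distrib mult.commute)
    moreover have "0 \<le> (J (\<lambda>x. g x + t n *\<^sub>R D \<phi> x) (\<lambda>x. u x + t n *\<^sub>R \<phi> x) - J g u) / t n" for n
      using mle[OF \<phi>, of "t n"] t[of n] unfolding Jm by (intro divide_nonneg_nonneg) auto
    ultimately show ?thesis by (metis (no_types, lifting) LIMSEQ_le_const)
  qed
  have eq: "(\<integral>x. \<rho> x * norm (g x) powr (p - 2) * (g x \<bullet> D \<phi> x) \<partial>M)
      = (\<integral>x. a x * \<bar>u x\<bar> powr (q - 2) * (u x * \<phi> x) \<partial>M) - (\<integral>x. b x * \<bar>u x\<bar> powr (s - 2) * (u x * \<phi> x) \<partial>M)"
    if \<phi>: "\<phi> \<in> \<C>" for \<phi>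
  proof -
    have "L (\<lambda>x. (-1) * \<phi> x) = - L \<phi>" unfolding L_def D_scaled[OF \<phi>] by simp
    then have "L \<phi> = 0" using L0[OF \<phi>] L0[OF scaled[OF \<phi>, of "-1"]] by linarith
    then show ?thesis by (simp add: L_def)
  qed
  \<comment> \<open>If \<open>u\<close> vanished, only nonnegative terms of \<open>J g u\<close>
    would remain, against \<open>J g u = m < 0\<close>.\<close>
  have nz: "\<not> (AE x in M. u x = 0)"
  proof
    assume "AE x in M. u x = 0"
    then have "A.Np q u = (\<integral>x. 0 \<partial>M)" unfolding A.Np_def
      using A.LpD(1)[OF V(2)] by (intro integral_cong_AE) auto
    then have "A.Np q u = 0" by simp
    moreover have "0 \<le> R.Np p g / p" "0 \<le> B.Np s u / s"
      using R.Np_nonneg B.Np_nonneg exponents by (auto intro!: divide_nonneg_nonneg)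
    ultimately have "0 \<le> J g u" by (simp add: J_def)
    then show False using Jm m_neg by simp
  qed
  show thesis
  proof (rule that[OF f(1) u(1,2) V(2) u(3) g(1) V(3) g(2)])
    fix \<phi> assume \<phi>: "\<phi> \<in> \<C>"
    show "integrable M (\<lambda>x. \<rho> x * norm (g x) powr (p - 2) * (g x \<bullet> D \<phi> x))"
      by (rule R.Np_directional_derivative(1)[OF exponents(1) g(1) grad_Lp[OF \<phi>]])
    show "integrable M (\<lambda>x. a x * \<bar>u x\<bar> powr (q - 2) * (u x * \<phi> x))"
      using A.Np_directional_derivative(1)[OF q1 V(2) a_Lp_q[OF \<phi>]] by simp
    show "integrable M (\<lambda>x. b x * \<bar>u x\<bar> powr (s - 2) * (u x * \<phi> x))"
      using B.Np_directional_derivative(1)[OF exponents(2) u(3) b_Lp[OF \<phi>]] by simp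
  qed (use eq nz in auto)
qed

end

subsection \<open>Hidden convexity\<close>

lemma grad_powr:
  assumes f: "smooth f" and pos: "0 < f x"
  shows "grad (\<lambda>x. f x powr r) x = (r * f x powr (r - 1)) *\<^sub>R grad f x"
proof (rule grad_eqI)
  have "((\<lambda>y. y powr r) has_derivative (\<lambda>h. (r * f x powr (r - 1)) * h)) (at (f x))"
    using has_real_derivative_powr[OF pos, of r] by (simp add: has_field_derivative_def)
  from has_derivative_compose[OF smooth_has_derivative[OF f] this]
  show "((\<lambda>x. f x powr r) has_derivative (\<lambda>v. ((r * f x powr (r - 1)) *\<^sub>R grad f x) \<bullet> v)) (at x)" by simp
qed

text \<open>A smooth approximation of \<open>\<bar>f x\<bar> powr q\<close>: for nonzero
  \<open>d\<close> the base of the power stays positive also where \<open>f\<close>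
  vanishes.\<close>

abbreviation regularized :: "real \<Rightarrow> real \<Rightarrow> ('a \<Rightarrow> real) \<Rightarrow> 'a \<Rightarrow> real" where
  "regularized q d f x \<equiv> ((f x)\<^sup>2 + d\<^sup>2) powr (q / 2)"

text \<open>A smooth substitute for the power mean of \<open>\<bar>f\<bar>\<close> and \<open>\<bar>g\<bar>\<close>. Subtracting \<open>d\<close> makes it vanish where both do.\<close>

definition smooth_mean :: "real \<Rightarrow> real \<Rightarrow> ('a \<Rightarrow> real) \<Rightarrow> ('a \<Rightarrow> real) \<Rightarrow> 'a \<Rightarrow> real" where
  "smooth_mean q d f g x =
     ((regularized q d f x + regularized q d g x) * (1 / 2)) powr (1 / q) + (- d)"

lemma square_powr_half: "0 \<le> t \<Longrightarrow> (t\<^sup>2) powr (q / 2) = t powr q" for t q :: real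
  by (simp add: powr_power[symmetric] powr_powr flip: powr_numeral)

context
  fixes f g :: "'a::euclidean_space \<Rightarrow> real" and p q d :: real
  assumes q: "1 < q" and d: "0 < d"
begin

lemma smooth_mean_nonneg: "0 \<le> smooth_mean q d f g x"
proof -
  have "d powr q \<le> regularized q d y x" for y :: "'a \<Rightarrow> real"
    using q d by (subst square_powr_half[symmetric]) (auto intro!: powr_mono2)
  from this[of f] this[of g]
  have "d powr q \<le> (regularized q d f x + regularized q d g x) * (1 / 2)" by simp
  then have "(d powr q) powr (1 / q) \<le> ((regularized q d f x + regularized q d g x) * (1 / 2)) powr (1 / q)"
    using q by (intro powr_mono2) auto
  then show ?thesis using q d by (simp add: smooth_mean_def powr_powr)
qed

lemma smooth_mean_le: "smooth_mean q d f g x \<le> \<bar>f x\<bar> + \<bar>g x\<bar>"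
proof -
  define m where "m = \<bar>f x\<bar> + \<bar>g x\<bar> + d"
  have m: "0 \<le> m" using d by (simp add: m_def)
  have "y\<^sup>2 + d\<^sup>2 \<le> m\<^sup>2" if "\<bar>y\<bar> + d \<le> m" for y
  proof -
    have "y\<^sup>2 + d\<^sup>2 \<le> (\<bar>y\<bar> + d)\<^sup>2" using d by (simp add: power2_sum)
    also have "\<dots> \<le> m\<^sup>2" using that d by (intro power_mono) auto
    finally show ?thesis .
  qed
  then have "(y\<^sup>2 + d\<^sup>2) powr (q / 2) \<le> m powr q" if "\<bar>y\<bar> + d \<le> m" for y
    using that q m by (subst square_powr_half[symmetric]) (auto intro!: powr_mono2)
  from this[of "f x"] this[of "g x"]
  have "(regularized q d f x + regularized q d g x) * (1 / 2) \<le> m powr q" by (simp add: m_def)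
  then have "((regularized q d f x + regularized q d g x) * (1 / 2)) powr (1 / q) \<le> (m powr q) powr (1 / q)"
    using q by (intro powr_mono2) auto
  also have "\<dots> = m" using q m by (simp add: powr_powr)
  finally show ?thesis by (simp add: smooth_mean_def m_def)
qed

lemma sum_squares_pos: "0 < (y::real)\<^sup>2 + d\<^sup>2"
  using d by (simp add: add_nonneg_pos)

lemma smooth_mean_smooth:
  assumes "smooth f" "smooth g"
  shows "smooth (\<lambda>x. (f x)\<^sup>2 + d\<^sup>2)"
    and "smooth (\<lambda>x. (regularized q d f x + regularized q d g x) * (1 / 2))"
    and "smooth (smooth_mean q d f g)"
proof -
  have sq: "smooth (\<lambda>x. (y x)\<^sup>2 + d\<^sup>2)" if "smooth y" for y :: "'a \<Rightarrow> real"
    unfolding power2_eq_square by (intro smooth_add smooth_mult smooth_const that)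
  show "smooth (\<lambda>x. (f x)\<^sup>2 + d\<^sup>2)" by (rule sq[OF assms(1)])
  show H: "smooth (\<lambda>x. (regularized q d f x + regularized q d g x) * (1 / 2))"
    by (intro smooth_mult smooth_add smooth_powr sq assms smooth_const sum_squares_pos)
  have "smooth_mean q d f g = (\<lambda>x. ((regularized q d f x + regularized q d g x) * (1 / 2)) powr (1 / q) + (- d))"
    by (simp add: smooth_mean_def fun_eq_iff)
  moreover have "0 < (regularized q d f x + regularized q d g x) * (1 / 2)" for x
    using d by (intro mult_pos_pos add_pos_pos) auto
  ultimately show "smooth (smooth_mean q d f g)" using H by (simp only:) (intro smooth_add smooth_powr smooth_const)
qed

lemma smooth_mean_Cc:
  assumes "f \<in> Cc_infinity UNIV" "g \<in> Cc_infinity UNIV"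
  shows "smooth_mean q d f g \<in> Cc_infinity UNIV"
proof (rule Cc_infinity_UNIV_I)
  show "smooth (smooth_mean q d f g)" using assms[THEN Cc_infinityD(1)] by (rule smooth_mean_smooth(3))
  have "smooth_mean q d f g x = 0" if "f x = 0" "g x = 0" for x
    using that q d by (simp add: smooth_mean_def square_powr_half powr_powr)
  then show "bounded {x. smooth_mean q d f g x \<noteq> 0}"
    by (intro bounded_subset[OF bounded_Un[THEN iffD2, OF conjI, OF assms[THEN Cc_infinityD(2)]]]) auto
qed

text \<open>The pointwise form of hidden convexity. With \<open>S y = sqrt (F y)\<close> and
  \<open>h\<close> the mean of order \<open>q\<close> of \<open>S f\<close> and \<open>S g\<close>,
  the chain rule bounds the gradient by an average of \<open>norm (grad f x)\<close> and
  \<open>norm (grad g x)\<close> with factors \<open>(S f / h) powr (q - 1)\<close> and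
  \<open>(S g / h) powr (q - 1)\<close>. The \<open>q\<close>-th powers of these ratios average to
  1, which is the normalization in \<open>weighted_mean_le_power_mean\<close>.\<close>

lemma norm_grad_smooth_mean:
  assumes s: "smooth f" "smooth g" and p: "q \<le> p"
  shows "norm (grad (smooth_mean q d f g) x) powr p \<le> (norm (grad f x) powr p + norm (grad g x) powr p) / 2"
proof -
  define F where "F y = ((y x)\<^sup>2 + d\<^sup>2)" for y :: "'a \<Rightarrow> real"
  define H where "H = (F f powr (q / 2) + F g powr (q / 2)) * (1 / 2)"
  define S where "S y = sqrt (F y)" for y
  have F: "0 < F y" for y unfolding F_def by (rule sum_squares_pos)
  have S: "0 < S y" "\<bar>y x\<bar> \<le> S y" "F y = (S y)\<^sup>2" for y
  proof -
    show "0 < S y" "F y = (S y)\<^sup>2" using F[of y] by (simp_all add: S_def)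
    have "\<bar>y x\<bar> = sqrt ((y x)\<^sup>2)" by simp
    also have "\<dots> \<le> S y" unfolding S_def F_def by (intro real_sqrt_le_mono) simp
    finally show "\<bar>y x\<bar> \<le> S y" .
  qed
  have FS: "F y powr (q / 2) = S y powr q" for y using S[of y] by (simp add: square_powr_half)
  have H: "0 < H" using F[of f] by (simp add: H_def add_pos_nonneg)
  define h where "h = H powr (1 / q)"
  have h: "0 < h" "h powr q = H" using H q by (simp_all add: h_def powr_powr)
  have G: "norm (grad (\<lambda>x. regularized q d y x) x) \<le> q * (S y powr (q - 1) * norm (grad y x))" if y: "smooth y" for y :: "'a \<Rightarrow> real"
  proof -
    have sq: "smooth (\<lambda>x. (y x)\<^sup>2 + d\<^sup>2)"
      unfolding power2_eq_square by (intro smooth_add smooth_mult smooth_const y)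
    have "grad (\<lambda>x. (y x)\<^sup>2 + d\<^sup>2) x = (2 * y x) *\<^sub>R grad y x"
    proof (rule grad_eqI)
      have "((\<lambda>x. y x * y x + d\<^sup>2) has_derivative (\<lambda>v. y x * (grad y x \<bullet> v) + (grad y x \<bullet> v) * y x)) (at x)"
        by (intro has_derivative_add_const has_derivative_mult smooth_has_derivative y)
      moreover have "(\<lambda>v. y x * (grad y x \<bullet> v) + (grad y x \<bullet> v) * y x) = (\<lambda>v. ((2 * y x) *\<^sub>R grad y x) \<bullet> v)"
        by (simp add: fun_eq_iff algebra_simps)
      ultimately show "((\<lambda>x. (y x)\<^sup>2 + d\<^sup>2) has_derivative (\<lambda>v. ((2 * y x) *\<^sub>R grad y x) \<bullet> v)) (at x)"
        by (simp only: power2_eq_square[of "y _"])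
    qed
    then have "grad (\<lambda>x. regularized q d y x) x = (q / 2 * F y powr (q / 2 - 1)) *\<^sub>R ((2 * y x) *\<^sub>R grad y x)"
      using grad_powr[OF sq sum_squares_pos, where x = x and r = "q / 2"] by (simp add: F_def)
    then have "norm (grad (\<lambda>x. regularized q d y x) x) = q * F y powr (q / 2 - 1) * \<bar>y x\<bar> * norm (grad y x)"
      using q by (simp add: abs_mult)
    \<comment> \<open>Enlarging \<open>\<bar>y x\<bar>\<close> to \<open>S y\<close> leaves pure
      powers of \<open>S y\<close>, with total exponent
      \<open>2 * (q / 2 - 1) + 1 = q - 1\<close>.\<close>
    also have "\<dots> \<le> q * F y powr (q / 2 - 1) * S y * norm (grad y x)"
      using q S(2)[of y] by (intro mult_right_mono mult_left_mono) auto
    also have "F y powr (q / 2 - 1) = S y powr (q - 2)"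
      using square_powr_half[of "S y" "q - 2"] S[of y] by (simp add: diff_divide_distrib)
    also have "q * S y powr (q - 2) * S y * norm (grad y x) = q * ((S y powr (q - 2) * S y) * norm (grad y x))" by simp
    also have "S y powr (q - 2) * S y = S y powr (q - 1)"
      using S(1)[of y] powr_add[of "S y" "q - 2" 1] by simp
    finally show ?thesis .
  qed
  define Hf where "Hf x = (regularized q d f x + regularized q d g x) * (1 / 2)" for x
  have sH: "smooth Hf" unfolding Hf_def by (rule smooth_mean_smooth(2)[OF s])
  have HfH: "Hf x = H" by (simp add: Hf_def H_def F_def)
  have sp: "smooth (\<lambda>x. regularized q d y x)" if "smooth y" for y :: "'a \<Rightarrow> real"
    unfolding power2_eq_square using sum_squares_pos[unfolded power2_eq_square]
    by (intro smooth_powr smooth_add smooth_mult smooth_const that) auto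
  have gH: "grad Hf x = (1/2) *\<^sub>R (grad (\<lambda>x. regularized q d f x) x + grad (\<lambda>x. regularized q d g x) x)"
  proof (rule grad_eqI)
    have "(Hf has_derivative (\<lambda>v. (grad (\<lambda>x. regularized q d f x) x \<bullet> v
        + grad (\<lambda>x. regularized q d g x) x \<bullet> v) * (1 / 2))) (at x)"
      unfolding Hf_def by (intro has_derivative_mult_left has_derivative_add smooth_has_derivative sp s)
    then show "(Hf has_derivative (\<lambda>v. ((1/2) *\<^sub>R (grad (\<lambda>x. regularized q d f x) x
        + grad (\<lambda>x. regularized q d g x) x)) \<bullet> v)) (at x)"
      by (simp add: inner_add_left)
  qed
  have "norm (grad Hf x) \<le> 1 / 2 * (norm (grad (\<lambda>x. regularized q d f x) x)
      + norm (grad (\<lambda>x. regularized q d g x) x))"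
    unfolding gH using norm_triangle_ineq by (simp add: norm_triangle_ineq)
  also have "\<dots> \<le> 1 / 2 * (q * (S f powr (q - 1) * norm (grad f x)) + q * (S g powr (q - 1) * norm (grad g x)))"
    by (intro mult_left_mono add_mono G s) auto
  finally have nH: "norm (grad Hf x) \<le> q * ((S f powr (q - 1) * norm (grad f x) + S g powr (q - 1) * norm (grad g x)) / 2)"
    by (simp add: algebra_simps)
  have "grad (smooth_mean q d f g) x = grad (\<lambda>x. Hf x powr (1 / q)) x"
  proof (rule grad_eqI)
    have Hp: "0 < Hf x" for x
      unfolding Hf_def using d by (intro mult_pos_pos add_pos_pos) auto
    have e: "smooth_mean q d f g = (\<lambda>x. Hf x powr (1 / q) + (- d))" by (simp add: smooth_mean_def Hf_def fun_eq_iff)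
    show "(smooth_mean q d f g has_derivative (\<lambda>v. grad (\<lambda>x. Hf x powr (1 / q)) x \<bullet> v)) (at x)"
      unfolding e by (rule has_derivative_add_const) (intro smooth_has_derivative smooth_powr sH Hp)
  qed
  also have "\<dots> = (1 / q * H powr (1 / q - 1)) *\<^sub>R grad Hf x"
    using grad_powr[OF sH, where x = x and r = "1 / q"] H by (simp add: HfH)
  finally have "norm (grad (smooth_mean q d f g) x) = 1 / q * H powr (1 / q - 1) * norm (grad Hf x)"
    using q by simp
  also have "\<dots> \<le> 1 / q * H powr (1 / q - 1) * (q * ((S f powr (q - 1) * norm (grad f x) + S g powr (q - 1) * norm (grad g x)) / 2))"
    using q by (intro mult_left_mono nH) auto
  also have "\<dots> = H powr (1 / q - 1) * ((S f powr (q - 1) * norm (grad f x) + S g powr (q - 1) * norm (grad g x)) / 2)"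
    using q by simp
  also have "H powr (1 / q - 1) = 1 / h powr (q - 1)"
  proof -
    have "H powr (1 / q - 1) = h powr (q * (1 / q - 1))" unfolding h(2)[symmetric] by (simp add: powr_powr)
    also have "q * (1 / q - 1) = - (q - 1)" using q by (simp add: field_simps)
    finally show ?thesis by (simp only: powr_minus_divide)
  qed
  also have "1 / h powr (q - 1) * ((S f powr (q - 1) * norm (grad f x) + S g powr (q - 1) * norm (grad g x)) / 2)
    = ((S f / h) powr (q - 1) * norm (grad f x) + (S g / h) powr (q - 1) * norm (grad g x)) / 2"
    using S(1)[of f] S(1)[of g] h by (simp add: powr_divide add_divide_distrib distrib_left)
  finally have "norm (grad (smooth_mean q d f g) x)
    \<le> ((S f / h) powr (q - 1) * norm (grad f x) + (S g / h) powr (q - 1) * norm (grad g x)) / 2" .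
  then have "norm (grad (smooth_mean q d f g) x) powr p
    \<le> (((S f / h) powr (q - 1) * norm (grad f x) + (S g / h) powr (q - 1) * norm (grad g x)) / 2) powr p"
    using q p by (intro powr_mono2) auto
  also have "\<dots> \<le> (norm (grad f x) powr p + norm (grad g x) powr p) / 2"
  proof (rule weighted_mean_le_power_mean[OF q p])
    have "(S f / h) powr q + (S g / h) powr q = (S f powr q + S g powr q) / H"
      using S(1)[of f] S(1)[of g] h by (simp add: powr_divide add_divide_distrib)
    also have "\<dots> = 2" using H unfolding FS[symmetric] by (simp add: H_def field_simps)
    finally show "((S f / h) powr q + (S g / h) powr q) / 2 = 1" by simp
  qed (use S(1)[of f] S(1)[of g] h in auto)
  finally show ?thesis .
qed

end

lemma smooth_mean_tendsto:
  assumes q: "1 < q" and d: "d \<longlonglongrightarrow> 0"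
  shows "(\<lambda>n. smooth_mean q (d n) f g x) \<longlonglongrightarrow> ((\<bar>f x\<bar> powr q + \<bar>g x\<bar> powr q) / 2) powr (1 / q)"
proof -
  have F: "(\<lambda>n. (y\<^sup>2 + (d n)\<^sup>2) powr (q / 2)) \<longlonglongrightarrow> \<bar>y\<bar> powr q" for y
  proof -
    have "(\<lambda>n. y\<^sup>2 + (d n)\<^sup>2) \<longlonglongrightarrow> \<bar>y\<bar>\<^sup>2" using tendsto_add[OF tendsto_const tendsto_power[OF d, of 2], of "y\<^sup>2"] by simp
    then have "(\<lambda>n. (y\<^sup>2 + (d n)\<^sup>2) powr (q / 2)) \<longlonglongrightarrow> (\<bar>y\<bar>\<^sup>2) powr (q / 2)"
      using q by (intro tendsto_powr' tendsto_const) auto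
    then show ?thesis by (simp only: square_powr_half abs_ge_zero)
  qed
  have "(\<lambda>n. smooth_mean q (d n) f g x) \<longlonglongrightarrow> ((\<bar>f x\<bar> powr q + \<bar>g x\<bar> powr q) * (1 / 2)) powr (1 / q) + (- 0)"
    unfolding smooth_mean_def using q
    by (intro tendsto_add tendsto_minus d tendsto_powr' tendsto_mult F tendsto_const) (auto intro!: always_eventually)
  then show ?thesis by simp
qed

subsection \<open>Local convergence and the weights on the half-space\<close>

context weighted_measure
begin

text \<open>A local substitute for Hoelder's inequality: \<open>powr_le_min_plus\<close> with
  exponents 1 and \<open>r\<close> at level \<open>\<epsilon>\<close>, where \<open>c\<close> bounds
  the weight from below on \<open>S\<close>. The free parameter \<open>\<epsilon>\<close> lets a
  small \<open>Np\<close> yield a small integral.\<close>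

lemma integrable_dominated_by_Lp:
  fixes h :: "'a \<Rightarrow> 'v::euclidean_space" and \<psi> :: "'a \<Rightarrow> 'w::euclidean_space"
  assumes S: "S \<in> sets M" "emeasure M S < \<infinity>" and c: "0 < c" "AE x in M. x \<in> S \<longrightarrow> c \<le> w x"
    and r: "1 < r" and h: "h \<in> Lp r" and \<psi>: "\<psi> \<in> borel_measurable M"
    and le: "\<And>x. x \<in> space M \<Longrightarrow> norm (\<psi> x) \<le> B * indicator S x * norm (h x)" and B: "0 \<le> B" and \<epsilon>: "0 < \<epsilon>"
  shows "integrable M \<psi>" "norm (\<integral>x. \<psi> x \<partial>M) \<le> B * (\<epsilon> * measure M S + \<epsilon> powr (1 - r) / c * Np r h)"
proof -
  define W where "W x = B * (\<epsilon> * indicator S x + \<epsilon> powr (1 - r) / c * (w x * norm (h x) powr r))" for x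
  have W: "integrable M W" unfolding W_def
    using S LpD(2)[OF h] by (intro integrable_mult_right Bochner_Integration.integrable_add) auto
  have ae: "AE x in M. norm (\<psi> x) \<le> W x"
    using c(2) AE_space
  proof eventually_elim
    case (elim x)
    have "indicator S x * norm (h x) \<le> \<epsilon> * indicator S x + \<epsilon> powr (1 - r) / c * (w x * norm (h x) powr r)"
    proof (cases "x \<in> S")
      case True
      have "norm (h x) \<le> min (norm (h x)) \<epsilon> + \<epsilon> powr (1 - r) * norm (h x) powr r"
        using powr_le_min_plus[OF r \<epsilon>, of "norm (h x)"] \<epsilon> by simp
      also have "\<dots> \<le> \<epsilon> + \<epsilon> powr (1 - r) / c * (w x * norm (h x) powr r)"
      proof -
        have "c * norm (h x) powr r \<le> w x * norm (h x) powr r" using elim True by (intro mult_right_mono) auto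
        then have "norm (h x) powr r \<le> w x * norm (h x) powr r / c" using c by (simp add: field_simps)
        then have "\<epsilon> powr (1 - r) * norm (h x) powr r \<le> \<epsilon> powr (1 - r) * (w x * norm (h x) powr r / c)"
          by (intro mult_left_mono) auto
        then show ?thesis by (simp add: add_mono)
      qed
      finally show ?thesis using True by simp
    next
      case False
      have "0 \<le> \<epsilon> powr (1 - r) / c * (w x * norm (h x) powr r)"
        using c w_pos elim by (intro mult_nonneg_nonneg divide_nonneg_nonneg) (auto intro: less_imp_le)
      then show ?thesis using False by simp
    qed
    from mult_left_mono[OF this B] show ?case using le[of x] elim by (simp add: W_def mult.assoc)
  qed
  have W0: "AE x in M. norm (\<psi> x) \<le> norm (W x)" using ae by eventually_elim auto
  show i: "integrable M \<psi>" by (rule Bochner_Integration.integrable_bound[OF W \<psi> W0])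
  have "norm (\<integral>x. \<psi> x \<partial>M) \<le> (\<integral>x. norm (\<psi> x) \<partial>M)" by (rule integral_norm_bound)
  also have "\<dots> \<le> (\<integral>x. W x \<partial>M)" using i W ae by (intro integral_mono_AE) auto
  also have "\<dots> = B * (\<epsilon> * measure M S + \<epsilon> powr (1 - r) / c * Np r h)"
    unfolding W_def Np_def using S LpD(2)[OF h] by simp
  finally show "norm (\<integral>x. \<psi> x \<partial>M) \<le> B * (\<epsilon> * measure M S + \<epsilon> powr (1 - r) / c * Np r h)" .
qed

lemma Lp_integrable_on:
  fixes h :: "'a \<Rightarrow> 'v::euclidean_space"
  assumes S: "S \<in> sets M" "emeasure M S < \<infinity>" and c: "0 < c" "AE x in M. x \<in> S \<longrightarrow> c \<le> w x"
    and r: "1 < r" and h: "h \<in> Lp r"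
  shows "integrable M (\<lambda>x. indicator S x *\<^sub>R h x)"
proof (rule integrable_dominated_by_Lp(1)[OF S c r h, where B = 1 and \<epsilon> = 1])
  show "(\<lambda>x. indicator S x *\<^sub>R h x) \<in> borel_measurable M" using S(1) LpD(1)[OF h] by measurable
qed auto

lemma integral_tendsto_of_Np_tendsto:
  fixes h :: "nat \<Rightarrow> 'a \<Rightarrow> 'v::euclidean_space" and \<psi> :: "nat \<Rightarrow> 'a \<Rightarrow> 'w::euclidean_space"
  assumes S: "S \<in> sets M" "emeasure M S < \<infinity>" and c: "0 < c" "AE x in M. x \<in> S \<longrightarrow> c \<le> w x"
    and r: "1 < r" and h: "\<And>n. h n \<in> Lp r" and k: "k \<in> Lp r" and lim: "(\<lambda>n. Np r (\<lambda>x. h n x - k x)) \<longlonglongrightarrow> 0"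
    and \<psi>: "\<And>n. integrable M (\<psi> n)" "integrable M \<omega>"
    and le: "\<And>n x. x \<in> space M \<Longrightarrow> norm (\<psi> n x - \<omega> x) \<le> B * indicator S x * norm (h n x - k x)" and B: "0 \<le> B"
  shows "(\<lambda>n. \<integral>x. \<psi> n x \<partial>M) \<longlonglongrightarrow> (\<integral>x. \<omega> x \<partial>M)"
proof (rule LIMSEQ_I)
  fix e :: real assume e: "0 < e"
  \<comment> \<open>Chosen first, so that the part proportional to the measure of \<open>S\<close>
    is below \<open>e / 2\<close>; with \<open>\<epsilon>\<close> fixed, the other part tends to 0
    with \<open>Np\<close>.\<close>
  define \<epsilon> where "\<epsilon> = e / (2 * (B * measure M S + 1))"
  have m: "0 \<le> B * measure M S" using B by simp
  have \<epsilon>: "0 < \<epsilon>" using e m by (simp add: \<epsilon>_def)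
  have "B * (\<epsilon> * measure M S) = \<epsilon> * (B * measure M S)" by simp
  also have "\<dots> < \<epsilon> * (B * measure M S + 1)" using \<epsilon> by simp
  also have "\<dots> = e / 2" using m by (simp add: \<epsilon>_def field_simps)
  finally have 1: "B * (\<epsilon> * measure M S) < e / 2" .
  have r0: "0 < r" using r by simp
  have "(\<lambda>n. B * (\<epsilon> powr (1 - r) / c * Np r (\<lambda>x. h n x - k x))) \<longlonglongrightarrow> B * (\<epsilon> powr (1 - r) / c * 0)"
    by (intro tendsto_mult tendsto_const lim)
  then have "\<forall>\<^sub>F n in sequentially. B * (\<epsilon> powr (1 - r) / c * Np r (\<lambda>x. h n x - k x)) < e / 2"
    using e by (intro order_tendstoD(2)) auto
  then obtain n0 where n0: "\<And>n. n0 \<le> n \<Longrightarrow> B * (\<epsilon> powr (1 - r) / c * Np r (\<lambda>x. h n x - k x)) < e / 2"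
    unfolding eventually_sequentially by blast
  have "norm ((\<integral>x. \<psi> n x \<partial>M) - (\<integral>x. \<omega> x \<partial>M)) < e" if "n0 \<le> n" for n
  proof -
    have "norm (\<integral>x. \<psi> n x - \<omega> x \<partial>M) \<le> B * (\<epsilon> * measure M S + \<epsilon> powr (1 - r) / c * Np r (\<lambda>x. h n x - k x))"
      by (rule integrable_dominated_by_Lp(2)[OF S c r Lp_diff[OF r0 h k] _ le B \<epsilon>])
        (use \<psi>(1)[of n] \<psi>(2) in auto)
    also have "\<dots> < e" unfolding distrib_left using n0[OF that] 1 by linarith
    finally show ?thesis using \<psi> by simp
  qed
  then show "\<exists>no. \<forall>n\<ge>no. norm ((\<integral>x. \<psi> n x \<partial>M) - (\<integral>x. \<omega> x \<partial>M)) < e" by blast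
qed

end

lemma set_integrable_half_space_subset:
  fixes h :: "'n::finite space \<Rightarrow> 'v::euclidean_space"
  assumes S: "S \<subseteq> half_space" and h: "integrable (lebesgue_on half_space) (\<lambda>x. indicator S x *\<^sub>R h x)"
  shows "set_integrable lebesgue S h"
proof -
  have "integrable lebesgue (\<lambda>x. indicator half_space x *\<^sub>R (indicator S x *\<^sub>R h x))"
    using h by (subst (asm) integrable_restrict_space) simp_all
  moreover have "(\<lambda>x. indicator half_space x *\<^sub>R (indicator S x *\<^sub>R h x)) = (\<lambda>x. indicator S x *\<^sub>R h x)"
    using S by (auto simp: indicator_def fun_eq_iff)
  ultimately show ?thesis unfolding set_integrable_def by (simp only:)
qed

text \<open>Integrability on the intersections with balls includes measurability there, and the
  balls exhaust the half-space.\<close>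

lemma integrable_on_bounded_subsets_measurable:
  assumes "integrable_on_bounded_subsets (k :: 'n::finite space \<Rightarrow> real)"
  shows "k \<in> borel_measurable (lebesgue_on half_space)"
proof -
  have m: "(\<lambda>x. indicator (half_space \<inter> ball 0 (real n)) x *\<^sub>R k x) \<in> borel_measurable lebesgue" for n
  proof -
    have "half_space \<inter> ball 0 (real n) \<in> sets lebesgue \<and> bounded (half_space \<inter> ball 0 (real n))
        \<and> half_space \<inter> ball 0 (real n) \<subseteq> (half_space :: 'n space set)"
      by (auto intro: bounded_subset[OF bounded_ball])
    then have "set_integrable lebesgue (half_space \<inter> ball 0 (real n)) k"
      using assms unfolding integrable_on_bounded_subsets_def by blast
    then show ?thesis unfolding set_integrable_def by (rule borel_measurable_integrable)
  qed
  have lim: "(\<lambda>n. indicator (half_space \<inter> ball 0 (real n)) x *\<^sub>R k x) \<longlonglongrightarrow> indicator half_space x *\<^sub>R k x" for x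
  proof (rule tendsto_eventually)
    obtain n0 :: nat where "norm x < real n0" using reals_Archimedean2 by blast
    then show "\<forall>\<^sub>F n in sequentially. indicator (half_space \<inter> ball 0 (real n)) x *\<^sub>R k x = indicator half_space x *\<^sub>R k x"
      by (intro eventually_sequentiallyI[of n0]) (auto simp: indicator_def)
  qed
  have "(\<lambda>x. indicator half_space x *\<^sub>R k x) \<in> borel_measurable lebesgue"
    by (rule borel_measurable_LIMSEQ_real[OF lim m])
  then show ?thesis by (simp add: borel_measurable_restrict_space_iff)
qed

lemma Lp_of_bounded_support:
  fixes k :: "'n::finite space \<Rightarrow> real" and h :: "'n space \<Rightarrow> 'v::euclidean_space"
  assumes w: "weighted_measure (lebesgue_on half_space) k" and k: "integrable_on_bounded_subsets k"
    and h: "continuous_on UNIV h" "\<And>x. norm (h x) \<le> B" "\<And>x. R < norm x \<Longrightarrow> h x = 0" and r: "0 < r"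
  shows "h \<in> weighted_measure.Lp (lebesgue_on half_space) k r"
proof -
  interpret weighted_measure "lebesgue_on half_space" k by (rule w)
  show ?thesis
  proof (rule Lp_bound)
    show "h \<in> borel_measurable (lebesgue_on half_space)"
      by (intro continuous_imp_measurable_on_sets_lebesgue continuous_on_subset[OF h(1)]) auto
    have "half_space \<inter> cball 0 R \<in> sets lebesgue \<and> bounded (half_space \<inter> cball 0 R)
        \<and> half_space \<inter> cball 0 R \<subseteq> (half_space :: 'n space set)"
      by (auto intro: bounded_subset[OF bounded_cball])
    then have "set_integrable lebesgue (half_space \<inter> cball 0 R) k"
      using k unfolding integrable_on_bounded_subsets_def by blast
    then have "integrable lebesgue (\<lambda>x. indicator half_space x *\<^sub>R (indicator (cball 0 R) x * k x))"
      by (simp add: set_integrable_def indicator_inter_arith mult.assoc)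
    then have "integrable (lebesgue_on half_space) (\<lambda>x. indicator (cball 0 R) x * k x)"
      by (simp add: integrable_restrict_space)
    then show "integrable (lebesgue_on half_space) (\<lambda>x. B powr r * (indicator (cball 0 R) x * k x))" by simp
    fix x :: "'n space" assume x: "x \<in> space (lebesgue_on half_space)"
    show "k x * norm (h x) powr r \<le> B powr r * (indicator (cball 0 R) x * k x)"
    proof (cases "R < norm x")
      case False
      have "norm (h x) powr r \<le> B powr r" using h(2)[of x] r by (intro powr_mono2) auto
      then show ?thesis using False w_pos[OF x] by (simp add: mult.commute)
    qed (use h(3) r in simp)
  qed
qed

text \<open>Compares \<open>a\<close> from above and \<open>\<rho>\<close> from below with the model
  weights of \<open>Hardy_inequality\<close>. The weight \<open>a\<close> is arbitrary because two
  instances are needed: the coefficient itself, for coercivity, and the model weight, for membership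
  in \<open>weighted_Lp\<close>.\<close>

lemma Hardy_weights:
  fixes \<rho> a :: "'n::finite space \<Rightarrow> real"
  assumes p: "1 < p" and \<gamma>: "p - 1 < \<gamma>"
    and R: "weighted_measure (lebesgue_on half_space) \<rho>" and A: "weighted_measure (lebesgue_on half_space) a"
    and \<rho>\<^sub>0: "0 < \<rho>\<^sub>0" "AE x in lebesgue_on half_space. \<rho>\<^sub>0 * (1 + snd x) powr \<gamma> \<le> \<rho> x"
    and a: "AE x in lebesgue_on half_space. a x \<le> C * (1 + snd x) powr (\<gamma> - p)"
  obtains \<kappa> where "0 < \<kappa>" "\<And>f. f \<in> Cc_infinity UNIV \<Longrightarrow> grad f \<in> weighted_measure.Lp (lebesgue_on half_space) \<rho> p \<Longrightarrow>
    f \<in> weighted_measure.Lp (lebesgue_on half_space) a p \<Longrightarrow>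
    weighted_measure.Np (lebesgue_on half_space) a p f \<le> \<kappa> * weighted_measure.Np (lebesgue_on half_space) \<rho> p (grad f)"
proof -
  interpret R: weighted_measure "lebesgue_on half_space" \<rho> by (rule R)
  interpret A: weighted_measure "lebesgue_on half_space" a by (rule A)
  obtain K where K: "0 < K" "\<And>f :: 'n space \<Rightarrow> real. f \<in> Cc_infinity UNIV \<Longrightarrow>
    (\<integral>x. (1 + snd x) powr (\<gamma> - p) * \<bar>f x\<bar> powr p \<partial>lebesgue_on half_space)
    \<le> K * (\<integral>x. (1 + snd x) powr \<gamma> * norm (grad f x) powr p \<partial>lebesgue_on half_space)"
    using Hardy_inequality[OF p \<gamma>] by blast
  define C' where "C' = max C 1"
  have C': "0 < C'" "C \<le> C'" by (auto simp: C'_def)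
  show thesis
  proof (rule that[of "C' * K / \<rho>\<^sub>0"])
    show "0 < C' * K / \<rho>\<^sub>0" using K(1) C' \<rho>\<^sub>0 by simp
    fix f :: "'n space \<Rightarrow> real"
    assume f: "f \<in> Cc_infinity UNIV" "grad f \<in> R.Lp p" "f \<in> A.Lp p"
    have p0: "0 < p" using p by simp
    note i1 = Cc_weighted_integrable(1)[OF f(1) p0, of "\<gamma> - p"] and i2 = Cc_weighted_integrable(2)[OF f(1) p0, of \<gamma>]
    have "A.Np p f \<le> (\<integral>x. C' * ((1 + snd x) powr (\<gamma> - p) * \<bar>f x\<bar> powr p) \<partial>lebesgue_on half_space)"
      unfolding A.Np_def
    proof (rule integral_mono_AE)
      show "AE x in lebesgue_on half_space. a x * norm (f x) powr p \<le> C' * ((1 + snd x) powr (\<gamma> - p) * \<bar>f x\<bar> powr p)"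
        using a
      proof eventually_elim
        case (elim x)
        have "a x \<le> C' * (1 + snd x) powr (\<gamma> - p)" using elim mult_right_mono[OF C'(2), of "(1 + snd x) powr (\<gamma> - p)"] by simp
        then have "a x * \<bar>f x\<bar> powr p \<le> C' * (1 + snd x) powr (\<gamma> - p) * \<bar>f x\<bar> powr p" by (intro mult_right_mono) auto
        then show ?case by (simp add: mult.assoc)
      qed
    qed (use A.LpD(2)[OF f(3)] i1 in auto)
    also have "\<dots> = C' * (\<integral>x. (1 + snd x) powr (\<gamma> - p) * \<bar>f x\<bar> powr p \<partial>lebesgue_on half_space)" by simp
    also have "\<dots> \<le> C' * (K * (\<integral>x. (1 + snd x) powr \<gamma> * norm (grad f x) powr p \<partial>lebesgue_on half_space))"
      using C' by (intro mult_left_mono K(2) f) auto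
    also have "(\<integral>x. (1 + snd x) powr \<gamma> * norm (grad f x) powr p \<partial>lebesgue_on half_space)
      \<le> (\<integral>x. (\<rho> x * norm (grad f x) powr p) / \<rho>\<^sub>0 \<partial>lebesgue_on half_space)"
    proof (rule integral_mono_AE)
      show "AE x in lebesgue_on half_space. (1 + snd x) powr \<gamma> * norm (grad f x) powr p \<le> \<rho> x * norm (grad f x) powr p / \<rho>\<^sub>0"
        using \<rho>\<^sub>0(2)
      proof eventually_elim
        case (elim x)
        have "\<rho>\<^sub>0 * (1 + snd x) powr \<gamma> * norm (grad f x) powr p \<le> \<rho> x * norm (grad f x) powr p"
          using elim by (intro mult_right_mono) auto
        then show ?case using \<rho>\<^sub>0 by (simp add: field_simps)
      qed
    qed (use R.LpD(2)[OF f(2)] i2 in auto)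
    also have "\<dots> = R.Np p (grad f) / \<rho>\<^sub>0" unfolding R.Np_def by simp
    finally show "A.Np p f \<le> C' * K / \<rho>\<^sub>0 * R.Np p (grad f)" using C' K by (simp add: mult_left_mono)
  qed
qed

subsection \<open>The weak solution\<close>

theorem theorem2p6:
  fixes \<rho> a b :: "('n::finite) space \<Rightarrow> real"
    and p q s \<gamma> \<rho>\<^sub>0 :: real
    and N :: nat
  assumes N: "N = CARD('n) + 1"
    and p: "1 < p" "p \<le> real N"
    and pos: "\<forall>x\<in>half_space. 0 < \<rho> x \<and> 0 < a x \<and> 0 < b x"
    and loc_int: "integrable_on_bounded_subsets \<rho>" "integrable_on_bounded_subsets a"
      "integrable_on_bounded_subsets b"
    and \<rho>\<^sub>0: "0 < \<rho>\<^sub>0"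
    and \<gamma>: "p - 1 < \<gamma>"
    and lower_bound: "AE x in lebesgue_on half_space. \<rho>\<^sub>0 * (1 + snd x) powr \<gamma> \<le> \<rho> x"
    and cases:
      "(1 < q \<and> q < s \<and> s < p \<and>
        set_integrable lebesgue half_space a \<and> a \<in> K_b p \<gamma> \<and>
        set_integrable lebesgue half_space b \<and> b \<in> K_b p \<gamma>) \<or>
       (1 < q \<and> q < p \<and> p < s \<and> ereal s < critical_exponent N p \<and>
        set_integrable lebesgue half_space a \<and> a \<in> K_b p \<gamma> \<and>
        b \<in> K_0 p \<gamma>)"
  shows "\<exists>u. weak_solution \<rho> a b p \<gamma> q s u \<and>
           (AE x in lebesgue_on half_space. 0 \<le> u x) \<and>
           \<not> (AE x in lebesgue_on half_space. u x = 0)"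
proof -
  let ?M = "lebesgue_on (half_space :: 'n space set)"
  have q: "1 < q" "q < p" "q < s" and p1: "1 < p" and a_int: "integrable ?M a" and aK: "a \<in> K_b p \<gamma>"
    using cases p by (auto simp: set_integral_half_space)
  interpret R: weighted_measure ?M \<rho>
    using integrable_on_bounded_subsets_measurable[OF loc_int(1)] pos by unfold_locales auto
  interpret A: weighted_measure ?M a
    using integrable_on_bounded_subsets_measurable[OF loc_int(2)] pos by unfold_locales auto
  interpret B: weighted_measure ?M b
    using integrable_on_bounded_subsets_measurable[OF loc_int(3)] pos by unfold_locales auto
  note R = R.weighted_measure_axioms and A = A.weighted_measure_axioms and B = B.weighted_measure_axioms
  have CcLp: "f \<in> weighted_measure.Lp ?M k r" "grad f \<in> weighted_measure.Lp ?M k r"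
    if f: "f \<in> Cc_infinity UNIV" "weighted_measure ?M k" "integrable_on_bounded_subsets k" "0 < r"
    for f :: "'n space \<Rightarrow> real" and k r
  proof -
    obtain C S where C: "\<And>x. \<bar>f x\<bar> \<le> C" "\<And>x. norm (grad f x) \<le> C"
      "\<And>x. S < norm x \<Longrightarrow> f x = 0" "\<And>x. S < norm x \<Longrightarrow> grad f x = 0" "0 < C" using Cc_infinity_bounds[OF f(1)] by blast
    note s = Cc_infinityD(1)[OF f(1)]
    show "f \<in> weighted_measure.Lp ?M k r"
      by (rule Lp_of_bounded_support[OF f(2,3) continuous_on_smooth[OF s] _ C(3) f(4), of C]) (use C(1) in auto)
    show "grad f \<in> weighted_measure.Lp ?M k r"
      by (rule Lp_of_bounded_support[OF f(2,3) continuous_on_grad[OF s] C(2,4) f(4)])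
  qed
  obtain C where C: "AE x in ?M. \<bar>a x * (1 + snd x) powr (p - \<gamma>)\<bar> \<le> C" using aK by (auto simp: K_b_def)
  have aC: "AE x in ?M. a x \<le> C * (1 + snd x) powr (\<gamma> - p)"
    using C AE_space
  proof eventually_elim
    case (elim x)
    have y: "0 < 1 + snd x" using elim by (simp add: half_space_def)
    have "a x = a x * (1 + snd x) powr (p - \<gamma>) * (1 + snd x) powr (\<gamma> - p)"
      using y by (simp add: mult.assoc flip: powr_add)
    also have "\<dots> \<le> C * (1 + snd x) powr (\<gamma> - p)" using elim by (intro mult_right_mono) auto
    finally show ?case .
  qed
  obtain \<kappa> where \<kappa>: "0 < \<kappa>" "\<And>f. f \<in> Cc_infinity UNIV \<Longrightarrow> grad f \<in> R.Lp p \<Longrightarrow> f \<in> A.Lp p \<Longrightarrow> A.Np p f \<le> \<kappa> * R.Np p (grad f)"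
    using Hardy_weights[OF p1 \<gamma> R A \<rho>\<^sub>0 lower_bound aC] by blast
  \<comment> \<open>The weight of the space \<open>weighted_Lp\<close>, treated as a further
    weighted measure, so that Hardy's inequality and Fatou's lemma can place \<open>u\<close>
    there.\<close>
  define w :: "'n space \<Rightarrow> real" where "w x = (1 + snd x) powr (\<gamma> - p)" for x
  interpret W: weighted_measure ?M w
  proof
    show "w \<in> borel_measurable ?M" unfolding w_def
      by (rule continuous_imp_measurable_on_sets_lebesgue[OF _ half_space_lebesgue])
        (intro continuous_intros; auto simp: half_space_def)
    show "0 < w x" if "x \<in> space ?M" for x using that by (auto simp: w_def half_space_def)
  qed
  have wLp: "f \<in> W.Lp p" if f: "f \<in> Cc_infinity UNIV" for f
  proof -
    have "integrable ?M (\<lambda>x. w x * norm (f x) powr p)"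
      unfolding w_def real_norm_def using p1 by (intro Cc_weighted_integrable(1)[OF f]) simp
    moreover have "f \<in> borel_measurable ?M"
      by (intro continuous_imp_measurable_on_sets_lebesgue continuous_on_smooth[OF Cc_infinityD(1)[OF f]]) auto
    ultimately show ?thesis by (simp add: W.Lp_def)
  qed
  obtain \<kappa>' where \<kappa>': "0 < \<kappa>'" "\<And>f. f \<in> Cc_infinity UNIV \<Longrightarrow> grad f \<in> R.Lp p \<Longrightarrow> f \<in> W.Lp p \<Longrightarrow> W.Np p f \<le> \<kappa>' * R.Np p (grad f)"
    using Hardy_weights[OF p1 \<gamma> R W.weighted_measure_axioms \<rho>\<^sub>0 lower_bound, of 1] by (auto simp: w_def)
  have p0: "0 < p" using p1 by simp
  interpret V: variational_problem ?M \<rho> a b "Cc_infinity UNIV" grad p q s \<kappa>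
  proof
    fix f g :: "'n space \<Rightarrow> real" and c :: real
    assume f: "f \<in> Cc_infinity UNIV"
    show "grad f \<in> R.Lp p" "f \<in> A.Lp p" "f \<in> B.Lp s"
      using CcLp(2)[OF f R loc_int(1)] CcLp(1)[OF f A loc_int(2)] CcLp(1)[OF f B loc_int(3)] p q by auto
    then show "A.Np p f \<le> \<kappa> * R.Np p (grad f)" using \<kappa>(2)[OF f] by blast
    assume g: "g \<in> Cc_infinity UNIV"
    show "(\<lambda>x. f x + c * g x) \<in> Cc_infinity UNIV" by (rule Cc_infinity_add_scaled[OF f g])
    show "grad (\<lambda>x. f x + c * g x) = (\<lambda>x. grad f x + c *\<^sub>R grad g x)"
      using grad_add_scaled[OF Cc_infinityD(1)[OF f] Cc_infinityD(1)[OF g]] by (simp add: fun_eq_iff)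
    define d where "d n = 1 / real (Suc n)" for n
    have d: "0 < d n" for n by (simp add: d_def)
    have d0: "d \<longlonglongrightarrow> 0" unfolding d_def using LIMSEQ_Suc[OF lim_1_over_n[where 'a=real]] .
    have E: "R.Np p (grad (smooth_mean q (d n) f g)) \<le> (R.Np p (grad f) + R.Np p (grad g)) / 2" for n
    proof -
      note L = R.LpD(2)[OF CcLp(2)[OF f R loc_int(1) p0]] R.LpD(2)[OF CcLp(2)[OF g R loc_int(1) p0]]
        R.LpD(2)[OF CcLp(2)[OF smooth_mean_Cc[OF q(1) d f g] R loc_int(1) p0]]
      have "R.Np p (grad (smooth_mean q (d n) f g))
        \<le> (\<integral>x. (\<rho> x * norm (grad f x) powr p + \<rho> x * norm (grad g x) powr p) / 2 \<partial>?M)" unfolding R.Np_def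
      proof (rule integral_mono)
        fix x :: "'n space" assume x: "x \<in> space ?M"
        show "\<rho> x * norm (grad (smooth_mean q (d n) f g) x) powr p
          \<le> (\<rho> x * norm (grad f x) powr p + \<rho> x * norm (grad g x) powr p) / 2"
          using mult_left_mono[OF norm_grad_smooth_mean[OF q(1) d Cc_infinityD(1)[OF f] Cc_infinityD(1)[OF g], of p n x], of "\<rho> x"]
            R.w_pos[OF x] q by (simp add: distrib_left)
      qed (use L in auto)
      then show ?thesis unfolding R.Np_def using L by simp
    qed
    show "\<exists>w. (\<forall>n. w n \<in> Cc_infinity UNIV \<and> (\<forall>x. 0 \<le> w n x \<and> w n x \<le> \<bar>f x\<bar> + \<bar>g x\<bar>)
      \<and> R.Np p (grad (w n)) \<le> (R.Np p (grad f) + R.Np p (grad g)) / 2)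
      \<and> (\<forall>x. (\<lambda>n. w n x) \<longlonglongrightarrow> ((\<bar>f x\<bar> powr q + \<bar>g x\<bar> powr q) / 2) powr (1 / q))"
      by (rule exI[of _ "\<lambda>n. smooth_mean q (d n) f g"], intro conjI allI)
        (rule smooth_mean_Cc[OF q(1) d f g] smooth_mean_nonneg[OF q(1) d] smooth_mean_le[OF q(1) d] E
          smooth_mean_tendsto[OF q(1) d0])+
  next
    \<comment> \<open>Height 2 and radius 1 keep the ball inside the half-space, where
      \<open>a\<close> is positive.\<close>
    define c :: "'n space" where "c = (0, 2)"
    obtain f where f: "f \<in> Cc_infinity UNIV" "\<And>x. 0 \<le> f x" "\<And>x. x \<in> ball c 1 \<Longrightarrow> 0 < f x"
      using ex_bump[of c] by blast
    have q0: "0 < q" using q by simp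
    have ball: "ball c 1 \<subseteq> half_space"
    proof
      fix x assume "x \<in> ball c 1"
      then have "dist (snd c) (snd x) < 1" using dist_snd_le[of c x] by simp
      then have "\<bar>2 - snd x\<bar> < 1" by (simp add: c_def dist_real_def)
      then show "x \<in> half_space" by (simp add: half_space_def)
    qed
    have "A.Np q f \<noteq> 0"
    proof
      assume z: "A.Np q f = 0"
      have "AE x in ?M. 0 \<le> a x * norm (f x) powr q"
        by (rule AE_I2) (intro mult_nonneg_nonneg less_imp_le[OF A.w_pos] powr_ge_zero)
      from integral_nonneg_eq_0_iff_AE[OF A.LpD(2)[OF CcLp(1)[OF f(1) A loc_int(2) q0]] this] z
      have "AE x in ?M. a x * norm (f x) powr q = 0" unfolding A.Np_def by simp
      then have "AE x in ?M. x \<notin> ball c 1"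
        using AE_space
      proof eventually_elim
        case (elim x)
        then show ?case using f(3)[of x] A.w_pos[of x] by auto
      qed
      then have "AE x in lebesgue. x \<notin> ball c 1"
        using ball by (subst (asm) AE_restrict_space_iff) (auto elim!: eventually_mono)
      then have "negligible (ball c 1)"
        by (simp add: negligible_iff_null_sets AE_iff_null_sets)
      then show False using open_not_negligible[of "ball c 1"] by simp
    qed
    then have "0 < A.Np q f" using A.Np_nonneg[of q f] by simp
    then show "\<exists>f\<in>Cc_infinity UNIV. 0 < A.Np q f" using f(1) by blast
  qed (use q a_int \<kappa> in auto)
  obtain f u g where f: "\<And>n. f n \<in> Cc_infinity UNIV" and u0: "\<And>x. 0 \<le> u x" and ae: "AE x in ?M. (\<lambda>n. f n x) \<longlonglongrightarrow> u x"
    and uA: "u \<in> A.Lp q" and uB: "u \<in> B.Lp s" and g: "g \<in> R.Lp p"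
    and limA: "(\<lambda>n. A.Np q (\<lambda>x. f n x - u x)) \<longlonglongrightarrow> 0" and limR: "(\<lambda>n. R.Np p (\<lambda>x. grad (f n) x - g x)) \<longlonglongrightarrow> 0"
    and i1: "\<And>\<phi>. \<phi> \<in> Cc_infinity UNIV \<Longrightarrow> integrable ?M (\<lambda>x. \<rho> x * norm (g x) powr (p - 2) * (g x \<bullet> grad \<phi> x))"
    and i2: "\<And>\<phi>. \<phi> \<in> Cc_infinity UNIV \<Longrightarrow> integrable ?M (\<lambda>x. a x * \<bar>u x\<bar> powr (q - 2) * (u x * \<phi> x))"
    and i3: "\<And>\<phi>. \<phi> \<in> Cc_infinity UNIV \<Longrightarrow> integrable ?M (\<lambda>x. b x * \<bar>u x\<bar> powr (s - 2) * (u x * \<phi> x))"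
    and eq: "\<And>\<phi>. \<phi> \<in> Cc_infinity UNIV \<Longrightarrow> (\<integral>x. \<rho> x * norm (g x) powr (p - 2) * (g x \<bullet> grad \<phi> x) \<partial>?M)
      = (\<integral>x. a x * \<bar>u x\<bar> powr (q - 2) * (u x * \<phi> x) \<partial>?M) - (\<integral>x. b x * \<bar>u x\<bar> powr (s - 2) * (u x * \<phi> x) \<partial>?M)"
    and nz: "\<not> (AE x in ?M. u x = 0)"
    using V.minimizer by blast
  have gR: "grad (f n) \<in> R.Lp p" for n by (rule V.grad_Lp[OF f])
  have fA: "f n \<in> A.Lp q" for n by (rule V.a_Lp_q[OF f])
  have um: "u \<in> borel_measurable ?M" by (rule A.LpD(1)[OF uA])
  \<comment> \<open>The gradient energies of the sequence converge, hence are bounded; Hardy's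
    inequality bounds \<open>W.Np p (f n)\<close>, and Fatou's lemma passes the bound to
    \<open>u\<close>.\<close>
  have uW: "u \<in> W.Lp p"
  proof -
    obtain E where "\<forall>n. norm (R.Np p (grad (f n))) \<le> E"
      using convergent_imp_Bseq[OF convergentI[OF R.Np_tendsto[OF p0 gR g limR]]] by (auto elim!: BseqE)
    then have E: "R.Np p (grad (f n)) \<le> E" for n by (simp add: abs_le_iff)
    have bd: "W.Np p (f n) \<le> \<kappa>' * E" for n
      using \<kappa>'(2)[OF f gR wLp[OF f], of n] mult_left_mono[OF E[of n], of \<kappa>'] \<kappa>'(1) by linarith
    show ?thesis by (rule W.Lp_Fatou(1)[OF p0 wLp[OF f] um always_eventually ae]) (use bd in blast)
  qed
  have uw: "u \<in> weighted_Lp p \<gamma>"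
    using um W.LpD(2)[OF uW] by (simp add: weighted_Lp_def set_integral_half_space w_def mult.commute)
  \<comment> \<open>On compact subsets of the open half-space both weights are bounded away from 0:
    \<open>a\<close> by continuity and positivity, \<open>\<rho>\<close> by the assumed lower bound
    and \<open>\<gamma> > 0\<close>. So the weighted convergences imply convergence of local
    integrals.\<close>
  have cpt: "S \<in> sets ?M" "emeasure ?M S < \<infinity>" "\<exists>c>0. AE x in ?M. x \<in> S \<longrightarrow> c \<le> a x" "AE x in ?M. x \<in> S \<longrightarrow> \<rho>\<^sub>0 \<le> \<rho> x"
    if S: "compact S" "S \<subseteq> half_space" for S
  proof -
    have Sl: "S \<in> sets lebesgue" using S(1) by (intro sets_completionI_sets) (simp add: compact_imp_closed)
    then show "S \<in> sets ?M" using S(2) by (simp add: sets_restrict_space_iff)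
    have "S \<in> lmeasurable" by (rule lmeasurable_compact[OF S(1)])
    then show "emeasure ?M S < \<infinity>" using S by (simp add: emeasure_restrict_space fmeasurable_def del: emeasure_completion)
    show "\<exists>c>0. AE x in ?M. x \<in> S \<longrightarrow> c \<le> a x"
    proof (cases "S = {}")
      case False
      have "continuous_on S a" using aK S(2) closure_subset unfolding K_b_def by (blast intro: continuous_on_subset)
      then obtain x0 where "x0 \<in> S" "\<And>x. x \<in> S \<Longrightarrow> a x0 \<le> a x"
        using continuous_attains_inf[OF S(1) False] by blast
      then show ?thesis using pos S(2) by (intro exI[of _ "a x0"]) auto
    qed (auto intro!: exI[of _ 1])
    show "AE x in ?M. x \<in> S \<longrightarrow> \<rho>\<^sub>0 \<le> \<rho> x"
      using lower_bound AE_space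
    proof eventually_elim
      case (elim x)
      have "1 powr \<gamma> \<le> (1 + snd x) powr \<gamma>" using elim \<gamma> p1 by (intro powr_mono2) (auto simp: half_space_def)
      then have "\<rho>\<^sub>0 * 1 \<le> \<rho>\<^sub>0 * (1 + snd x) powr \<gamma>" using \<rho>\<^sub>0 by (intro mult_left_mono) auto
      then show ?case using elim by simp
    qed
  qed
  have wg: "has_weak_gradient half_space u g"
    unfolding has_weak_gradient_def
  proof (intro conjI ballI)
    show "locally_integrable half_space u" unfolding locally_integrable_def
    proof (intro allI impI)
      fix S :: "'n space set" assume S: "compact S \<and> S \<subseteq> half_space"
      then obtain c where c: "0 < c" "AE x in ?M. x \<in> S \<longrightarrow> c \<le> a x" using cpt(3) by blast
      have "integrable ?M (\<lambda>x. indicator S x *\<^sub>R u x)"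
        using A.Lp_integrable_on[OF cpt(1,2) c q(1) uA] S by blast
      then show "set_integrable lebesgue S u"
        using S by (intro set_integrable_half_space_subset) auto
    qed
    show "locally_integrable half_space g" unfolding locally_integrable_def
    proof (intro allI impI)
      fix S :: "'n space set" assume S: "compact S \<and> S \<subseteq> half_space"
      have "integrable ?M (\<lambda>x. indicator S x *\<^sub>R g x)"
        using R.Lp_integrable_on[OF cpt(1,2) \<rho>\<^sub>0 cpt(4) p1 g] S by blast
      then show "set_integrable lebesgue S g"
        using S by (intro set_integrable_half_space_subset) auto
    qed
    fix \<phi> :: "'n space \<Rightarrow> real" assume \<phi>: "\<phi> \<in> Cc_infinity half_space"
    obtain C S0 where C: "\<And>x. \<bar>\<phi> x\<bar> \<le> C" "\<And>x. norm (grad \<phi> x) \<le> C"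
      "\<And>x. S0 < norm x \<Longrightarrow> \<phi> x = 0" "\<And>x. S0 < norm x \<Longrightarrow> grad \<phi> x = 0" "0 < C" using Cc_infinity_bounds[OF \<phi>] by blast
    note s\<phi> = Cc_infinityD(1)[OF \<phi>]
    define S where "S = closure {x. \<phi> x \<noteq> 0}"
    have S: "compact S" "S \<subseteq> half_space" using \<phi> by (auto simp: Cc_infinity_def S_def)
    have out: "\<phi> x = 0" "grad \<phi> x = 0" if "x \<notin> S" for x
      using that closure_subset[of "{x. \<phi> x \<noteq> 0}"] grad_eq_0_outside_support[of x \<phi>] by (auto simp: S_def)
    have m: "\<phi> \<in> borel_measurable ?M" "grad \<phi> \<in> borel_measurable ?M"
      by (intro continuous_imp_measurable_on_sets_lebesgue continuous_on_smooth[OF s\<phi>] continuous_on_grad[OF s\<phi>] half_space_lebesgue)+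
    obtain c where c: "0 < c" "AE x in ?M. x \<in> S \<longrightarrow> c \<le> a x" using cpt(3)[OF S] by blast
    have C0: "0 \<le> C" using C(5) by simp
    have iu: "integrable ?M (\<lambda>x. h x *\<^sub>R grad \<phi> x)" if h: "h \<in> A.Lp q" for h
    proof (rule A.integrable_dominated_by_Lp(1)[OF cpt(1,2)[OF S] c q(1) h _ _ C0 zero_less_one])
      show "(\<lambda>x. h x *\<^sub>R grad \<phi> x) \<in> borel_measurable ?M" using m A.LpD(1)[OF h] by measurable
      show "norm (h x *\<^sub>R grad \<phi> x) \<le> C * indicator S x * norm (h x)" for x
        using mult_left_mono[OF C(2)[of x], of "\<bar>h x\<bar>"] out[of x] by (cases "x \<in> S") (simp_all add: mult.commute)
    qed
    have ig: "integrable ?M (\<lambda>x. \<phi> x *\<^sub>R h x)" if h: "h \<in> R.Lp p" for h :: "'n space \<Rightarrow> 'n space"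
    proof (rule R.integrable_dominated_by_Lp(1)[OF cpt(1,2)[OF S] \<rho>\<^sub>0 cpt(4)[OF S] p1 h _ _ C0 zero_less_one])
      show "(\<lambda>x. \<phi> x *\<^sub>R h x) \<in> borel_measurable ?M" using m R.LpD(1)[OF h] by measurable
      show "norm (\<phi> x *\<^sub>R h x) \<le> C * indicator S x * norm (h x)" for x
        using C(1)[of x] out[of x] by (cases "x \<in> S") (auto simp: mult_right_mono)
    qed
    \<comment> \<open>Both sides of the integration by parts for \<open>f n\<close> converge, since
      \<open>\<phi>\<close> and \<open>grad \<phi>\<close> are bounded and vanish off the compact
      set \<open>S\<close>; the limit is the identity that defines the weak gradient.\<close>
    have l1: "(\<lambda>n. \<integral>x. f n x *\<^sub>R grad \<phi> x \<partial>?M) \<longlonglongrightarrow> (\<integral>x. u x *\<^sub>R grad \<phi> x \<partial>?M)"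
    proof (rule A.integral_tendsto_of_Np_tendsto[OF cpt(1,2)[OF S] c q(1) fA uA limA iu[OF fA] iu[OF uA] _ C0])
      show "norm (f n x *\<^sub>R grad \<phi> x - u x *\<^sub>R grad \<phi> x) \<le> C * indicator S x * norm (f n x - u x)" for n x
        using mult_left_mono[OF C(2)[of x], of "\<bar>f n x - u x\<bar>"] out[of x]
        by (cases "x \<in> S") (simp_all add: mult.commute flip: scaleR_diff_left)
    qed
    have l2: "(\<lambda>n. \<integral>x. \<phi> x *\<^sub>R grad (f n) x \<partial>?M) \<longlonglongrightarrow> (\<integral>x. \<phi> x *\<^sub>R g x \<partial>?M)"
    proof (rule R.integral_tendsto_of_Np_tendsto[OF cpt(1,2)[OF S] \<rho>\<^sub>0 cpt(4)[OF S] p1 gR g limR ig[OF gR] ig[OF g] _ C0])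
      show "norm (\<phi> x *\<^sub>R grad (f n) x - \<phi> x *\<^sub>R g x) \<le> C * indicator S x * norm (grad (f n) x - g x)" for n x
        using C(1)[of x] out[of x] by (cases "x \<in> S") (auto simp: mult_right_mono simp flip: scaleR_diff_right)
    qed
    have "(\<integral>x. f n x *\<^sub>R grad \<phi> x \<partial>?M) = - (\<integral>x. \<phi> x *\<^sub>R grad (f n) x \<partial>?M)" for n
      using integral_grad_by_parts[OF f[of n] \<phi>] by (simp only: set_integral_half_space)
    then have "(\<lambda>n. \<integral>x. f n x *\<^sub>R grad \<phi> x \<partial>?M) \<longlonglongrightarrow> - (\<integral>x. \<phi> x *\<^sub>R g x \<partial>?M)" using tendsto_minus[OF l2] by simp
    then show "(LINT x:half_space|lebesgue. u x *\<^sub>R grad \<phi> x) = - (LINT x:half_space|lebesgue. \<phi> x *\<^sub>R g x)"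
      using LIMSEQ_unique[OF l1] by (simp only: set_integral_half_space)
  qed
  \<comment> \<open>The minimizing sequence itself supplies the approximating functions, by strong
    convergence of its gradients.\<close>
  have "u \<in> energy_space \<rho> p \<gamma>"
    unfolding energy_space_def mem_Collect_eq
  proof (intro conjI exI[of _ g] allI impI uw wg)
    fix \<epsilon> :: real assume \<epsilon>: "0 < \<epsilon>"
    then have "\<forall>\<^sub>F n in sequentially. R.Np p (\<lambda>x. grad (f n) x - g x) < \<epsilon> powr p"
      by (intro order_tendstoD(2)[OF limR]) simp
    then obtain n where n: "R.Np p (\<lambda>x. grad (f n) x - g x) < \<epsilon> powr p"
      using eventually_happens'[OF sequentially_bot] by blast
    have "(\<integral>\<^sup>+x\<in>half_space. ennreal (\<rho> x * norm (grad (f n) x - g x) powr p) \<partial>lebesgue)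
      = (\<integral>\<^sup>+x. ennreal (\<rho> x * norm (grad (f n) x - g x) powr p) \<partial>?M)"
      by (simp add: nn_integral_restrict_space)
    also have "\<dots> = ennreal (R.Np p (\<lambda>x. grad (f n) x - g x))"
      by (rule R.Np_nn_integral[OF R.Lp_diff[OF p0 gR g]])
    also have "\<dots> < ennreal (\<epsilon> powr p)" using n \<epsilon> by (intro ennreal_lessI) auto
    finally show "\<exists>\<phi>\<in>C_delta_infinity. (\<integral>\<^sup>+x\<in>half_space. ennreal (\<rho> x * norm (grad \<phi> x - g x) powr p) \<partial>lebesgue) < ennreal (\<epsilon> powr p)"
      using f[of n] unfolding C_delta_infinity_def by blast
  qed
  moreover have "set_integrable lebesgue half_space (\<lambda>x. \<rho> x * norm (g x) powr (p - 2) * (g x \<bullet> grad \<phi> x)) \<and>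
      set_integrable lebesgue half_space (\<lambda>x. (a x * \<bar>u x\<bar> powr (q - 2) * u x - b x * \<bar>u x\<bar> powr (s - 2) * u x) * \<phi> x) \<and>
      (LINT x:half_space|lebesgue. \<rho> x * norm (g x) powr (p - 2) * (g x \<bullet> grad \<phi> x)) =
      (LINT x:half_space|lebesgue. (a x * \<bar>u x\<bar> powr (q - 2) * u x - b x * \<bar>u x\<bar> powr (s - 2) * u x) * \<phi> x)"
    if "\<phi> \<in> C_delta_infinity" for \<phi>
  proof -
    have \<phi>: "\<phi> \<in> Cc_infinity UNIV" using that by (simp add: C_delta_infinity_def)
    have e: "(\<lambda>x. (a x * \<bar>u x\<bar> powr (q - 2) * u x - b x * \<bar>u x\<bar> powr (s - 2) * u x) * \<phi> x)
      = (\<lambda>x. a x * \<bar>u x\<bar> powr (q - 2) * (u x * \<phi> x) - b x * \<bar>u x\<bar> powr (s - 2) * (u x * \<phi> x))"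
      by (simp add: fun_eq_iff left_diff_distrib mult.assoc)
    show ?thesis unfolding e set_integral_half_space using i1[OF \<phi>] i2[OF \<phi>] i3[OF \<phi>] eq[OF \<phi>] by simp
  qed
  ultimately have "weak_solution \<rho> a b p \<gamma> q s u" using wg unfolding weak_solution_def by blast
  then show ?thesis using u0 nz by (intro exI[of _ u] conjI) auto
qed

end
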